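(* Let $\chi$ be an irreducible character of $W$ and let $0\ne v_\chi\in V_\chi$. The $\mathcal{H}$-module $L(\chi)$ is finite-dimensional if and only if there exists an integer $m\ge 0$ such that $E^m.v_\chi\in R_{2m}(\chi)$.
   Context: Let $\mathfrak{a}_{\mathbb{R}}$ be a real vector space of dimension $\ell\ge 1$, $R\subset\mathfrak{a}_{\mathbb{R}}^*$ a reduced root system, $W$ its Weyl group, $\mathfrak{a}=\mathbb{C}\otimes_{\mathbb{R}}\mathfrak{a}_{\mathbb{R}}$. For $\alpha\in R$ let $r_\alpha$ be the reflection and $\alpha^\vee\in\mathfrak{a}$ the coroot. Fix $k:R\to\mathbb{C}$, $\alpha\mapsto k_\alpha$, with $k_{w(\alpha)}=k_\alpha$ for all $w\in W$. Let $\mathcal{P}=S(\mathfrak{a}^* )=\bigoplus_{n\ge0}\mathcal{P}_n$, $\mathcal{P}_n=S^n(\mathfrak{a}^* )$, $\mathcal{P}_+=\bigoplus_{n\ge1}\mathcal{P}_n$, with its natural $W$-action. For $y\in\mathfrak{a}$, the Dunkl operator is $T_y=T_y(k)=\partial_y+\sum_{\alpha\in R^+}k_\alpha\frac{\langle\alpha,y\rangle}{\alpha}(1-r_\alpha)\in\mathrm{End}_{\mathbb{C}}(\mathcal{P})$, where $R^+$ is a system of positive roots. The rational Cherednik algebra $\mathcal{H}=\mathcal{H}(k)$ is the subalgebra of $\mathrm{End}_{\mathbb{C}}(\mathcal{P})$ generated by all $w\in W$, all multiplications by $x\in\mathfrak{a}^*$ and all $T_y$, $y\in\mathfrak{a}$.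 The map $y\mapsto T_y$ extends to an algebra isomorphism $T$ from $S(\mathfrak{a})$ onto $\mathcal{S}=\mathbb{C}[T_y:y\in\mathfrak{a}]$; put $\mathcal{S}_+=\bigoplus_{n\ge1}T(S^n(\mathfrak{a}))$. Multiplication gives $\mathcal{H}=\mathcal{P}\otimes\mathbb{C}W\otimes\mathcal{S}$ as vector spaces; $\mathcal{S}\otimes\mathbb{C}W$ denotes the subalgebra generated by $\mathcal{S}$ and $W$. For an irreducible character $\chi$ of $W$ let $V_\chi$ be an irreducible $W$-module of character $\chi$, made into an $\mathcal{S}\otimes\mathbb{C}W$-module by $\mathcal{S}_+V_\chi=0$. The Verma module is $M(\chi)=\mathcal{H}\otimes_{\mathcal{S}\otimes\mathbb{C}W}V_\chi$, identified with $\mathcal{P}\otimes V_\chi$ and graded by $M_n(\chi)=\mathcal{P}_n\otimes V_\chi$. It has a unique simple quotient $L(\chi)$. Let $B^*(x,z)=\sum_{\alpha\in R}\langle\alpha^\vee,x\rangle\langle\alpha^\vee,z\rangle$ on $\mathfrak{a}^*$ and let $B:\mathfrak{a}^*\to\mathfrak{a}$ be the isomorphism with $B^*(x,z)=\langle B(x),z\rangle$. There is an involutive anti-automorphism $\sigma$ of $\mathcal{H}$ with $\sigma(x)=T_{B(x)}$, $\sigma(T_y)=B^{-1}(y)$, $\sigma(w)=w^{-1}$. Let $\pi:\mathcal{H}\to\mathbb{C}W$ be the projection along $\mathcal{P}_+\mathcal{H}+\mathcal{H}\mathcal{S}_+$ (one has $\mathcal{H}=\mathbb{C}W\oplus(\mathcal{P}_+\mathcal{H}+\mathcal{H}\mathcal{S}_+)$)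 and $\beta(a,b)=\pi(\sigma(a)b)$. Fix a nondegenerate symmetric $W$-invariant bilinear form $(\cdot\mid\cdot)$ on $V_\chi$ and $0\neq v_\chi\in V_\chi$; then $(a.v_\chi,b.v_\chi)=(v_\chi\mid\beta(a,b).v_\chi)$, $a,b\in\mathcal{H}$, is a well-defined symmetric bilinear form on $M(\chi)=\mathcal{H}.v_\chi$. Let $R(\chi)$ be its radical (a graded $\mathcal{H}$-submodule of $M(\chi)$, independent of the choices) and $R_n(\chi)=R(\chi)\cap M_n(\chi)$. Let $z_1,\dots,z_\ell$ be a basis of $\mathfrak{a}_{\mathbb{R}}^*$ orthonormal for $B^*$; $E=\frac12\sum_{i=1}^\ell z_i^2\in\mathcal{P}_2\subset\mathcal{H}$. *)

theory Defs
  imports "HOL-Analysis.Analysis" "HOL-Library.Poly_Mapping"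
begin

text \<open>
  Both the real space and its dual are written in (mutually dual) coordinates as
  \<open>real ^ 'n\<close>, so that the pairing of a functional with a vector is \<open>\<bullet>\<close>;
  their complexifications are \<open>complex ^ 'n\<close> with the bilinear pairing below.
  The inner product plays no other role.
\<close>

definition pairing :: "complex ^ 'n \<Rightarrow> complex ^ 'n \<Rightarrow> complex" where
  "pairing x y = (\<Sum>i\<in>UNIV. x $ i * y $ i)"

definition cplx :: "real ^ 'n \<Rightarrow> complex ^ 'n" where
  "cplx x = (\<chi> i. complex_of_real (x $ i))"


section \<open>Root systems\<close>

text \<open>The intrinsic definition of Bourbaki, which uses no invariant inner product.\<close>

definition is_coroot :: "(real ^ 'n) set \<Rightarrow> real ^ 'n \<Rightarrow> real ^ 'n \<Rightarrow> bool" where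
  "is_coroot R \<alpha> c \<longleftrightarrow> \<alpha> \<bullet> c = 2 \<and> (\<lambda>x. x - (x \<bullet> c) *\<^sub>R \<alpha>) ` R \<subseteq> R"

definition root_system :: "(real ^ 'n) set \<Rightarrow> bool" where
  "root_system R \<longleftrightarrow> finite R \<and> 0 \<notin> R \<and> span R = UNIV \<and>
     (\<forall>\<alpha>\<in>R. \<exists>c. is_coroot R \<alpha> c \<and> (\<forall>\<beta>\<in>R. \<beta> \<bullet> c \<in> \<int>))"

definition reduced_root_system :: "(real ^ 'n) set \<Rightarrow> bool" where
  "reduced_root_system R \<longleftrightarrow> root_system R \<and>
     (\<forall>\<alpha>\<in>R. \<forall>t::real. t *\<^sub>R \<alpha> \<in> R \<longrightarrow> t = 1 \<or> t = -1)"

definition coroot :: "(real ^ 'n) set \<Rightarrow> real ^ 'n \<Rightarrow> real ^ 'n" where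
  "coroot R \<alpha> = (THE c. is_coroot R \<alpha> c)"

definition reflection :: "(real ^ 'n) set \<Rightarrow> real ^ 'n \<Rightarrow> real ^ 'n \<Rightarrow> real ^ 'n" where
  "reflection R \<alpha> x = x - (x \<bullet> coroot R \<alpha>) *\<^sub>R \<alpha>"

text \<open>Elements of the Weyl group are maps of the dual space, the space containing \<open>R\<close>.
  Closure under inverses is automatic as reflections are involutions.\<close>

inductive_set weyl_group :: "(real ^ 'n) set \<Rightarrow> (real ^ 'n \<Rightarrow> real ^ 'n) set"
  for R :: "(real ^ 'n) set" where
  weyl_id: "id \<in> weyl_group R"
| weyl_reflection: "\<alpha> \<in> R \<Longrightarrow> w \<in> weyl_group R \<Longrightarrow> reflection R \<alpha> \<circ> w \<in> weyl_group R"

definition positive_system :: "(real ^ 'n) set \<Rightarrow> (real ^ 'n) set \<Rightarrow> bool" where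
  "positive_system R Rp \<longleftrightarrow>
     (\<exists>y. (\<forall>\<alpha>\<in>R. \<alpha> \<bullet> y \<noteq> 0) \<and> Rp = {\<alpha>\<in>R. \<alpha> \<bullet> y > 0})"

definition Bstar :: "(real ^ 'n) set \<Rightarrow> complex ^ 'n \<Rightarrow> complex ^ 'n \<Rightarrow> complex" where
  "Bstar R x z =
     (\<Sum>\<alpha>\<in>R. pairing (cplx (coroot R \<alpha>)) x * pairing (cplx (coroot R \<alpha>)) z)"

definition Biso :: "(real ^ 'n) set \<Rightarrow> complex ^ 'n \<Rightarrow> complex ^ 'n" where
  "Biso R x = (THE y. \<forall>z. Bstar R x z = pairing y z)"


section \<open>The polynomial algebra and Dunkl operators\<close>

text \<open>The symmetric algebra of the complexified dual space, as the polynomial ring in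
  the coordinate functionals; a monomial is its exponent vector.\<close>

type_synonym 'n cpoly = "('n \<Rightarrow>\<^sub>0 nat) \<Rightarrow>\<^sub>0 complex"
type_synonym 'n oper = "'n cpoly \<Rightarrow> 'n cpoly"

definition Const :: "complex \<Rightarrow> 'n cpoly" where
  "Const c = Poly_Mapping.single 0 c"

definition linear_form :: "complex ^ 'n \<Rightarrow> 'n cpoly" where
  "linear_form x = (\<Sum>i\<in>UNIV. Poly_Mapping.single (Poly_Mapping.single i 1) (x $ i))"

definition mono_degree :: "('n::finite \<Rightarrow>\<^sub>0 nat) \<Rightarrow> nat" where
  "mono_degree e = (\<Sum>i\<in>UNIV. Poly_Mapping.lookup e i)"

definition homogeneous :: "nat \<Rightarrow> 'n::finite cpoly set" where
  "homogeneous n = {p. \<forall>e\<in>Poly_Mapping.keys p. mono_degree e = n}"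

definition poly_plus :: "'n::finite cpoly set" where
  "poly_plus = {p. \<forall>e\<in>Poly_Mapping.keys p. mono_degree e \<ge> 1}"

definition partial_deriv :: "'n \<Rightarrow> 'n cpoly \<Rightarrow> 'n cpoly" where
  "partial_deriv i p = (\<Sum>e\<in>Poly_Mapping.keys p.
     Poly_Mapping.single (e - Poly_Mapping.single i 1)
       (Poly_Mapping.lookup p e * of_nat (Poly_Mapping.lookup e i)))"

definition dir_deriv :: "complex ^ 'n \<Rightarrow> 'n cpoly \<Rightarrow> 'n cpoly" where
  "dir_deriv y p = (\<Sum>i\<in>UNIV. Const (y $ i) * partial_deriv i p)"

text \<open>The algebra endomorphism extending the linear map \<open>w\<close> of the dual space:
  it substitutes the linear form of \<open>w e\<^sub>i\<close> for the \<open>i\<close>-th variable.\<close>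

definition weyl_act :: "(real ^ 'n \<Rightarrow> real ^ 'n) \<Rightarrow> 'n::finite oper" where
  "weyl_act w p = (\<Sum>e\<in>Poly_Mapping.keys p. Const (Poly_Mapping.lookup p e) *
     (\<Prod>i\<in>UNIV. linear_form (cplx (w (axis i 1))) ^ Poly_Mapping.lookup e i))"

definition poly_quot :: "'n cpoly \<Rightarrow> 'n cpoly \<Rightarrow> 'n cpoly" where
  "poly_quot q l = (THE g. l * g = q)"

definition dunkl ::
  "(real ^ 'n) set \<Rightarrow> (real ^ 'n) set \<Rightarrow> (real ^ 'n \<Rightarrow> complex) \<Rightarrow> complex ^ 'n \<Rightarrow> 'n::finite oper" where
  "dunkl R Rp k y p = dir_deriv y p +
     (\<Sum>\<alpha>\<in>Rp. Const (k \<alpha> * pairing (cplx \<alpha>) y) *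
        poly_quot (p - weyl_act (reflection R \<alpha>) p) (linear_form (cplx \<alpha>)))"


section \<open>The rational Cherednik algebra\<close>

definition op_add :: "'n oper \<Rightarrow> 'n oper \<Rightarrow> 'n oper" where
  "op_add a b = (\<lambda>p. a p + b p)"

definition op_scale :: "complex \<Rightarrow> 'n oper \<Rightarrow> 'n oper" where
  "op_scale c a = (\<lambda>p. Const c * a p)"

definition op_mult :: "'n cpoly \<Rightarrow> 'n oper" where
  "op_mult q = (\<lambda>p. q * p)"

inductive_set cherednik ::
  "(real ^ 'n) set \<Rightarrow> (real ^ 'n) set \<Rightarrow> (real ^ 'n \<Rightarrow> complex) \<Rightarrow> 'n::finite oper set"
  for R Rp :: "(real ^ 'n) set" and k :: "real ^ 'n \<Rightarrow> complex" where
  cherednik_weyl: "w \<in> weyl_group R \<Longrightarrow> weyl_act w \<in> cherednik R Rp k"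
| cherednik_mult: "op_mult (linear_form x) \<in> cherednik R Rp k"
| cherednik_dunkl: "dunkl R Rp k y \<in> cherednik R Rp k"
| cherednik_add: "a \<in> cherednik R Rp k \<Longrightarrow> b \<in> cherednik R Rp k \<Longrightarrow> op_add a b \<in> cherednik R Rp k"
| cherednik_scale: "a \<in> cherednik R Rp k \<Longrightarrow> op_scale c a \<in> cherednik R Rp k"
| cherednik_comp: "a \<in> cherednik R Rp k \<Longrightarrow> b \<in> cherednik R Rp k \<Longrightarrow> a \<circ> b \<in> cherednik R Rp k"

text \<open>The span of all products of \<open>n \<ge> 1\<close> Dunkl operators, i.e. the image under \<open>T\<close>
  of the augmentation ideal of the symmetric algebra.\<close>

inductive_set dunkl_plus ::
  "(real ^ 'n) set \<Rightarrow> (real ^ 'n) set \<Rightarrow> (real ^ 'n \<Rightarrow> complex) \<Rightarrow> 'n::finite oper set"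
  for R Rp :: "(real ^ 'n) set" and k :: "real ^ 'n \<Rightarrow> complex" where
  dunkl_plus_gen: "dunkl R Rp k y \<in> dunkl_plus R Rp k"
| dunkl_plus_add: "a \<in> dunkl_plus R Rp k \<Longrightarrow> b \<in> dunkl_plus R Rp k \<Longrightarrow> op_add a b \<in> dunkl_plus R Rp k"
| dunkl_plus_scale: "a \<in> dunkl_plus R Rp k \<Longrightarrow> op_scale c a \<in> dunkl_plus R Rp k"
| dunkl_plus_comp: "a \<in> dunkl_plus R Rp k \<Longrightarrow> b \<in> dunkl_plus R Rp k \<Longrightarrow> a \<circ> b \<in> dunkl_plus R Rp k"

text \<open>The involutive anti-automorphism \<open>\<sigma>\<close> of the algebra; its values on generators
  determine it.\<close>

definition cherednik_involution ::
  "(real ^ 'n) set \<Rightarrow> (real ^ 'n) set \<Rightarrow> (real ^ 'n \<Rightarrow> complex) \<Rightarrow> ('n::finite oper \<Rightarrow> 'n oper) \<Rightarrow> bool" where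
  "cherednik_involution R Rp k \<sigma> \<longleftrightarrow>
     (\<forall>a\<in>cherednik R Rp k. \<sigma> a \<in> cherednik R Rp k \<and> \<sigma> (\<sigma> a) = a \<and>
        (\<forall>c. \<sigma> (op_scale c a) = op_scale c (\<sigma> a)) \<and>
        (\<forall>b\<in>cherednik R Rp k. \<sigma> (op_add a b) = op_add (\<sigma> a) (\<sigma> b) \<and> \<sigma> (a \<circ> b) = \<sigma> b \<circ> \<sigma> a)) \<and>
     (\<forall>x. \<sigma> (op_mult (linear_form x)) = dunkl R Rp k (Biso R x)) \<and>
     (\<forall>y. \<sigma> (dunkl R Rp k y) = op_mult (linear_form (inv (Biso R) y))) \<and>
     (\<forall>w\<in>weyl_group R. \<sigma> (weyl_act w) = weyl_act (inv w))"

text \<open>An element of the group algebra is given by its coefficients on the Weyl group.\<close>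

definition group_algebra_op ::
  "(real ^ 'n) set \<Rightarrow> ((real ^ 'n \<Rightarrow> real ^ 'n) \<Rightarrow> complex) \<Rightarrow> 'n::finite oper" where
  "group_algebra_op R c p = (\<Sum>w\<in>weyl_group R. Const (c w) * weyl_act w p)"

text \<open>The projection \<open>\<pi>\<close> onto the group algebra along
  \<open>\<P>\<^sub>+ \<H> + \<H> \<S>\<^sub>+\<close>: the linear map which is the identity on the group algebra and
  vanishes on all products spanning that sum.\<close>

definition cherednik_projection ::
  "(real ^ 'n) set \<Rightarrow> (real ^ 'n) set \<Rightarrow> (real ^ 'n \<Rightarrow> complex) \<Rightarrow>
     ('n::finite oper \<Rightarrow> (real ^ 'n \<Rightarrow> real ^ 'n) \<Rightarrow> complex) \<Rightarrow> bool" where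
  "cherednik_projection R Rp k \<pi> \<longleftrightarrow> (\<forall>w\<in>weyl_group R.
     (\<forall>a\<in>cherednik R Rp k. (\<forall>c. \<pi> (op_scale c a) w = c * \<pi> a w) \<and>
        (\<forall>b\<in>cherednik R Rp k. \<pi> (op_add a b) w = \<pi> a w + \<pi> b w) \<and>
        (\<forall>p\<in>poly_plus. \<pi> (op_mult p \<circ> a) w = 0) \<and>
        (\<forall>s\<in>dunkl_plus R Rp k. \<pi> (a \<circ> s) w = 0)) \<and>
     (\<forall>c. \<pi> (group_algebra_op R c) w = c w))"


section \<open>Modules over algebras of operators\<close>

text \<open>All algebras \<open>H\<close> of operators below contain the scalars, so scalar multiplication is
  part of the action and need not be listed separately.\<close>

record ('n, 'a) op_module =
  mcarrier :: "'a set"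
  mzero :: 'a
  madd :: "'a \<Rightarrow> 'a \<Rightarrow> 'a"
  mact :: "'n oper \<Rightarrow> 'a \<Rightarrow> 'a"

definition submodule :: "'n oper set \<Rightarrow> ('n, 'a) op_module \<Rightarrow> 'a set \<Rightarrow> bool" where
  "submodule H M N \<longleftrightarrow> N \<subseteq> mcarrier M \<and> mzero M \<in> N \<and>
     (\<forall>x\<in>N. \<forall>y\<in>N. madd M x y \<in> N) \<and> (\<forall>h\<in>H. \<forall>x\<in>N. mact M h x \<in> N)"

definition submodule_generated :: "'n oper set \<Rightarrow> ('n, 'a) op_module \<Rightarrow> 'a set \<Rightarrow> 'a set" where
  "submodule_generated H M X = \<Inter>{N. submodule H M N \<and> X \<subseteq> N}"

definition mcoset :: "('n, 'a) op_module \<Rightarrow> 'a set \<Rightarrow> 'a \<Rightarrow> 'a set" where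
  "mcoset M N x = {madd M x y | y. y \<in> N}"

definition quotient_module :: "('n, 'a) op_module \<Rightarrow> 'a set \<Rightarrow> ('n, 'a set) op_module" where
  "quotient_module M N =
     \<lparr> mcarrier = mcoset M N ` mcarrier M,
       mzero = mcoset M N (mzero M),
       madd = (\<lambda>A B. {madd M a b | a b. a \<in> A \<and> b \<in> B}),
       mact = (\<lambda>h A. {madd M (mact M h a) y | a y. a \<in> A \<and> y \<in> N}) \<rparr>"

definition simple_module :: "'n oper set \<Rightarrow> ('n, 'a) op_module \<Rightarrow> bool" where
  "simple_module H M \<longleftrightarrow> mcarrier M \<noteq> {mzero M} \<and>
     (\<forall>N. submodule H M N \<longrightarrow> N = {mzero M} \<or> N = mcarrier M)"

inductive_set mspan :: "('n, 'a) op_module \<Rightarrow> 'a set \<Rightarrow> 'a set"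
  for M :: "('n, 'a) op_module" and X :: "'a set" where
  mspan_zero: "mzero M \<in> mspan M X"
| mspan_step: "x \<in> X \<Longrightarrow> y \<in> mspan M X \<Longrightarrow> madd M (mact M (op_scale c id) x) y \<in> mspan M X"

definition finite_dimensional :: "('n, 'a) op_module \<Rightarrow> bool" where
  "finite_dimensional M \<longleftrightarrow>
     (\<exists>X. finite X \<and> X \<subseteq> mcarrier M \<and> mcarrier M \<subseteq> mspan M X)"


section \<open>Verma modules\<close>

text \<open>Irreducible modules of a finite group are finite-dimensional, so they are given by
  matrix representations on \<open>complex ^ 'm\<close>.\<close>

definition irreducible_rep ::
  "(real ^ 'n) set \<Rightarrow> ((real ^ 'n \<Rightarrow> real ^ 'n) \<Rightarrow> complex ^ 'm ^ 'm) \<Rightarrow> bool" where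
  "irreducible_rep R \<rho> \<longleftrightarrow> \<rho> id = mat 1 \<and>
     (\<forall>w\<in>weyl_group R. \<forall>w'\<in>weyl_group R. \<rho> (w \<circ> w') = \<rho> w ** \<rho> w') \<and>
     (\<forall>U. vec.subspace U \<and> (\<forall>w\<in>weyl_group R. \<forall>u\<in>U. \<rho> w *v u \<in> U) \<longrightarrow> U = {0} \<or> U = UNIV)"

text \<open>\<open>H \<otimes> V\<close> over the complex numbers, for \<open>V = complex ^ 'm\<close>, is \<open>H ^ 'm\<close>.\<close>

definition tensor_module :: "'n oper set \<Rightarrow> ('n, 'n oper ^ 'm) op_module" where
  "tensor_module H =
     \<lparr> mcarrier = {t. \<forall>i. t $ i \<in> H},
       mzero = (\<chi> i. (\<lambda>p. 0)),
       madd = (\<lambda>s t. \<chi> i. op_add (s $ i) (t $ i)),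
       mact = (\<lambda>h t. \<chi> i. h \<circ> (t $ i)) \<rparr>"

definition pure_tensor :: "'n oper \<Rightarrow> complex ^ 'm \<Rightarrow> 'n oper ^ 'm" where
  "pure_tensor a v = (\<chi> i. op_scale (v $ i) a)"

text \<open>Passing from \<open>H \<otimes> V\<close> over the complex numbers to the tensor product over
  \<open>\<S> \<otimes> \<complex>W\<close>: as this algebra is generated by \<open>W\<close> and
  \<open>\<S>\<^sub>+\<close>, and the latter annihilates \<open>V\<close>, it suffices to impose balancing for these elements.\<close>

definition balancing_relations ::
  "(real ^ 'n) set \<Rightarrow> (real ^ 'n) set \<Rightarrow> (real ^ 'n \<Rightarrow> complex) \<Rightarrow>
     ((real ^ 'n \<Rightarrow> real ^ 'n) \<Rightarrow> complex ^ 'm ^ 'm) \<Rightarrow> ('n::finite oper ^ 'm) set" where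
  "balancing_relations R Rp k \<rho> =
     {madd (tensor_module (cherednik R Rp k)) (pure_tensor (a \<circ> weyl_act w) v) (pure_tensor a (- (\<rho> w *v v)))
        | a w v. a \<in> cherednik R Rp k \<and> w \<in> weyl_group R} \<union>
     {pure_tensor (a \<circ> s) v | a s v. a \<in> cherednik R Rp k \<and> s \<in> dunkl_plus R Rp k}"

definition verma_kernel ::
  "(real ^ 'n) set \<Rightarrow> (real ^ 'n) set \<Rightarrow> (real ^ 'n \<Rightarrow> complex) \<Rightarrow>
     ((real ^ 'n \<Rightarrow> real ^ 'n) \<Rightarrow> complex ^ 'm ^ 'm) \<Rightarrow> ('n::finite oper ^ 'm) set" where
  "verma_kernel R Rp k \<rho> = submodule_generated (cherednik R Rp k)
     (tensor_module (cherednik R Rp k)) (balancing_relations R Rp k \<rho>)"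

definition verma ::
  "(real ^ 'n) set \<Rightarrow> (real ^ 'n) set \<Rightarrow> (real ^ 'n \<Rightarrow> complex) \<Rightarrow>
     ((real ^ 'n \<Rightarrow> real ^ 'n) \<Rightarrow> complex ^ 'm ^ 'm) \<Rightarrow> ('n::finite, ('n oper ^ 'm) set) op_module" where
  "verma R Rp k \<rho> =
     quotient_module (tensor_module (cherednik R Rp k)) (verma_kernel R Rp k \<rho>)"

definition verma_class ::
  "(real ^ 'n) set \<Rightarrow> (real ^ 'n) set \<Rightarrow> (real ^ 'n \<Rightarrow> complex) \<Rightarrow>
     ((real ^ 'n \<Rightarrow> real ^ 'n) \<Rightarrow> complex ^ 'm ^ 'm) \<Rightarrow> 'n::finite oper ^ 'm \<Rightarrow> ('n oper ^ 'm) set" where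
  "verma_class R Rp k \<rho> t =
     mcoset (tensor_module (cherednik R Rp k)) (verma_kernel R Rp k \<rho>) t"

text \<open>The image of \<open>\<P>\<^sub>n \<otimes> V\<close>, where \<open>\<P>\<^sub>n \<otimes> complex ^ 'm\<close> is \<open>\<P>\<^sub>n ^ 'm\<close>.\<close>

definition verma_grade ::
  "(real ^ 'n) set \<Rightarrow> (real ^ 'n) set \<Rightarrow> (real ^ 'n \<Rightarrow> complex) \<Rightarrow>
     ((real ^ 'n \<Rightarrow> real ^ 'n) \<Rightarrow> complex ^ 'm ^ 'm) \<Rightarrow> nat \<Rightarrow> ('n::finite oper ^ 'm) set set" where
  "verma_grade R Rp k \<rho> n =
     {verma_class R Rp k \<rho> (\<chi> i. op_mult (p i)) | p. \<forall>i. p i \<in> homogeneous n}"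

definition simple_quotient ::
  "(real ^ 'n) set \<Rightarrow> (real ^ 'n) set \<Rightarrow> (real ^ 'n \<Rightarrow> complex) \<Rightarrow>
     ((real ^ 'n \<Rightarrow> real ^ 'n) \<Rightarrow> complex ^ 'm ^ 'm) \<Rightarrow> ('n::finite, ('n oper ^ 'm) set set) op_module" where
  "simple_quotient R Rp k \<rho> = quotient_module (verma R Rp k \<rho>)
     (THE J. submodule (cherednik R Rp k) (verma R Rp k \<rho>) J \<and>
             simple_module (cherednik R Rp k) (quotient_module (verma R Rp k \<rho>) J))"


section \<open>The contravariant form\<close>

definition invariant_form ::
  "(real ^ 'n) set \<Rightarrow> ((real ^ 'n \<Rightarrow> real ^ 'n) \<Rightarrow> complex ^ 'm ^ 'm) \<Rightarrow>
     (complex ^ 'm \<Rightarrow> complex ^ 'm \<Rightarrow> complex) \<Rightarrow> bool" where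
  "invariant_form R \<rho> f \<longleftrightarrow>
     (\<forall>u v v' c. f u (v + v') = f u v + f u v' \<and> f u (c *s v) = c * f u v) \<and>
     (\<forall>u v. f u v = f v u) \<and>
     (\<forall>u. (\<forall>v. f u v = 0) \<longrightarrow> u = 0) \<and>
     (\<forall>w\<in>weyl_group R. \<forall>u v. f (\<rho> w *v u) (\<rho> w *v v) = f u v)"

definition group_algebra_act ::
  "(real ^ 'n) set \<Rightarrow> ((real ^ 'n \<Rightarrow> real ^ 'n) \<Rightarrow> complex ^ 'm ^ 'm) \<Rightarrow>
     ((real ^ 'n \<Rightarrow> real ^ 'n) \<Rightarrow> complex) \<Rightarrow> complex ^ 'm \<Rightarrow> complex ^ 'm" where
  "group_algebra_act R \<rho> c v = (\<Sum>w\<in>weyl_group R. c w *s (\<rho> w *v v))"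

text \<open>\<open>verma_orbit \<dots> v a\<close> is the element \<open>a.v\<close> of the Verma module, for \<open>v\<close> in \<open>V\<close>.\<close>

definition verma_orbit ::
  "(real ^ 'n) set \<Rightarrow> (real ^ 'n) set \<Rightarrow> (real ^ 'n \<Rightarrow> complex) \<Rightarrow>
     ((real ^ 'n \<Rightarrow> real ^ 'n) \<Rightarrow> complex ^ 'm ^ 'm) \<Rightarrow> complex ^ 'm \<Rightarrow> 'n::finite oper \<Rightarrow>
     ('n oper ^ 'm) set" where
  "verma_orbit R Rp k \<rho> v a = mact (verma R Rp k \<rho>) a (verma_class R Rp k \<rho> (pure_tensor id v))"

text \<open>\<open>(a.v, b.v) = (v | \<beta>(a,b).v)\<close> with \<open>\<beta>(a,b) = \<pi>(\<sigma>(a) b)\<close>; the value does not depend on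
  the representatives \<open>a\<close> and \<open>b\<close>.\<close>

definition verma_form ::
  "(real ^ 'n) set \<Rightarrow> (real ^ 'n) set \<Rightarrow> (real ^ 'n \<Rightarrow> complex) \<Rightarrow>
     ((real ^ 'n \<Rightarrow> real ^ 'n) \<Rightarrow> complex ^ 'm ^ 'm) \<Rightarrow> ('n::finite oper \<Rightarrow> 'n oper) \<Rightarrow>
     ('n oper \<Rightarrow> (real ^ 'n \<Rightarrow> real ^ 'n) \<Rightarrow> complex) \<Rightarrow>
     (complex ^ 'm \<Rightarrow> complex ^ 'm \<Rightarrow> complex) \<Rightarrow> complex ^ 'm \<Rightarrow>
     ('n oper ^ 'm) set \<Rightarrow> ('n oper ^ 'm) set \<Rightarrow> complex" where
  "verma_form R Rp k \<rho> \<sigma> \<pi> f v X Y =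
     (let a = (SOME a. a \<in> cherednik R Rp k \<and> verma_orbit R Rp k \<rho> v a = X);
          b = (SOME b. b \<in> cherednik R Rp k \<and> verma_orbit R Rp k \<rho> v b = Y)
      in f v (group_algebra_act R \<rho> (\<pi> (\<sigma> a \<circ> b)) v))"

definition verma_radical ::
  "(real ^ 'n) set \<Rightarrow> (real ^ 'n) set \<Rightarrow> (real ^ 'n \<Rightarrow> complex) \<Rightarrow>
     ((real ^ 'n \<Rightarrow> real ^ 'n) \<Rightarrow> complex ^ 'm ^ 'm) \<Rightarrow> ('n::finite oper \<Rightarrow> 'n oper) \<Rightarrow>
     ('n oper \<Rightarrow> (real ^ 'n \<Rightarrow> real ^ 'n) \<Rightarrow> complex) \<Rightarrow>
     (complex ^ 'm \<Rightarrow> complex ^ 'm \<Rightarrow> complex) \<Rightarrow> complex ^ 'm \<Rightarrow> ('n oper ^ 'm) set set" where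
  "verma_radical R Rp k \<rho> \<sigma> \<pi> f v =
     {X \<in> mcarrier (verma R Rp k \<rho>). \<forall>Y\<in>mcarrier (verma R Rp k \<rho>).
        verma_form R Rp k \<rho> \<sigma> \<pi> f v X Y = 0}"

definition radical_grade ::
  "(real ^ 'n) set \<Rightarrow> (real ^ 'n) set \<Rightarrow> (real ^ 'n \<Rightarrow> complex) \<Rightarrow>
     ((real ^ 'n \<Rightarrow> real ^ 'n) \<Rightarrow> complex ^ 'm ^ 'm) \<Rightarrow> ('n::finite oper \<Rightarrow> 'n oper) \<Rightarrow>
     ('n oper \<Rightarrow> (real ^ 'n \<Rightarrow> real ^ 'n) \<Rightarrow> complex) \<Rightarrow>
     (complex ^ 'm \<Rightarrow> complex ^ 'm \<Rightarrow> complex) \<Rightarrow> complex ^ 'm \<Rightarrow> nat \<Rightarrow> ('n oper ^ 'm) set set" where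
  "radical_grade R Rp k \<rho> \<sigma> \<pi> f v n =
     verma_radical R Rp k \<rho> \<sigma> \<pi> f v \<inter> verma_grade R Rp k \<rho> n"

definition orthonormal_basis :: "(real ^ 'n) set \<Rightarrow> ('n \<Rightarrow> real ^ 'n) \<Rightarrow> bool" where
  "orthonormal_basis R z \<longleftrightarrow> inj z \<and> independent (range z) \<and> span (range z) = UNIV \<and>
     (\<forall>i j. Bstar R (cplx (z i)) (cplx (z j)) = (if i = j then 1 else 0))"

definition E_poly :: "('n \<Rightarrow> real ^ 'n) \<Rightarrow> 'n::finite cpoly" where
  "E_poly z = Const (1/2) * (\<Sum>i\<in>UNIV. linear_form (cplx (z i)) ^ 2)"

end

theory Submission
  imports Defs "HOL-Library.Function_Algebras" "HOL-Computational_Algebra.Fundamental_Theorem_Algebra"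
begin

text \<open>
  The simple quotient is \<open>M(\<chi>)\<close> modulo the radical of the contravariant form, which is its
  largest proper submodule because the Euler operator lies in the algebra and acts by a scalar on
  the lowest degree. Since \<open>E\<close> is invariant under the group, \<open>E\<^sup>m.v\<close> lies in the radical iff the
  ideal of elements annihilating the simple quotient contains \<open>E\<^sup>m\<close>. The key relation is
  \<open>[T\<^sub>y, f(E)] = f'(E) x\<close>, where \<open>x\<close> is the linear form with \<open>B x = y\<close>; it has no
  contribution from the reflections. Commuting \<open>p E\<^sup>a\<^sup>+\<^sup>1\<close> with \<open>T\<^sub>y\<close> shows inductively that the
  annihilator contains all products of \<open>2j\<close> linear forms with \<open>E\<^sup>m\<^sup>-\<^sup>j\<close>, hence for \<open>j = m\<close> all
  polynomials of degree \<open>2m\<close>, so that the quotient is finite-dimensional. Conversely, if it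
  is finite-dimensional, take \<open>f\<close> of least degree with \<open>f(E)\<close> in the annihilator;
  then \<open>f'(E) E\<close> is in it too, which forces \<open>f\<close> to be a multiple of \<open>X\<^sup>m\<close>.
\<close>

section \<open>Polynomials\<close>

text \<open>Sorting products yields only the spanning half of the decomposition of \<open>H\<close>
  into polynomials, group and Dunkl operators; the independence half enters through the projection
  \<open>\<pi>\<close>. It induces a linear map \<open>\<Phi>\<close> from the tensor module to V
  that reads off the component of degree 0, and the radical becomes the largest submodule
  \<open>J0\<close> inside the kernel of \<open>\<Phi>\<close>. Computations are made with
  representatives in the tensor module over the complex numbers, so the nested quotients behind
  \<open>simple_quotient\<close> are collapsed once and then avoided. The annihilator is used
  instead of the radical because a commutator with a Dunkl operator also multiplies on the right,
  under which only a two-sided ideal is stable. For invariant polynomials the two conditions agree: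
  by irreducibility, what holds at the one vector \<open>v\<close> holds on the whole module. The
  obstacle in the first direction is that the other factor \<open>p\<close> of
  \<open>p E^(a+1)\<close> is not invariant, so its commutators contain reflections. They are
  harmless because a reflection preserves both \<open>E\<close> and the number of linear forms in a
  product.\<close>

definition Var :: "'n \<Rightarrow> 'n cpoly" where
  "Var i = Poly_Mapping.single (Poly_Mapping.single i 1) 1"

lemma Const_add: "Const (a + b) = Const a + Const b"
  by (simp add: Const_def single_add)

lemma Const_mult: "Const (a * b) = Const a * Const b"
  by (simp add: Const_def mult_single)

lemma Const_0 [simp]: "Const 0 = 0" and Const_1 [simp]: "Const 1 = 1"
  by (simp_all add: Const_def)

lemma Const_minus: "Const (- a) = - Const a"
  by (simp add: Const_def single_uminus)

lemma Const_diff: "Const (a - b) = Const a - Const b"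
  by (simp add: Const_def single_diff)

lemma Const_sum: "Const (\<Sum>i\<in>A. f i) = (\<Sum>i\<in>A. Const (f i))"
  by (induction A rule: infinite_finite_induct) (simp_all add: Const_add)

lemma Const_of_nat: "Const (of_nat n) = of_nat n"
  by (simp add: Const_def)

lemma lookup_Const_mult: "Poly_Mapping.lookup (Const c * q) e = c * Poly_Mapping.lookup q e"
proof -
  have "Const c * q = Poly_Mapping.map ((*) c) q"
    by (simp add: Const_def mult_map_scale_conv_mult)
  then show ?thesis
    by (simp add: Poly_Mapping.map.rep_eq when_def)
qed

lemma Const_mult_single: "Const c * Poly_Mapping.single e a = Poly_Mapping.single e (c * a)"
  by (simp add: Const_def mult_single)

lemma cpoly_eq_sum_single:
  assumes "finite A" "Poly_Mapping.keys p \<subseteq> A"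
  shows "p = (\<Sum>e\<in>A. Poly_Mapping.single e (Poly_Mapping.lookup p e))"
proof (rule poly_mapping_eqI)
  fix e
  have "Poly_Mapping.lookup (\<Sum>e\<in>A. Poly_Mapping.single e (Poly_Mapping.lookup p e)) e
      = (\<Sum>e'\<in>A. if e' = e then Poly_Mapping.lookup p e' else 0)"
    by (simp add: lookup_sum lookup_single when_def)
  also have "\<dots> = Poly_Mapping.lookup p e"
    using assms by (auto simp: in_keys_iff)
  finally show "Poly_Mapping.lookup p e =
      Poly_Mapping.lookup (\<Sum>e\<in>A. Poly_Mapping.single e (Poly_Mapping.lookup p e)) e"
    by simp
qed

lemma Var_power: "Var i ^ n = Poly_Mapping.single (Poly_Mapping.single i n) 1"
  by (induction n) (simp_all add: Var_def mult_single flip: single_add)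

lemma prod_single: "finite A \<Longrightarrow> (\<Prod>i\<in>A. Poly_Mapping.single (f i) (1::'b::comm_semiring_1))
    = Poly_Mapping.single (\<Sum>i\<in>A. f i :: 'a::comm_monoid_add) 1"
  by (induction A rule: finite_induct) (simp_all add: mult_single)

lemma single_eq_prod_Var:
  fixes e :: "'n::finite \<Rightarrow>\<^sub>0 nat"
  shows "Poly_Mapping.single e c = Const c * (\<Prod>i\<in>UNIV. Var i ^ Poly_Mapping.lookup e i)"
proof -
  have "(\<Sum>i\<in>UNIV. Poly_Mapping.single i (Poly_Mapping.lookup e i)) = e"
    by (rule poly_mapping_eqI) (simp add: lookup_sum lookup_single when_def)
  then show ?thesis
    by (simp add: Var_power prod_single Const_mult_single)
qed

text \<open>Polynomials are generated as an algebra by constants and variables. Identities between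
  homomorphisms or derivations, and membership in \<open>H\<close>, thereby reduce to
  generators.\<close>

lemma cpoly_induct [case_names Const Var add mult]:
  fixes p :: "'n::finite cpoly"
  assumes "\<And>c. P (Const c)" "\<And>i. P (Var i)"
    and add: "\<And>p q. P p \<Longrightarrow> P q \<Longrightarrow> P (p + q)" and mult: "\<And>p q. P p \<Longrightarrow> P q \<Longrightarrow> P (p * q)"
  shows "P p"
proof -
  have pow: "P (Var i ^ n)" for i n
    by (induction n) (use assms(1)[of 1] assms(2) mult in auto)
  have prod: "P (\<Prod>i\<in>A. Var i ^ f i)" if "finite A" for A f
    using that by (induction A rule: finite_induct) (use assms(1)[of 1] pow mult in auto)
  have single: "P (Poly_Mapping.single e c)" for e c
    unfolding single_eq_prod_Var by (intro mult assms prod) auto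
  have sum: "P (\<Sum>e\<in>A. Poly_Mapping.single e (f e))" if "finite A" for A f
    using that by (induction A rule: finite_induct) (use assms(1)[of 0] single add in auto)
  show ?thesis
    using sum[of "Poly_Mapping.keys p" "Poly_Mapping.lookup p"]
    by (simp flip: cpoly_eq_sum_single)
qed

lemma lookup_Var_mult:
  "Poly_Mapping.lookup (Var i * q) e =
     (if Poly_Mapping.lookup e i = 0 then 0 else Poly_Mapping.lookup q (e - Poly_Mapping.single i 1))"
proof -
  have eq: "e' + Poly_Mapping.single i 1 = e \<longleftrightarrow>
      Poly_Mapping.lookup e i \<noteq> 0 \<and> e' = e - Poly_Mapping.single i 1" for e'
  proof
    assume "e' + Poly_Mapping.single i 1 = e"
    then show "Poly_Mapping.lookup e i \<noteq> 0 \<and> e' = e - Poly_Mapping.single i 1"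
      by (auto simp: lookup_add)
  next
    assume "Poly_Mapping.lookup e i \<noteq> 0 \<and> e' = e - Poly_Mapping.single i 1"
    then show "e' + Poly_Mapping.single i 1 = e"
      by (intro poly_mapping_eqI) (auto simp: lookup_add lookup_minus lookup_single when_def)
  qed
  \<comment> \<open>Adjoining this exponent puts the only index that can contribute into the range,
    whether or not it lies in the support of \<open>q\<close>.\<close>
  define K where "K = insert (e - Poly_Mapping.single i 1) (Poly_Mapping.keys q)"
  have "q = (\<Sum>e\<in>K. Poly_Mapping.single e (Poly_Mapping.lookup q e))"
    by (rule cpoly_eq_sum_single) (auto simp: K_def)
  then have "Var i * q = (\<Sum>e\<in>K. Var i * Poly_Mapping.single e (Poly_Mapping.lookup q e))"
    by (metis sum_distrib_left)
  then have "Var i * q =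
      (\<Sum>e'\<in>K. Poly_Mapping.single (e' + Poly_Mapping.single i 1) (Poly_Mapping.lookup q e'))"
    by (simp add: Var_def mult_single add.commute)
  then have "Poly_Mapping.lookup (Var i * q) e =
      (\<Sum>e'\<in>K. if e' + Poly_Mapping.single i 1 = e then Poly_Mapping.lookup q e' else 0)"
    by (simp only: lookup_sum lookup_single when_def)
  then show ?thesis
    unfolding eq by (auto simp: K_def sum.If_cases sum.delta)
qed

lemma linear_form_eq_Var: "linear_form x = (\<Sum>i\<in>UNIV. Const (x $ i) * Var i)"
  by (simp add: linear_form_def Var_def Const_mult_single)

lemma linear_form_add: "linear_form (x + y) = linear_form x + linear_form y"
  by (simp add: linear_form_eq_Var Const_add distrib_right sum.distrib)

lemma linear_form_scale: "linear_form (c *s x) = Const c * linear_form x"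
  by (simp add: linear_form_eq_Var Const_mult sum_distrib_left mult.assoc)

lemma linear_form_0 [simp]: "linear_form 0 = 0"
  by (simp add: linear_form_eq_Var)

lemma linear_form_diff: "linear_form (x - y) = linear_form x - linear_form y"
  by (simp add: linear_form_eq_Var Const_diff left_diff_distrib sum_subtractf)

lemma linear_form_sum: "linear_form (\<Sum>i\<in>A. f i) = (\<Sum>i\<in>A. linear_form (f i))"
  by (induction A rule: infinite_finite_induct) (simp_all add: linear_form_add)

lemma linear_form_axis: "linear_form (axis i 1) = Var i"
proof -
  have "linear_form (axis i 1) = (\<Sum>j\<in>UNIV. if j = i then Var j else 0)"
    unfolding linear_form_eq_Var by (intro sum.cong) (auto simp: axis_def)
  then show ?thesis by simp
qed

text \<open>Among the monomials of \<open>g\<close> take one of maximal degree in a variable occurring in the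
  linear form; multiplied by that variable it yields a monomial that cannot cancel.\<close>

lemma linear_form_mult_eq_0:
  fixes g :: "'n::finite cpoly"
  assumes "x \<noteq> 0" "linear_form x * g = 0"
  shows "g = 0"
proof (rule ccontr)
  assume "g \<noteq> 0"
  obtain j where j: "x $ j \<noteq> 0"
    using assms(1) by (auto simp: vec_eq_iff)
  have "Poly_Mapping.keys g \<noteq> {}" using \<open>g \<noteq> 0\<close>
    by (metis in_keys_iff lookup_zero poly_mapping_eqI empty_iff)
  define D where "D = Max ((\<lambda>e. Poly_Mapping.lookup e j) ` Poly_Mapping.keys g)"
  have "D \<in> (\<lambda>e. Poly_Mapping.lookup e j) ` Poly_Mapping.keys g"
    unfolding D_def by (rule Max_in) (use \<open>Poly_Mapping.keys g \<noteq> {}\<close> in auto)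
  then obtain e where e: "e \<in> Poly_Mapping.keys g" "Poly_Mapping.lookup e j = D" by auto
  have max: "Poly_Mapping.lookup e' j \<le> D" if "e' \<in> Poly_Mapping.keys g" for e'
    unfolding D_def using that by auto
  define e1 where "e1 = e + Poly_Mapping.single j 1"
  have "0 = Poly_Mapping.lookup (linear_form x * g) e1"
    using assms(2) by simp
  also have "\<dots> = (\<Sum>i\<in>UNIV. x $ i * Poly_Mapping.lookup (Var i * g) e1)"
    by (simp add: linear_form_eq_Var sum_distrib_right lookup_sum mult.assoc lookup_Const_mult)
  also have "\<dots> = (\<Sum>i\<in>UNIV. if i = j then x $ j * Poly_Mapping.lookup g e else 0)"
  proof (rule sum.cong)
    fix i
    have "Poly_Mapping.lookup (Var i * g) e1 = 0" if "i \<noteq> j"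
    proof -
      have "Poly_Mapping.lookup (e1 - Poly_Mapping.single i 1) j = Suc D"
        using that e(2) by (simp add: e1_def lookup_add lookup_minus lookup_single)
      then have "e1 - Poly_Mapping.single i 1 \<notin> Poly_Mapping.keys g"
        using max by fastforce
      then show ?thesis by (simp add: lookup_Var_mult in_keys_iff)
    qed
    moreover have "Poly_Mapping.lookup (Var j * g) e1 = Poly_Mapping.lookup g e"
      by (simp add: lookup_Var_mult e1_def lookup_add)
    ultimately show "x $ i * Poly_Mapping.lookup (Var i * g) e1 =
        (if i = j then x $ j * Poly_Mapping.lookup g e else 0)"
      by simp
  qed simp
  also have "\<dots> = x $ j * Poly_Mapping.lookup g e" by simp
  finally show False using j e(1) by (simp add: in_keys_iff)
qed

lemma linear_form_mult_cancel:
  fixes g :: "'n::finite cpoly"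
  assumes "x \<noteq> 0" "linear_form x * g = linear_form x * h"
  shows "g = h"
  using linear_form_mult_eq_0[OF assms(1), of "g - h"] assms(2) by (simp add: right_diff_distrib)

subsection \<open>Substitution homomorphisms\<close>

text \<open>Frees the substitution in \<open>weyl_act\<close> from the Weyl group: the images of the
  variables are arbitrary, so the homomorphism laws hold for any map \<open>w\<close>, linear or
  not.\<close>

definition subst :: "('n \<Rightarrow> 'n cpoly) \<Rightarrow> 'n::finite cpoly \<Rightarrow> 'n cpoly" where
  "subst l p = (\<Sum>e\<in>Poly_Mapping.keys p. Const (Poly_Mapping.lookup p e) *
     (\<Prod>i\<in>UNIV. l i ^ Poly_Mapping.lookup e i))"

lemma subst_superset:
  assumes "finite A" "Poly_Mapping.keys p \<subseteq> A"
  shows "subst l p = (\<Sum>e\<in>A. Const (Poly_Mapping.lookup p e) *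
     (\<Prod>i\<in>UNIV. l i ^ Poly_Mapping.lookup e i))"
  unfolding subst_def by (rule sum.mono_neutral_left) (use assms in \<open>auto simp: in_keys_iff\<close>)

lemma subst_add: "subst l (p + q) = subst l p + subst l q"
proof -
  let ?A = "Poly_Mapping.keys p \<union> Poly_Mapping.keys q"
  have "Poly_Mapping.keys (p + q) \<subseteq> ?A" by (rule keys_add)
  then show ?thesis
    by (simp add: subst_superset[where A = ?A] lookup_add Const_add distrib_right sum.distrib)
qed

lemma subst_0 [simp]: "subst l 0 = 0"
  by (simp add: subst_def)

lemma subst_single:
  "subst l (Poly_Mapping.single e c) = Const c * (\<Prod>i\<in>UNIV. l i ^ Poly_Mapping.lookup e i)"
  by (subst subst_superset[where A = "{e}"]) auto

lemma subst_sum: "subst l (\<Sum>i\<in>A. f i) = (\<Sum>i\<in>A. subst l (f i))"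
  by (induction A rule: infinite_finite_induct) (simp_all add: subst_add)

lemma subst_Const [simp]: "subst l (Const c) = Const c"
  by (simp add: Const_def[of c] subst_single)

lemma subst_Var [simp]: "subst l (Var i) = l i"
proof -
  have "(\<Prod>j\<in>UNIV. l j ^ Poly_Mapping.lookup (Poly_Mapping.single i 1) j)
     = (\<Prod>j\<in>UNIV. if j = i then l j else 1)"
    by (intro prod.cong) (auto simp: lookup_single when_def)
  then show ?thesis by (simp add: Var_def subst_single)
qed

lemma subst_mult: "subst l (p * q) = subst l p * subst l q"
proof -
  have *: "subst l (Poly_Mapping.single a b * Poly_Mapping.single c d) =
      subst l (Poly_Mapping.single a b) * subst l (Poly_Mapping.single c d)" for a b c d
    by (simp add: mult_single subst_single Const_mult lookup_add power_add prod.distrib algebra_simps)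
  have "p * q = (\<Sum>a\<in>Poly_Mapping.keys p. \<Sum>b\<in>Poly_Mapping.keys q.
      Poly_Mapping.single a (Poly_Mapping.lookup p a) * Poly_Mapping.single b (Poly_Mapping.lookup q b))"
    by (simp flip: sum_product cpoly_eq_sum_single)
  then have "subst l (p * q) =
      (\<Sum>a\<in>Poly_Mapping.keys p. subst l (Poly_Mapping.single a (Poly_Mapping.lookup p a))) *
      (\<Sum>b\<in>Poly_Mapping.keys q. subst l (Poly_Mapping.single b (Poly_Mapping.lookup q b)))"
    by (simp add: subst_sum * sum_product)
  then show ?thesis by (simp flip: subst_sum cpoly_eq_sum_single)
qed

lemma subst_power: "subst l (p ^ n) = subst l p ^ n"
  using subst_Const[of l 1] by (induction n) (simp_all add: subst_mult)

lemma subst_linear_form: "subst l (linear_form x) = (\<Sum>i\<in>UNIV. Const (x $ i) * l i)"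
  by (simp add: linear_form_eq_Var subst_sum subst_mult)

text \<open>The constant term is evaluation at the origin, hence multiplicative. This is how
  membership in \<open>poly_plus\<close> is tracked through products.\<close>

lemma lookup_mult_0:
  fixes p q :: "'n::finite cpoly"
  shows "Poly_Mapping.lookup (p * q) 0 = Poly_Mapping.lookup p 0 * Poly_Mapping.lookup q 0"
proof (induction p arbitrary: q rule: cpoly_induct)
  case (Const c)
  then show ?case by (simp add: lookup_Const_mult) (simp add: Const_def)
next
  case (Var i)
  have "Poly_Mapping.lookup (Var i) 0 = 0"
    using lookup_Var_mult[of i 1 0] by simp
  then show ?case by (simp add: lookup_Var_mult)
next
  case (mult p1 p2)
  then show ?case by (simp add: mult.assoc)
qed (simp add: distrib_right lookup_add)

lemma lookup_Var_0 [simp]: "Poly_Mapping.lookup (Var i) 0 = 0"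
  using lookup_Var_mult[of i 1 0] by simp

lemma lookup_linear_form_0 [simp]: "Poly_Mapping.lookup (linear_form x) 0 = 0"
  by (simp add: linear_form_eq_Var lookup_sum lookup_mult_0 lookup_Const_mult)

lemma lookup_Const_0 [simp]: "Poly_Mapping.lookup (Const c) 0 = c"
  by (simp add: Const_def)

lemma mono_degree_eq_0: "mono_degree e = 0 \<longleftrightarrow> e = 0"
  by (auto simp: mono_degree_def poly_mapping_eq_iff fun_eq_iff)

lemma poly_plus_iff: "p \<in> poly_plus \<longleftrightarrow> Poly_Mapping.lookup p 0 = 0"
proof
  show "p \<in> poly_plus \<Longrightarrow> Poly_Mapping.lookup p 0 = 0"
    unfolding poly_plus_def using mono_degree_eq_0[of "0 :: 'a \<Rightarrow>\<^sub>0 nat"]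
    by (metis (mono_tags, lifting) in_keys_iff mem_Collect_eq not_one_le_zero)
  show "Poly_Mapping.lookup p 0 = 0 \<Longrightarrow> p \<in> poly_plus"
    unfolding poly_plus_def in_keys_iff
    by (auto simp: Suc_le_eq mono_degree_eq_0 intro!: gr0I)
qed

subsection \<open>Derivatives\<close>

lemma lookup_partial_deriv:
  "Poly_Mapping.lookup (partial_deriv i p) e =
     of_nat (Suc (Poly_Mapping.lookup e i)) * Poly_Mapping.lookup p (e + Poly_Mapping.single i 1)"
proof -
  let ?s = "Poly_Mapping.single i (1::nat)"
  \<comment> \<open>Subtraction of exponents is truncated, so an exponent without \<open>i\<close>
    is sent to itself; its term carries the factor \<open>0\<close>, which makes the two conditions
    interchangeable.\<close>
  have eq: "(if e' - ?s = e then Poly_Mapping.lookup p e' * of_nat (Poly_Mapping.lookup e' i) else 0) =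
     (if e' = e + ?s then Poly_Mapping.lookup p e' * of_nat (Poly_Mapping.lookup e' i) else 0)" for e'
  proof (cases "Poly_Mapping.lookup e' i = 0")
    case False
    then have "e' - ?s = e \<longleftrightarrow> e' = e + ?s"
      by (auto simp: poly_mapping_eq_iff fun_eq_iff lookup_add lookup_minus lookup_single when_def)
    then show ?thesis by simp
  qed simp
  have "Poly_Mapping.lookup (partial_deriv i p) e = (\<Sum>e'\<in>Poly_Mapping.keys p.
      if e' - ?s = e then Poly_Mapping.lookup p e' * of_nat (Poly_Mapping.lookup e' i) else 0)"
    by (simp add: partial_deriv_def lookup_sum lookup_single when_def)
  also have "\<dots> = (\<Sum>e'\<in>Poly_Mapping.keys p. if e' = e + ?s then
      Poly_Mapping.lookup p e' * of_nat (Poly_Mapping.lookup e' i) else 0)"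
    by (simp only: eq)
  finally show ?thesis
    by (auto simp: in_keys_iff lookup_add)
qed

lemma partial_deriv_add: "partial_deriv i (p + q) = partial_deriv i p + partial_deriv i q"
  by (rule poly_mapping_eqI) (simp add: lookup_partial_deriv lookup_add algebra_simps)

lemma add_single_neq_0: "e + Poly_Mapping.single i (1::nat) \<noteq> 0"
proof
  assume "e + Poly_Mapping.single i 1 = 0"
  from arg_cong[OF this, of "\<lambda>x. Poly_Mapping.lookup x i"] show False
    by (simp add: lookup_add)
qed

lemma partial_deriv_Const [simp]: "partial_deriv i (Const c) = 0"
  by (rule poly_mapping_eqI)
     (simp add: lookup_partial_deriv Const_def lookup_single add_single_neq_0[simplified]
        add_single_neq_0[simplified, symmetric])

lemma partial_deriv_Var: "partial_deriv i (Var j) = (if i = j then 1 else 0)"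
proof (rule poly_mapping_eqI)
  fix e :: "'a \<Rightarrow>\<^sub>0 nat"
  have "i = j \<Longrightarrow> e + Poly_Mapping.single i 1 = Poly_Mapping.single j 1 \<longleftrightarrow> e = 0"
    using add_right_cancel[of e "Poly_Mapping.single j 1" 0] by simp
  moreover have "e + Poly_Mapping.single i 1 \<noteq> Poly_Mapping.single j 1" if "i \<noteq> j"
  proof
    assume "e + Poly_Mapping.single i 1 = Poly_Mapping.single j 1"
    from arg_cong[OF this, of "\<lambda>x. Poly_Mapping.lookup x i"] that show False
      by (simp add: lookup_add lookup_single)
  qed
  ultimately show "Poly_Mapping.lookup (partial_deriv i (Var j)) e =
      Poly_Mapping.lookup (if i = j then 1 else 0) e"
    by (cases "i = j") (auto simp: lookup_partial_deriv Var_def lookup_single when_def lookup_one)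
qed

lemma partial_deriv_mult:
  fixes p q :: "'n::finite cpoly"
  shows "partial_deriv i (p * q) = p * partial_deriv i q + partial_deriv i p * q"
proof (induction p arbitrary: q rule: cpoly_induct)
  case (Const c)
  have "partial_deriv i (Const c * q) = Const c * partial_deriv i q"
    by (rule poly_mapping_eqI) (simp add: lookup_partial_deriv lookup_Const_mult)
  then show ?case by simp
next
  case (Var j)
  \<comment> \<open>The Leibniz rule for a variable, coefficient by coefficient; for
    \<open>i = j\<close> the surplus \<open>1\<close> in the multiplicity is the derivative of the
    variable itself.\<close>
  have *: "of_nat (Suc (Poly_Mapping.lookup e i)) * Poly_Mapping.lookup (Var j * q) (e + Poly_Mapping.single i 1)
     = Poly_Mapping.lookup (Var j * partial_deriv i q) e + (if i = j then Poly_Mapping.lookup q e else 0)" for e q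
  proof (cases "i = j")
    case True
    have "e - Poly_Mapping.single j 1 + Poly_Mapping.single j 1 = e" if "Poly_Mapping.lookup e j \<noteq> 0"
      using that by (intro poly_mapping_eqI) (auto simp: lookup_add lookup_minus lookup_single when_def)
    then show ?thesis using True
      by (auto simp: lookup_Var_mult lookup_partial_deriv lookup_add lookup_minus ring_distribs)
  next
    case False
    have "e + Poly_Mapping.single i 1 - Poly_Mapping.single j 1 =
        e - Poly_Mapping.single j 1 + Poly_Mapping.single i 1"
      using False by (intro poly_mapping_eqI) (auto simp: lookup_add lookup_minus lookup_single when_def)
    then show ?thesis using False
      by (auto simp: lookup_Var_mult lookup_partial_deriv lookup_add lookup_minus lookup_single ring_distribs)
  qed
  show ?case
    using *[of _ q] partial_deriv_Var[of i j] by (intro poly_mapping_eqI)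
      (cases "i = j"; simp add: lookup_partial_deriv lookup_add del: of_nat_Suc)
next
  case (add p1 p2)
  then show ?case by (simp add: distrib_right distrib_left partial_deriv_add add_ac)
next
  case (mult p1 p2)
  then show ?case by (simp add: mult.assoc distrib_left add_ac)
    (simp add: mult.commute distrib_left mult.left_commute add_ac)
qed

lemma dir_deriv_add: "dir_deriv y (p + q) = dir_deriv y p + dir_deriv y q"
  by (simp add: dir_deriv_def partial_deriv_add distrib_left sum.distrib)

lemma dir_deriv_mult: "dir_deriv y (p * q) = p * dir_deriv y q + dir_deriv y p * q"
  by (simp add: dir_deriv_def partial_deriv_mult distrib_left sum.distrib sum_distrib_left
      sum_distrib_right mult.assoc mult.left_commute)

lemma dir_deriv_Const [simp]: "dir_deriv y (Const c) = 0"
  by (simp add: dir_deriv_def)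

lemma dir_deriv_sum: "dir_deriv y (\<Sum>i\<in>A. f i) = (\<Sum>i\<in>A. dir_deriv y (f i))"
  using dir_deriv_Const[of y 0]
  by (induction A rule: infinite_finite_induct) (simp_all add: dir_deriv_add)

lemma dir_deriv_linear_form: "dir_deriv y (linear_form x) = Const (pairing x y)"
proof -
  have "dir_deriv y (Var i) = Const (y $ i)" for i
  proof -
    have "dir_deriv y (Var i) = (\<Sum>j\<in>UNIV. if j = i then Const (y $ j) else 0)"
      unfolding dir_deriv_def by (intro sum.cong) (auto simp: partial_deriv_Var)
    then show ?thesis by simp
  qed
  then show ?thesis
    by (simp add: linear_form_eq_Var dir_deriv_sum dir_deriv_mult pairing_def Const_sum Const_mult)
qed

lemma dir_deriv_power:
  "dir_deriv y (p ^ n) = of_nat n * p ^ (n - 1) * dir_deriv y p"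
proof (induction n)
  case 0
  then show ?case using dir_deriv_Const[of y 1] by simp
next
  case (Suc n)
  have "dir_deriv y (p ^ Suc n) = of_nat n * (p * p ^ (n - 1)) * dir_deriv y p + p ^ n * dir_deriv y p"
    by (simp add: dir_deriv_mult Suc.IH ac_simps)
  also have "of_nat n * (p * p ^ (n - 1)) = of_nat n * p ^ n"
    by (cases n) auto
  finally show ?case
    by (simp add: algebra_simps)
qed

section \<open>Weyl groups and the invariant form\<close>

lemma pairing_commute: "pairing x y = pairing y x"
  by (simp add: pairing_def mult.commute)

lemma pairing_add: "pairing (x + y) z = pairing x z + pairing y z"
  by (simp add: pairing_def distrib_right sum.distrib)

lemma pairing_scale: "pairing (c *s x) z = c * pairing x z"
  by (simp add: pairing_def sum_distrib_left mult.assoc)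

lemma pairing_sum: "pairing (\<Sum>i\<in>A. f i) z = (\<Sum>i\<in>A. pairing (f i) z)"
  by (induction A rule: infinite_finite_induct) (simp_all add: pairing_add, simp_all add: pairing_def)

lemma pairing_cplx: "pairing (cplx x) (cplx y) = complex_of_real (x \<bullet> y)"
  by (simp add: pairing_def cplx_def inner_vec_def)

lemma pairing_axis: "pairing x (axis i 1) = x $ i"
proof -
  have "pairing x (axis i 1) = (\<Sum>j\<in>UNIV. if j = i then x $ j else 0)"
    unfolding pairing_def by (intro sum.cong) (auto simp: axis_def)
  then show ?thesis by simp
qed

lemma pairing_eqI: "(\<And>z. pairing x z = pairing y z) \<Longrightarrow> x = y"
  by (metis pairing_axis vec_eq_iff)

lemma cplx_add: "cplx (x + y) = cplx x + cplx y"
  and cplx_scale: "cplx (c *\<^sub>R x) = complex_of_real c *s cplx x"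
  and cplx_diff: "cplx (x - y) = cplx x - cplx y"
  and cplx_0: "cplx 0 = 0"
  by (simp_all add: cplx_def vec_eq_iff)

lemma cplx_sum: "cplx (\<Sum>i\<in>A. f i) = (\<Sum>i\<in>A. cplx (f i))"
  by (induction A rule: infinite_finite_induct) (simp_all add: cplx_add cplx_0)

lemma cplx_eq_0_iff: "cplx x = 0 \<longleftrightarrow> x = 0"
  by (simp add: cplx_def vec_eq_iff)

lemma cplx_axis: "cplx (axis i 1) = axis i 1"
  by (simp add: cplx_def vec_eq_iff axis_def)

text \<open>The product of two reflections with the same root is a transvection; as it preserves
  the finite set \<open>R\<close>, it fixes \<open>R\<close> pointwise.\<close>

lemma coroot_unique:
  assumes R: "root_system R" and "is_coroot R \<alpha> c" "is_coroot R \<alpha> c'"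
  shows "c = c'"
proof -
  define d where "d = c - c'"
  have c: "\<alpha> \<bullet> c = 2" "\<alpha> \<bullet> c' = 2" and
    refl: "\<And>x. x \<in> R \<Longrightarrow> x - (x \<bullet> c) *\<^sub>R \<alpha> \<in> R" "\<And>x. x \<in> R \<Longrightarrow> x - (x \<bullet> c') *\<^sub>R \<alpha> \<in> R"
    using assms(2,3) by (auto simp: is_coroot_def)
  have "\<alpha> \<noteq> 0" using c by auto
  have step: "y + (y \<bullet> d) *\<^sub>R \<alpha> \<in> R" if "y \<in> R" for y
  proof -
    let ?y = "y - (y \<bullet> c) *\<^sub>R \<alpha>"
    have "?y - (?y \<bullet> c') *\<^sub>R \<alpha> = y + (- (y \<bullet> c) - (y \<bullet> c' - (y \<bullet> c) * 2)) *\<^sub>R \<alpha>"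
      by (simp only: inner_diff_left inner_scaleR_left c scaleR_left_diff_distrib scaleR_minus_left)
        simp
    also have "- (y \<bullet> c) - (y \<bullet> c' - (y \<bullet> c) * 2) = y \<bullet> d"
      by (simp add: d_def inner_diff_right)
    finally show ?thesis
      using refl(2)[OF refl(1)[OF that]] by (simp only:)
  qed
  have iter: "x + (real n * (x \<bullet> d)) *\<^sub>R \<alpha> \<in> R" if "x \<in> R" for x n
  proof (induction n)
    case (Suc n)
    have "\<alpha> \<bullet> d = 0" by (simp add: d_def inner_diff_right c)
    with step[OF Suc] show ?case
      by (simp add: inner_add_left scaleR_add_left algebra_simps)
  qed (use that in simp)
  have "x \<bullet> d = 0" if "x \<in> R" for x
  proof (rule ccontr)
    assume "x \<bullet> d \<noteq> 0"
    then have "inj (\<lambda>n::nat. x + (real n * (x \<bullet> d)) *\<^sub>R \<alpha>)"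
      using \<open>\<alpha> \<noteq> 0\<close> by (intro injI) simp
    moreover have "finite (range (\<lambda>n::nat. x + (real n * (x \<bullet> d)) *\<^sub>R \<alpha>))"
      by (rule finite_subset[of _ R]) (use iter[OF that] R in \<open>auto simp: root_system_def\<close>)
    ultimately show False
      by (metis finite_imageD infinite_UNIV_nat)
  qed
  then have "orthogonal d x" if "x \<in> R" for x
    using that by (metis inner_commute orthogonal_def)
  moreover have "d \<in> span R" using R by (simp add: root_system_def)
  ultimately have "orthogonal d d"
    by (metis orthogonal_to_span)
  then show ?thesis by (simp add: d_def orthogonal_def)
qed

lemma is_coroot_coroot:
  assumes R: "root_system R" and "\<alpha> \<in> R"
  shows "is_coroot R \<alpha> (coroot R \<alpha>)"
proof -
  obtain c where "is_coroot R \<alpha> c" using assms by (auto simp: root_system_def)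
  then show ?thesis
    unfolding coroot_def using coroot_unique[OF R] by (rule_tac theI) auto
qed

lemma coroot_eqI: "root_system R \<Longrightarrow> is_coroot R \<alpha> c \<Longrightarrow> coroot R \<alpha> = c"
  unfolding coroot_def by (rule the_equality) (auto intro: coroot_unique)

text \<open>\<open>Bstar\<close> on real points, where sums of squares are positive.\<close>

definition real_Bstar :: "(real ^ 'n) set \<Rightarrow> real ^ 'n \<Rightarrow> real ^ 'n \<Rightarrow> real" where
  "real_Bstar R x z = (\<Sum>\<alpha>\<in>R. (coroot R \<alpha> \<bullet> x) * (coroot R \<alpha> \<bullet> z))"

lemma Bstar_cplx: "Bstar R (cplx x) (cplx z) = complex_of_real (real_Bstar R x z)"
  by (simp add: Bstar_def real_Bstar_def pairing_cplx)

text \<open>Expanding \<open>Bstar\<close> represents the functional by the combination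
  \<open>y\<close> of coroots, and testing on the coordinate axes shows that a representing vector
  is unique; so the description in \<open>Biso\<close> denotes it.\<close>

lemma pairing_Biso: "pairing (Biso R x) z = Bstar R x z"
proof -
  define y where "y = (\<Sum>\<alpha>\<in>R. pairing (cplx (coroot R \<alpha>)) x *s cplx (coroot R \<alpha>))"
  have "\<forall>z. Bstar R x z = pairing y z"
    by (simp add: Bstar_def y_def pairing_sum pairing_scale)
  moreover from this have "y' = y" if "\<forall>z. Bstar R x z = pairing y' z" for y'
    using that by (intro pairing_eqI) simp
  ultimately have "\<forall>z. Bstar R x z = pairing (Biso R x) z"
    unfolding Biso_def by (rule theI)
  then show ?thesis by simp
qed

lemma weyl_act_eq_subst: "weyl_act w = subst (\<lambda>i. linear_form (cplx (w (axis i 1))))"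
  by (rule ext) (simp add: weyl_act_def subst_def)

lemma weyl_act_add: "weyl_act w (p + q) = weyl_act w p + weyl_act w q"
  and weyl_act_mult: "weyl_act w (p * q) = weyl_act w p * weyl_act w q"
  and weyl_act_power: "weyl_act w (p ^ n) = weyl_act w p ^ n"
  and weyl_act_sum: "weyl_act w (\<Sum>i\<in>A. f i) = (\<Sum>i\<in>A. weyl_act w (f i))"
  and weyl_act_Const [simp]: "weyl_act w (Const c) = Const c"
  and weyl_act_Var: "weyl_act w (Var i) = linear_form (cplx (w (axis i 1)))"
  by (simp_all add: weyl_act_eq_subst subst_add subst_mult subst_power subst_sum)

text \<open>The complex-linear map with the values of \<open>w\<close> on the coordinate axes. It
  extends \<open>w\<close> only if \<open>w\<close> is real-linear.\<close>

definition complexified :: "(real ^ 'n \<Rightarrow> real ^ 'n) \<Rightarrow> complex ^ 'n \<Rightarrow> complex ^ 'n" where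
  "complexified w x = (\<Sum>i\<in>UNIV. x $ i *s cplx (w (axis i 1)))"

lemma weyl_act_linear_form: "weyl_act w (linear_form x) = linear_form (complexified w x)"
  by (simp add: weyl_act_eq_subst subst_linear_form complexified_def linear_form_sum linear_form_scale)

lemma complexified_cplx:
  assumes "linear w"
  shows "complexified w (cplx x) = cplx (w x)"
proof -
  have "w x = (\<Sum>i\<in>UNIV. x $ i *\<^sub>R w (axis i 1))"
  proof -
    have "w x = w (\<Sum>i\<in>UNIV. x $ i *\<^sub>R axis i 1)"
      by (simp add: basis_expansion[of x, unfolded scalar_mult_eq_scaleR])
    then show ?thesis
      by (simp add: linear_sum[OF assms] linear_scale[OF assms])
  qed
  then show ?thesis
    by (simp add: complexified_def cplx_sum cplx_scale) (simp add: cplx_def)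
qed

text \<open>Linearity is asked of \<open>w\<close> alone: \<open>w'\<close> enters through its
  values on the axes, but \<open>w\<close> has to be applied to those values.\<close>

lemma weyl_act_comp:
  fixes w w' :: "real ^ 'n::finite \<Rightarrow> real ^ 'n"
  assumes "linear w"
  shows "weyl_act (w \<circ> w') p = weyl_act w (weyl_act w' p)"
  by (induction p rule: cpoly_induct)
     (simp_all add: weyl_act_add weyl_act_mult weyl_act_Var weyl_act_linear_form complexified_cplx[OF assms])

lemma weyl_act_id: "weyl_act id = (id :: ('n::finite) oper)"
proof
  fix p :: "'n cpoly"
  show "weyl_act id p = id p"
    by (induction p rule: cpoly_induct)
       (simp_all add: weyl_act_add weyl_act_mult weyl_act_Var cplx_axis linear_form_axis)
qed

lemma lookup_weyl_act_0: "Poly_Mapping.lookup (weyl_act w p) 0 = Poly_Mapping.lookup p 0"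
  by (induction p rule: cpoly_induct)
     (simp_all add: weyl_act_add weyl_act_mult weyl_act_Var lookup_add lookup_mult_0)

section \<open>The degree operator on polynomials\<close>

definition euler :: "'n::finite cpoly \<Rightarrow> 'n cpoly" where
  "euler p = (\<Sum>i\<in>UNIV. Var i * partial_deriv i p)"

lemma euler_add: "euler (p + q) = euler p + euler q"
  by (simp add: euler_def partial_deriv_add distrib_left sum.distrib)

lemma euler_mult: "euler (p * q) = p * euler q + euler p * q"
  by (simp add: euler_def partial_deriv_mult distrib_left sum.distrib sum_distrib_left
      sum_distrib_right mult.assoc mult.left_commute)

lemma euler_Const [simp]: "euler (Const c) = 0"
  by (simp add: euler_def)

lemma euler_Var: "euler (Var i) = Var i"
proof -
  have "euler (Var i) = (\<Sum>j\<in>UNIV. if j = i then Var j else 0)"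
    unfolding euler_def by (intro sum.cong) (auto simp: partial_deriv_Var)
  then show ?thesis by simp
qed

lemma euler_sum: "euler (\<Sum>i\<in>A. f i) = (\<Sum>i\<in>A. euler (f i))"
  using euler_Const[of 0] by (induction A rule: infinite_finite_induct) (simp_all add: euler_add)

lemma euler_linear_form: "euler (linear_form x) = linear_form x"
  by (simp add: linear_form_eq_Var euler_sum euler_mult euler_Var)

text \<open>A variable is replaced by a linear form, on which \<open>euler\<close> is again the
  identity; the derivation rule carries the agreement from variables to all polynomials.\<close>

lemma weyl_act_euler: "weyl_act w (euler p) = euler (weyl_act w p)"
proof (induction p rule: cpoly_induct)
  case (Const c)
  show ?case using weyl_act_Const[of w 0] by simp
qed (simp_all add: euler_add euler_mult weyl_act_add weyl_act_mult euler_Var weyl_act_Var euler_linear_form)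

lemma lookup_euler:
  "Poly_Mapping.lookup (euler p) e = of_nat (mono_degree e) * Poly_Mapping.lookup p e"
proof -
  have "Poly_Mapping.lookup (Var i * partial_deriv i p) e =
      of_nat (Poly_Mapping.lookup e i) * Poly_Mapping.lookup p e" for i
  proof (cases "Poly_Mapping.lookup e i")
    case (Suc n)
    then have "e - Poly_Mapping.single i 1 + Poly_Mapping.single i 1 = e"
      by (intro poly_mapping_eqI) (auto simp: lookup_add lookup_minus lookup_single when_def)
    with Suc show ?thesis
      by (simp add: lookup_Var_mult lookup_partial_deriv lookup_minus)
  qed (simp add: lookup_Var_mult)
  then show ?thesis
    by (simp add: euler_def lookup_sum mono_degree_def sum_distrib_right)
qed

locale dunkl_setup =
  fixes R Rp :: "(real ^ 'n::finite) set"
    and k :: "real ^ 'n \<Rightarrow> complex"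
    and z :: "'n \<Rightarrow> real ^ 'n"
  assumes reduced: "reduced_root_system R"
    and positive: "positive_system R Rp"
    and orthonormal: "orthonormal_basis R z"
begin

abbreviation "W \<equiv> weyl_group R"
abbreviation "cor \<equiv> coroot R"
abbreviation "r \<equiv> reflection R"

lemma root_system: "root_system R"
  using reduced by (simp add: reduced_root_system_def)

lemma finite_R: "finite R" and span_R: "span R = UNIV" and zero_notin_R: "0 \<notin> R"
  using root_system by (auto simp: root_system_def)

lemma Rp_subset: "Rp \<subseteq> R"
  using positive by (auto simp: positive_system_def)

lemma finite_Rp: "finite Rp"
  using Rp_subset finite_R by (rule finite_subset)

lemma root_coroot: "\<alpha> \<in> R \<Longrightarrow> \<alpha> \<bullet> cor \<alpha> = 2"
  using is_coroot_coroot[OF root_system] by (simp add: is_coroot_def)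

lemma reflection_closed: "\<alpha> \<in> R \<Longrightarrow> x \<in> R \<Longrightarrow> r \<alpha> x \<in> R"
  using is_coroot_coroot[OF root_system, of \<alpha>] by (auto simp: is_coroot_def reflection_def)

lemma reflection_involutive: "\<alpha> \<in> R \<Longrightarrow> r \<alpha> (r \<alpha> x) = x"
  by (simp add: reflection_def inner_diff_left root_coroot algebra_simps)

lemma linear_reflection: "linear (r \<alpha>)"
  by (rule linearI) (simp_all add: reflection_def inner_add_left algebra_simps)

lemma linear_W: "w \<in> W \<Longrightarrow> linear w"
proof (induction rule: weyl_group.induct)
  case weyl_id
  show ?case by (rule linear_id)
next
  case (weyl_reflection \<alpha> w)
  then show ?case using linear_reflection linear_compose by blast
qed

lemma W_closed: "w \<in> W \<Longrightarrow> x \<in> R \<Longrightarrow> w x \<in> R"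
  by (induction rule: weyl_group.induct) (auto simp: reflection_closed)

text \<open>A linear map is determined by its values on the spanning set \<open>R\<close>, which the
  group maps into itself; so restriction to \<open>R\<close> embeds the group into a finite set of
  functions.\<close>

lemma finite_W: "finite W"
proof (rule inj_on_finite)
  show "inj_on (\<lambda>w. restrict w R) W"
  proof (rule inj_onI, rule ext)
    fix w w' x assume w: "w \<in> W" "w' \<in> W" and eq: "restrict w R = restrict w' R"
    have "w y = w' y" if "y \<in> R" for y
      using eq that by (metis restrict_apply')
    then show "w x = w' x"
      using linear_eq_on[of w w' x R] linear_W w span_R by simp
  qed
  show "(\<lambda>w. restrict w R) ` W \<subseteq> (\<Pi>\<^sub>E x\<in>R. R)"
    using W_closed by (auto simp: PiE_def extensional_def)
  show "finite (\<Pi>\<^sub>E x\<in>R. R)"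
    using finite_R by (intro finite_PiE) auto
qed

lemma W_comp: "w \<in> W \<Longrightarrow> w' \<in> W \<Longrightarrow> w \<circ> w' \<in> W"
  by (induction rule: weyl_group.induct) (auto simp: comp_assoc intro: weyl_reflection)

lemma reflection_in_W: "\<alpha> \<in> R \<Longrightarrow> r \<alpha> \<in> W"
  using weyl_reflection[OF _ weyl_id] by simp

lemma W_inverse: "w \<in> W \<Longrightarrow> \<exists>w'\<in>W. w \<circ> w' = id \<and> w' \<circ> w = id"
proof (induction rule: weyl_group.induct)
  case weyl_id
  then show ?case by (intro bexI[of _ id]) (simp_all add: weyl_group.weyl_id del: id_apply)
next
  case (weyl_reflection \<alpha> w)
  then obtain w' where w': "w' \<in> W" "w \<circ> w' = id" "w' \<circ> w = id" by blast
  have "r \<alpha> \<circ> w \<circ> (w' \<circ> r \<alpha>) = id" "w' \<circ> r \<alpha> \<circ> (r \<alpha> \<circ> w) = id"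
    using w' weyl_reflection(1) by (auto simp: fun_eq_iff reflection_involutive)
  then show ?case
    using w' weyl_reflection(1) W_comp reflection_in_W by blast
qed

lemma inv_W: "w \<in> W \<Longrightarrow> inv w \<in> W"
  and inv_W_comp: "w \<in> W \<Longrightarrow> inv w \<circ> w = id" "w \<in> W \<Longrightarrow> w \<circ> inv w = id"
proof -
  assume "w \<in> W"
  then obtain w' where w': "w' \<in> W" "w \<circ> w' = id" "w' \<circ> w = id" using W_inverse by blast
  then have "inv w = w'" by (intro inv_unique_comp)
  then show "inv w \<in> W" "inv w \<circ> w = id" "w \<circ> inv w = id" using w' by simp_all
qed

lemma inv_inv_W: "w \<in> W \<Longrightarrow> inv (inv w) = w"
  by (intro inv_unique_comp inv_W_comp)

text \<open>The reflection in \<open>r \<alpha> \<beta>\<close> is the conjugate of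
  \<open>r \<beta>\<close> by \<open>r \<alpha>\<close>. The formula reads off its coroot, and
  uniqueness of coroots identifies it.\<close>

lemma coroot_reflection:
  assumes "\<alpha> \<in> R" "\<beta> \<in> R"
  shows "cor (r \<alpha> \<beta>) = cor \<beta> - (\<alpha> \<bullet> cor \<beta>) *\<^sub>R cor \<alpha>"
proof (rule coroot_eqI[OF root_system])
  let ?c = "cor \<beta> - (\<alpha> \<bullet> cor \<beta>) *\<^sub>R cor \<alpha>"
  have "x - (x \<bullet> ?c) *\<^sub>R r \<alpha> \<beta> = r \<alpha> (r \<beta> (r \<alpha> x))" for x
    by (simp add: reflection_def inner_diff_left inner_diff_right root_coroot assms algebra_simps)
  then show "is_coroot R (r \<alpha> \<beta>) ?c"
    using assms reflection_closed
    by (auto simp: is_coroot_def) (simp add: reflection_def inner_diff_left inner_diff_right root_coroot)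
qed

text \<open>By \<open>coroot_reflection\<close> the transpose of \<open>r \<alpha>\<close> permutes
  the coroots, so the sum is merely reindexed.\<close>

lemma real_Bstar_reflection:
  assumes "\<alpha> \<in> R"
  shows "real_Bstar R (r \<alpha> x) (r \<alpha> y) = real_Bstar R x y"
proof -
  have *: "cor \<beta> \<bullet> r \<alpha> x = cor (r \<alpha> \<beta>) \<bullet> x" if "\<beta> \<in> R" for \<beta> x
    using that assms
    by (simp add: coroot_reflection) (simp add: reflection_def inner_diff_left inner_diff_right inner_commute)
  have "real_Bstar R (r \<alpha> x) (r \<alpha> y) = (\<Sum>\<beta>\<in>R. (cor (r \<alpha> \<beta>) \<bullet> x) * (cor (r \<alpha> \<beta>) \<bullet> y))"
    unfolding real_Bstar_def by (intro sum.cong) (simp_all add: *)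
  also have "\<dots> = real_Bstar R x y"
    unfolding real_Bstar_def
    by (rule sum.reindex_bij_witness[where i = "r \<alpha>" and j = "r \<alpha>"])
       (use assms in \<open>auto simp: reflection_involutive reflection_closed\<close>)
  finally show ?thesis .
qed

lemma real_Bstar_add: "real_Bstar R (x + y) u = real_Bstar R x u + real_Bstar R y u"
  by (simp add: real_Bstar_def inner_add_right distrib_right sum.distrib)

lemma real_Bstar_scale: "real_Bstar R (c *\<^sub>R x) u = c * real_Bstar R x u"
  by (simp add: real_Bstar_def sum_distrib_left mult.assoc)

lemma real_Bstar_commute: "real_Bstar R x u = real_Bstar R u x"
  by (simp add: real_Bstar_def mult.commute)

lemma real_Bstar_sum: "real_Bstar R (\<Sum>i\<in>A. f i) u = (\<Sum>i\<in>A. real_Bstar R (f i) u)"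
  by (induction A rule: infinite_finite_induct)
     (simp_all add: real_Bstar_add, simp_all add: real_Bstar_def)

lemma real_Bstar_z: "real_Bstar R (z i) (z j) = (if i = j then 1 else 0)"
proof -
  have "complex_of_real (real_Bstar R (z i) (z j)) = complex_of_real (if i = j then 1 else 0)"
    using orthonormal by (simp add: orthonormal_basis_def flip: Bstar_cplx)
  then show ?thesis using of_real_eq_iff by blast
qed

lemma orthonormal_expansion:
  shows "(\<Sum>i\<in>UNIV. real_Bstar R x (z i) *\<^sub>R z i) = x"
proof -
  have "x \<in> span (range z)" "inj z" using orthonormal by (auto simp: orthonormal_basis_def)
  then obtain u where "x = (\<Sum>y\<in>range z. u y *\<^sub>R y)"
    by (auto simp: span_finite)
  then have x: "x = (\<Sum>i\<in>UNIV. u (z i) *\<^sub>R z i)"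
    using \<open>inj z\<close> by (simp add: sum.reindex)
  have "real_Bstar R x (z i) = u (z i)" for i
    by (subst x) (simp add: real_Bstar_sum real_Bstar_scale real_Bstar_z if_distrib cong: if_cong)
  then show ?thesis using x by simp
qed

lemma Bstar_expansion: "(\<Sum>i\<in>UNIV. Bstar R x (cplx (z i)) *s cplx (z i)) = x"
proof -
  define a b :: "real ^ 'n" where "a = (\<chi> i. Re (x $ i))" and "b = (\<chi> i. Im (x $ i))"
  have x: "x = cplx a + \<i> *s cplx b"
    by (simp add: vec_eq_iff a_def b_def cplx_def complex_eq)
  have *: "(\<Sum>i\<in>UNIV. Bstar R (cplx a) (cplx (z i)) *s cplx (z i)) = cplx a" for a
    using arg_cong[OF orthonormal_expansion[of a], of cplx] by (simp add: cplx_sum cplx_scale Bstar_cplx)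
  have "Bstar R x u = Bstar R (cplx a) u + \<i> * Bstar R (cplx b) u" for u
    by (simp add: x Bstar_def pairing_commute[of "cplx (coroot R _)" "_ + _"] pairing_commute[of "cplx (coroot R _)" "_ *s _"]
      pairing_add pairing_scale sum.distrib sum_distrib_left algebra_simps)
      (simp add: pairing_commute)
  then have "(\<Sum>i\<in>UNIV. Bstar R x (cplx (z i)) *s cplx (z i)) =
      (\<Sum>i\<in>UNIV. Bstar R (cplx a) (cplx (z i)) *s cplx (z i)) +
      \<i> *s (\<Sum>i\<in>UNIV. Bstar R (cplx b) (cplx (z i)) *s cplx (z i))"
    by (simp add: vec.scale_sum_right vec.scale_left_distrib sum.distrib vector_smult_assoc)
  then show ?thesis using * x by simp
qed

text \<open>Ensures that each Dunkl operator has the form \<open>T (Biso R x)\<close>, the image of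
  a multiplication operator under the involution.\<close>

lemma surj_Biso: "\<exists>x. Biso R x = y"
proof
  \<comment> \<open>For an orthonormal basis the inverse isomorphism takes the values of the basis
    functionals at \<open>y\<close> as coordinates.\<close>
  let ?x = "\<Sum>i\<in>UNIV. pairing (cplx (z i)) y *s cplx (z i)"
  show "Biso R ?x = y"
  proof (rule pairing_eqI)
    fix u
    have "pairing (Biso R ?x) u = (\<Sum>i\<in>UNIV. pairing (cplx (z i)) y * Bstar R (cplx (z i)) u)"
      unfolding pairing_Biso Bstar_def
      by (simp add: pairing_commute[of "cplx (coroot R _)"] pairing_sum pairing_scale
        sum_distrib_left sum_distrib_right mult.assoc) (rule sum.swap)
    also have "\<dots> = pairing (\<Sum>i\<in>UNIV. Bstar R u (cplx (z i)) *s cplx (z i)) y"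
      by (simp add: pairing_sum pairing_scale Bstar_def mult.commute)
    also have "\<dots> = pairing y u"
      by (simp add: Bstar_expansion pairing_commute)
    finally show "pairing (Biso R ?x) u = pairing y u" .
  qed
qed

text \<open>\<open>E\<close> is half a squared norm, so its gradient in the direction dual to
  \<open>x\<close> is \<open>x\<close>: the factor 1/2 absorbs the exponent, and the orthonormal
  expansion reassembles \<open>x\<close>. Both directions of the theorem draw their linear forms
  from here.\<close>

lemma dir_deriv_E: "dir_deriv (Biso R x) (E_poly z) = linear_form x"
proof -
  have "dir_deriv (Biso R x) (E_poly z) =
      Const (1/2) * (\<Sum>i\<in>UNIV. Const (2 * Bstar R x (cplx (z i))) * linear_form (cplx (z i)))"
    by (simp add: E_poly_def dir_deriv_mult dir_deriv_sum dir_deriv_power dir_deriv_linear_form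
      pairing_Biso pairing_commute[of _ "Biso R x"] Const_mult Const_of_nat[of 2, simplified] mult_ac)
  also have "\<dots> = linear_form (\<Sum>i\<in>UNIV. Bstar R x (cplx (z i)) *s cplx (z i))"
    by (simp add: linear_form_sum linear_form_scale sum_distrib_left flip: mult.assoc Const_mult)
  finally show ?thesis by (simp add: Bstar_expansion)
qed

text \<open>The reflection subtracts \<open>a i\<close> times \<alpha> from \<open>z i\<close>.
  Expanding the squares produces a cross term and a square term in \<alpha>; scaled by
  \<open>b\<close>, the expansion of \<alpha> in the basis turns them into -4 and +4 times the
  square of \<alpha>.\<close>

lemma weyl_act_E_reflection:
  assumes "\<alpha> \<in> R"
  shows "weyl_act (r \<alpha>) (E_poly z) = E_poly z"
proof -
  define a where "a i = z i \<bullet> cor \<alpha>" for i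
  define b where "b = real_Bstar R \<alpha> \<alpha>"
  let ?l = "\<lambda>x. linear_form (cplx x) :: 'n cpoly"
  have r\<alpha>: "r \<alpha> \<alpha> = - \<alpha>" using assms by (simp add: reflection_def root_coroot scaleR_2)
  \<comment> \<open>\<open>b\<close> is a sum of real squares, one of which is the square of 2, so
    it can be divided out at the end.\<close>
  have "(cor \<alpha> \<bullet> \<alpha>) * (cor \<alpha> \<bullet> \<alpha>) \<le> b"
    unfolding b_def real_Bstar_def
    by (rule member_le_sum) (use assms finite_R in auto)
  then have "b \<noteq> 0" using root_coroot[OF assms] by (auto simp: inner_commute)
  \<comment> \<open>Invariance moves the reflection from one argument to the other; evaluating it on
    both sides expresses the coroot through the form.\<close>
  have "2 * real_Bstar R \<alpha> x = b * (x \<bullet> cor \<alpha>)" for x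
  proof -
    have "real_Bstar R (r \<alpha> \<alpha>) x = real_Bstar R \<alpha> (r \<alpha> x)"
      using real_Bstar_reflection[OF assms, of \<alpha> "r \<alpha> x"] reflection_involutive[OF assms] by simp
    moreover have "real_Bstar R (- \<alpha>) x = - real_Bstar R \<alpha> x"
      using real_Bstar_scale[of "-1" \<alpha> x] by simp
    moreover have "real_Bstar R \<alpha> (r \<alpha> x) = real_Bstar R \<alpha> x - (x \<bullet> cor \<alpha>) * b"
    proof -
      have "real_Bstar R \<alpha> (r \<alpha> x) = real_Bstar R (x + (- (x \<bullet> cor \<alpha>)) *\<^sub>R \<alpha>) \<alpha>"
        by (subst real_Bstar_commute) (simp add: reflection_def)
      then show ?thesis
        by (simp only: real_Bstar_add real_Bstar_scale b_def real_Bstar_commute[of x])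
    qed
    ultimately show ?thesis using r\<alpha> by (simp add: algebra_simps)
  qed
  then have ba: "b * a i = 2 * real_Bstar R \<alpha> (z i)" for i by (simp add: a_def)
  have two: "Const 2 = (2 :: 'n cpoly)"
    using Const_of_nat[of 2] by simp
  have sum: "(\<Sum>i\<in>UNIV. (b * a i) *\<^sub>R z i) = 2 *\<^sub>R \<alpha>"
    using orthonormal_expansion[of \<alpha>] by (simp add: ba flip: scaleR_scaleR scaleR_sum_right)
  have sum_a: "(\<Sum>i\<in>UNIV. b * a i * a i) = 4"
    using arg_cong[OF sum, of "\<lambda>x. x \<bullet> cor \<alpha>"] root_coroot[OF assms]
    by (simp add: inner_sum_left a_def)
  have sum_l: "(\<Sum>i\<in>UNIV. Const (complex_of_real (b * a i)) * ?l (z i)) = Const 2 * ?l \<alpha>"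
    using arg_cong[OF sum, of ?l]
    by (simp add: cplx_sum cplx_scale linear_form_sum linear_form_scale)
  have l: "weyl_act (r \<alpha>) (?l x) = ?l x - Const (complex_of_real (x \<bullet> cor \<alpha>)) * ?l \<alpha>" for x
    by (simp add: weyl_act_linear_form complexified_cplx[OF linear_reflection])
       (simp add: reflection_def cplx_diff cplx_scale linear_form_diff linear_form_scale)
  have "Const (complex_of_real b) * (\<Sum>i\<in>UNIV. weyl_act (r \<alpha>) (?l (z i) ^ 2)) =
      Const (complex_of_real b) * (\<Sum>i\<in>UNIV. ?l (z i) ^ 2)
      - Const 2 * ?l \<alpha> * (\<Sum>i\<in>UNIV. Const (complex_of_real (b * a i)) * ?l (z i))
      + Const (\<Sum>i\<in>UNIV. complex_of_real (b * a i * a i)) * ?l \<alpha> ^ 2"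
  proof -
    have "Const (complex_of_real b) * weyl_act (r \<alpha>) (?l (z i) ^ 2) = Const (complex_of_real b) * ?l (z i) ^ 2
        - Const 2 * ?l \<alpha> * (Const (complex_of_real (b * a i)) * ?l (z i))
        + Const (complex_of_real (b * a i * a i)) * ?l \<alpha> ^ 2" for i
    proof -
      have *: "B * (y - A * x)^2 = B * y^2 - 2 * x * (B * A * y) + B * A * A * x^2" for A B x y :: "'n cpoly"
        by (simp add: power2_eq_square algebra_simps)
      show ?thesis
        by (simp add: weyl_act_power l a_def[symmetric] * Const_mult two)
    qed
    then show ?thesis
      by (simp only: sum_distrib_left sum_subtractf sum.distrib Const_sum sum_distrib_right)
  qed
  also have "(\<Sum>i\<in>UNIV. complex_of_real (b * a i * a i)) = 4"
    using arg_cong[OF sum_a, of complex_of_real] by simp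
  also note sum_l
  also have "Const (complex_of_real b) * (\<Sum>i\<in>UNIV. ?l (z i) ^ 2) - Const 2 * ?l \<alpha> * (Const 2 * ?l \<alpha>)
      + Const 4 * ?l \<alpha> ^ 2 = Const (complex_of_real b) * (\<Sum>i\<in>UNIV. ?l (z i) ^ 2)"
  proof -
    have "Const 4 = Const 2 * (Const 2 :: 'n cpoly)" by (simp flip: Const_mult)
    then show ?thesis by (simp add: power2_eq_square mult_ac)
  qed
  finally have "Const (inverse (complex_of_real b)) * (Const (complex_of_real b) * (\<Sum>i\<in>UNIV. weyl_act (r \<alpha>) (?l (z i) ^ 2)))
     = Const (inverse (complex_of_real b)) * (Const (complex_of_real b) * (\<Sum>i\<in>UNIV. ?l (z i) ^ 2))"
    by simp
  then have "(\<Sum>i\<in>UNIV. weyl_act (r \<alpha>) (?l (z i) ^ 2)) = (\<Sum>i\<in>UNIV. ?l (z i) ^ 2)"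
    using \<open>b \<noteq> 0\<close> by (simp flip: mult.assoc Const_mult)
  then show ?thesis
    by (simp add: E_poly_def weyl_act_mult weyl_act_sum)
qed

lemma weyl_act_E: "w \<in> W \<Longrightarrow> weyl_act w (E_poly z) = E_poly z"
proof (induction rule: weyl_group.induct)
  case weyl_id
  show ?case by (rule trans[OF fun_cong[OF weyl_act_id] id_apply])
next
  case (weyl_reflection \<alpha> w)
  then show ?case
    unfolding weyl_act_comp[OF linear_reflection] by (simp add: weyl_act_E_reflection)
qed

section \<open>Dunkl operators\<close>

definition quot_diff :: "real ^ 'n \<Rightarrow> 'n cpoly \<Rightarrow> 'n cpoly" where
  "quot_diff \<alpha> p = poly_quot (p - weyl_act (r \<alpha>) p) (linear_form (cplx \<alpha>))"

lemma weyl_act_reflection_linear_form: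
  "linear_form x - weyl_act (r \<alpha>) (linear_form x) =
     linear_form (cplx \<alpha>) * Const (pairing x (cplx (cor \<alpha>)))"
proof -
  have "Var i - weyl_act (r \<alpha>) (Var i) = Const (pairing (axis i 1) (cplx (cor \<alpha>))) * linear_form (cplx \<alpha>)" for i
  proof -
    have "Var i - weyl_act (r \<alpha>) (Var i) = linear_form (cplx ((axis i 1 \<bullet> cor \<alpha>) *\<^sub>R \<alpha>))"
      by (simp add: weyl_act_Var reflection_def cplx_diff linear_form_diff cplx_axis linear_form_axis)
    then show ?thesis
      by (simp add: cplx_scale linear_form_scale pairing_cplx flip: cplx_axis)
  qed
  then have *: "weyl_act (r \<alpha>) (Var i) = Var i - Const (pairing (axis i 1) (cplx (cor \<alpha>))) * linear_form (cplx \<alpha>)" for i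
    by (simp add: algebra_simps)
  show ?thesis
    by (simp add: linear_form_eq_Var[of x] weyl_act_sum weyl_act_mult *)
       (simp add: right_diff_distrib sum_subtractf pairing_commute[of "axis _ _"] pairing_axis
          pairing_def[of x] Const_sum Const_mult sum_distrib_left sum_distrib_right mult_ac)
qed

text \<open>Gives meaning to the definite description in \<open>poly_quot\<close>: a quotient exists
  on generators and is inherited by sums and products, and it is unique because nonzero linear forms
  cancel.\<close>

lemma quot_diff:
  assumes "\<alpha> \<in> R"
  shows "linear_form (cplx \<alpha>) * quot_diff \<alpha> p = p - weyl_act (r \<alpha>) p"
proof -
  have nz: "cplx \<alpha> \<noteq> 0" using assms zero_notin_R by (auto simp: cplx_eq_0_iff)
  let ?l = "linear_form (cplx \<alpha>)"
  have "\<exists>g. ?l * g = p - weyl_act (r \<alpha>) p"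
  proof (induction p rule: cpoly_induct)
    case (Const c)
    show ?case by (rule exI[of _ 0]) simp
  next
    case (Var i)
    show ?case
      using weyl_act_reflection_linear_form[of "axis i 1" \<alpha>] by (metis linear_form_axis)
  next
    case (add p q)
    then obtain g h where "?l * g = p - weyl_act (r \<alpha>) p" "?l * h = q - weyl_act (r \<alpha>) q" by blast
    then show ?case
      by (intro exI[of _ "g + h"]) (simp add: weyl_act_add distrib_left)
  next
    case (mult p q)
    then obtain g h where gh: "?l * g = p - weyl_act (r \<alpha>) p" "?l * h = q - weyl_act (r \<alpha>) q" by blast
    \<comment> \<open>The witness is the twisted Leibniz rule, with the reflection acting on
      \<open>q\<close> in the second term.\<close>
    have "?l * (p * h + g * weyl_act (r \<alpha>) q) = p * (?l * h) + (?l * g) * weyl_act (r \<alpha>) q"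
      by (simp add: distrib_left mult_ac)
    then have "?l * (p * h + g * weyl_act (r \<alpha>) q) = p * q - weyl_act (r \<alpha>) (p * q)"
      unfolding gh by (simp add: weyl_act_mult algebra_simps)
    then show ?case by blast
  qed
  then obtain g where g: "?l * g = p - weyl_act (r \<alpha>) p" by blast
  show ?thesis
    unfolding quot_diff_def poly_quot_def
  proof (rule theI[where a = g])
    show "h = g" if "?l * h = p - weyl_act (r \<alpha>) p" for h
      by (rule linear_form_mult_cancel[OF nz]) (simp add: g that)
  qed (rule g)
qed

lemma quot_diff_unique:
  assumes "\<alpha> \<in> R" "linear_form (cplx \<alpha>) * g = p - weyl_act (r \<alpha>) p"
  shows "quot_diff \<alpha> p = g"
proof (rule linear_form_mult_cancel)
  show "cplx \<alpha> \<noteq> 0" using assms zero_notin_R by (auto simp: cplx_eq_0_iff)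
qed (simp add: assms quot_diff)

lemma quot_diff_add: "\<alpha> \<in> R \<Longrightarrow> quot_diff \<alpha> (p + q) = quot_diff \<alpha> p + quot_diff \<alpha> q"
  by (rule quot_diff_unique) (simp_all add: distrib_left quot_diff weyl_act_add)

lemma quot_diff_mult:
  assumes "\<alpha> \<in> R"
  shows "quot_diff \<alpha> (p * q) = p * quot_diff \<alpha> q + quot_diff \<alpha> p * weyl_act (r \<alpha>) q"
proof (rule quot_diff_unique[OF assms])
  have "linear_form (cplx \<alpha>) * (p * quot_diff \<alpha> q + quot_diff \<alpha> p * weyl_act (r \<alpha>) q) =
      p * (linear_form (cplx \<alpha>) * quot_diff \<alpha> q) + (linear_form (cplx \<alpha>) * quot_diff \<alpha> p) * weyl_act (r \<alpha>) q"
    by (simp add: distrib_left mult_ac)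
  then show "linear_form (cplx \<alpha>) * (p * quot_diff \<alpha> q + quot_diff \<alpha> p * weyl_act (r \<alpha>) q) =
      p * q - weyl_act (r \<alpha>) (p * q)"
    by (simp add: quot_diff[OF assms] weyl_act_mult algebra_simps)
qed

lemma quot_diff_invariant: "\<alpha> \<in> R \<Longrightarrow> weyl_act (r \<alpha>) p = p \<Longrightarrow> quot_diff \<alpha> p = 0"
  by (rule quot_diff_unique) simp_all

lemma quot_diff_linear_form:
  "\<alpha> \<in> R \<Longrightarrow> quot_diff \<alpha> (linear_form x) = Const (pairing x (cplx (cor \<alpha>)))"
  by (rule quot_diff_unique) (simp_all add: weyl_act_reflection_linear_form)

abbreviation "T \<equiv> dunkl R Rp k"

lemma dunkl_eq: "T y p = dir_deriv y p +
    (\<Sum>\<alpha>\<in>Rp. Const (k \<alpha> * pairing (cplx \<alpha>) y) * quot_diff \<alpha> p)"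
  by (simp add: dunkl_def quot_diff_def)

lemma dunkl_add: "T y (p + q) = T y p + T y q"
  using Rp_subset
  by (simp add: dunkl_eq dir_deriv_add quot_diff_add subset_iff distrib_left sum.distrib)

lemma dunkl_mult: "T y (p * q) = p * T y q + dir_deriv y p * q +
    (\<Sum>\<alpha>\<in>Rp. Const (k \<alpha> * pairing (cplx \<alpha>) y) * quot_diff \<alpha> p * weyl_act (r \<alpha>) q)"
  using Rp_subset
  by (simp add: dunkl_eq dir_deriv_mult quot_diff_mult subset_iff distrib_left sum.distrib
     sum_distrib_left mult_ac add_ac)

text \<open>An invariant factor has zero divided differences, so no reflection term survives. Hence
  the commutator of a Dunkl operator with a polynomial in \<open>E\<close> is multiplication by a
  polynomial.\<close>

lemma dunkl_mult_invariant:
  assumes "\<And>w. w \<in> W \<Longrightarrow> weyl_act w p = p"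
  shows "T y (p * q) = p * T y q + dir_deriv y p * q"
proof -
  have "quot_diff \<alpha> p = 0" if "\<alpha> \<in> Rp" for \<alpha>
    using that Rp_subset assms reflection_in_W by (intro quot_diff_invariant) auto
  then show ?thesis by (simp add: dunkl_mult)
qed

lemma dunkl_Const_mult: "T y (Const c * p) = Const c * T y p"
  by (subst dunkl_mult_invariant) simp_all

lemma dunkl_linear_form_mult: "T y (linear_form x * q) = linear_form x * T y q + Const (pairing x y) * q +
    (\<Sum>\<alpha>\<in>Rp. Const (k \<alpha> * pairing (cplx \<alpha>) y * pairing x (cplx (cor \<alpha>))) * weyl_act (r \<alpha>) q)"
  using Rp_subset
  by (simp add: dunkl_mult dir_deriv_linear_form quot_diff_linear_form subset_iff Const_mult mult.assoc)

text \<open>Weighting by the variables turns the coordinates of \<alpha> into its linear form, which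
  cancels the denominator of the divided difference. This is what places the degree operator in
  \<open>H\<close>.\<close>

lemma sum_Var_dunkl: "(\<Sum>i\<in>UNIV. Var i * T (axis i 1) p) =
    euler p + (\<Sum>\<alpha>\<in>Rp. Const (k \<alpha>) * (p - weyl_act (r \<alpha>) p))"
proof -
  have d: "dir_deriv (axis i 1) p = partial_deriv i p" for i
  proof -
    have "dir_deriv (axis i 1) p = (\<Sum>j\<in>UNIV. if j = i then partial_deriv j p else 0)"
      unfolding dir_deriv_def by (intro sum.cong) (auto simp: axis_def)
    then show ?thesis by simp
  qed
  have "(\<Sum>i\<in>UNIV. \<Sum>\<alpha>\<in>Rp. Var i * (Const (k \<alpha> * cplx \<alpha> $ i) * quot_diff \<alpha> p)) =
      (\<Sum>\<alpha>\<in>Rp. Const (k \<alpha>) * (linear_form (cplx \<alpha>) * quot_diff \<alpha> p))"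
    by (subst sum.swap)
       (simp add: linear_form_eq_Var sum_distrib_left sum_distrib_right Const_mult mult_ac)
  also have "\<dots> = (\<Sum>\<alpha>\<in>Rp. Const (k \<alpha>) * (p - weyl_act (r \<alpha>) p))"
    using Rp_subset by (intro sum.cong) (auto simp: quot_diff)
  finally show ?thesis
    by (simp add: dunkl_eq d euler_def distrib_left sum.distrib pairing_axis sum_distrib_left)
qed

end

section \<open>The Cherednik algebra\<close>

text \<open>Sums of sorted products. \<open>dunkl_plus\<close> has no unit, so \<open>id\<close> is
  adjoined to reach all polynomials in Dunkl operators; scalars are absorbed into \<open>p\<close>.
  Uniqueness of such expressions is not claimed.\<close>

inductive_set triangular ::
  "(real ^ 'n) set \<Rightarrow> (real ^ 'n) set \<Rightarrow> (real ^ 'n \<Rightarrow> complex) \<Rightarrow> 'n::finite oper set"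
  for R Rp :: "(real ^ 'n) set" and k :: "real ^ 'n \<Rightarrow> complex" where
  triangular_base: "w \<in> weyl_group R \<Longrightarrow> s \<in> insert id (dunkl_plus R Rp k) \<Longrightarrow>
     op_mult p \<circ> weyl_act w \<circ> s \<in> triangular R Rp k"
| triangular_add: "a \<in> triangular R Rp k \<Longrightarrow> b \<in> triangular R Rp k \<Longrightarrow> op_add a b \<in> triangular R Rp k"

locale verma_setup = dunkl_setup R Rp k z
  for R Rp :: "(real ^ 'n::finite) set" and k z +
  fixes \<rho> :: "(real ^ 'n \<Rightarrow> real ^ 'n) \<Rightarrow> complex ^ 'm::finite ^ 'm"
    and \<sigma> :: "'n oper \<Rightarrow> 'n oper"
    and \<pi> :: "'n oper \<Rightarrow> (real ^ 'n \<Rightarrow> real ^ 'n) \<Rightarrow> complex"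
    and form :: "complex ^ 'm \<Rightarrow> complex ^ 'm \<Rightarrow> complex"
    and v :: "complex ^ 'm"
  assumes irreducible: "irreducible_rep R \<rho>"
    and involution: "cherednik_involution R Rp k \<sigma>"
    and projection: "cherednik_projection R Rp k \<pi>"
    and invariant: "invariant_form R \<rho> form"
    and v_nonzero: "v \<noteq> 0"
begin

abbreviation "H \<equiv> cherednik R Rp k"
abbreviation "S \<equiv> dunkl_plus R Rp k"

lemmas op_defs = op_mult_def op_scale_def op_add_def

text \<open>Operators are arbitrary functions, so composition distributes over sums in its left
  argument for free; in its right argument it takes additivity of the outer operator, which members
  of \<open>H\<close> inherit from the generators.\<close>

lemma H_linear: "a \<in> H \<Longrightarrow> a (p + q) = a p + a q \<and> a (Const c * p) = Const c * a p"
proof (induction arbitrary: p q c rule: cherednik.induct)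
  case (cherednik_weyl w)
  then show ?case by (simp add: weyl_act_add weyl_act_mult)
next
  case (cherednik_mult x)
  then show ?case by (simp add: op_defs distrib_left mult_ac)
next
  case (cherednik_dunkl y)
  then show ?case by (simp add: dunkl_add dunkl_Const_mult)
next
  case (cherednik_add a b)
  then show ?case by (simp add: op_defs distrib_left mult_ac add_ac)
next
  case (cherednik_scale a c')
  then show ?case by (simp add: op_defs distrib_left mult_ac)
qed simp

lemma H_add: "a \<in> H \<Longrightarrow> a (p + q) = a p + a q"
  and H_Const_mult: "a \<in> H \<Longrightarrow> a (Const c * p) = Const c * a p"
  using H_linear by blast+

lemma H_0: "a \<in> H \<Longrightarrow> a 0 = 0"
  using H_Const_mult[of a 0 0] by simp

lemma comp_op_add: "a \<in> H \<Longrightarrow> a \<circ> op_add b c = op_add (a \<circ> b) (a \<circ> c)"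
  by (rule ext) (simp add: op_defs H_add)

lemma comp_op_scale: "a \<in> H \<Longrightarrow> a \<circ> op_scale c b = op_scale c (a \<circ> b)"
  by (rule ext) (simp add: op_defs H_Const_mult)

lemma op_add_comp: "op_add a b \<circ> c = op_add (a \<circ> c) (b \<circ> c)"
  and op_scale_comp: "op_scale x a \<circ> c = op_scale x (a \<circ> c)"
  by (simp_all add: op_defs fun_eq_iff)

lemma S_subset_H: "s \<in> S \<Longrightarrow> s \<in> H"
  by (induction rule: dunkl_plus.induct) (blast intro: cherednik.intros)+

lemma id_in_H: "id \<in> H"
  using cherednik_weyl[OF weyl_id, of R Rp k] by (metis weyl_act_id)

lemma S_id_subset_H: "s \<in> insert id S \<Longrightarrow> s \<in> H"
  using S_subset_H id_in_H by blast

lemma scale_id_in_H: "op_scale c id \<in> H"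
  by (rule cherednik_scale[OF id_in_H])

lemma op_mult_Const: "op_mult (Const c) = op_scale c id"
  by (simp add: op_defs fun_eq_iff)

lemma op_mult_mult: "op_mult (p * q) = op_mult p \<circ> op_mult q"
  by (simp add: op_defs fun_eq_iff mult.assoc)

lemma op_mult_add: "op_mult (p + q) = op_add (op_mult p) (op_mult q)"
  by (simp add: op_defs fun_eq_iff distrib_right)

lemma op_mult_Const_mult: "op_mult (Const c * p) = op_scale c (op_mult p)"
  by (simp add: op_defs fun_eq_iff mult.assoc)

lemma weyl_comp_op_mult: "weyl_act w \<circ> op_mult p = op_mult (weyl_act w p) \<circ> weyl_act w"
  by (simp add: op_defs fun_eq_iff weyl_act_mult)

lemma weyl_comp_weyl: "w \<in> W \<Longrightarrow> weyl_act w \<circ> weyl_act w' = weyl_act (w \<circ> w')"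
  by (rule ext) (unfold weyl_act_comp[OF linear_W] comp_apply, rule refl)

lemma op_mult_in_H: "op_mult p \<in> H"
proof (induction p rule: cpoly_induct)
  case (Const c)
  show ?case unfolding op_mult_Const by (rule scale_id_in_H)
next
  case (Var i)
  show ?case using cherednik_mult[of "axis i 1" R Rp k] unfolding linear_form_axis .
next
  case (add p q)
  then show ?case unfolding op_mult_add by (rule cherednik_add)
next
  case (mult p q)
  then show ?case unfolding op_mult_mult by (rule cherednik_comp)
qed

lemma sigma_in_H: "a \<in> H \<Longrightarrow> \<sigma> a \<in> H"
  and sigma_sigma: "a \<in> H \<Longrightarrow> \<sigma> (\<sigma> a) = a"
  and sigma_scale: "a \<in> H \<Longrightarrow> \<sigma> (op_scale c a) = op_scale c (\<sigma> a)"
  and sigma_add: "a \<in> H \<Longrightarrow> b \<in> H \<Longrightarrow> \<sigma> (op_add a b) = op_add (\<sigma> a) (\<sigma> b)"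
  and sigma_comp: "a \<in> H \<Longrightarrow> b \<in> H \<Longrightarrow> \<sigma> (a \<circ> b) = \<sigma> b \<circ> \<sigma> a"
  and sigma_linear_form: "\<sigma> (op_mult (linear_form x)) = T (Biso R x)"
  and sigma_dunkl: "\<sigma> (T y) = op_mult (linear_form (inv (Biso R) y))"
  and sigma_weyl: "w \<in> W \<Longrightarrow> \<sigma> (weyl_act w) = weyl_act (inv w)"
  using involution unfolding cherednik_involution_def by blast+

lemma sigma_id: "\<sigma> id = id"
proof -
  have "inv id = (id :: real ^ 'n \<Rightarrow> real ^ 'n)" by (rule inv_id)
  then show ?thesis using sigma_weyl[OF weyl_id] by (simp only: weyl_act_id)
qed

text \<open>The equivariance of Dunkl operators is the image under the involution of the evident
  equivariance of multiplication operators.\<close>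

lemma dunkl_comp_weyl:
  assumes "w \<in> W"
  shows "\<exists>y'. T y \<circ> weyl_act w = weyl_act w \<circ> T y'"
proof -
  obtain x where x: "Biso R x = y" using surj_Biso by blast
  have "\<sigma> (weyl_act (inv w) \<circ> op_mult (linear_form x)) =
      \<sigma> (op_mult (linear_form (complexified (inv w) x)) \<circ> weyl_act (inv w))"
    by (simp only: weyl_comp_op_mult weyl_act_linear_form)
  then have "T y \<circ> weyl_act w = weyl_act w \<circ> T (Biso R (complexified (inv w) x))"
    by (simp only: sigma_comp sigma_weyl sigma_linear_form inv_W assms x inv_inv_W
        cherednik_weyl op_mult_in_H)
  then show ?thesis by blast
qed

lemma S_comp_weyl:
  assumes "w \<in> W" "s \<in> S"
  shows "\<exists>s'\<in>S. s \<circ> weyl_act w = weyl_act w \<circ> s'"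
  using assms(2)
proof (induction rule: dunkl_plus.induct)
  case (dunkl_plus_gen y)
  then show ?case using dunkl_comp_weyl[OF assms(1), of y] dunkl_plus.dunkl_plus_gen by blast
next
  case (dunkl_plus_add a b)
  then obtain a' b' where ab: "a' \<in> S" "b' \<in> S" "a \<circ> weyl_act w = weyl_act w \<circ> a'"
      "b \<circ> weyl_act w = weyl_act w \<circ> b'" by blast
  then have "op_add a b \<circ> weyl_act w = weyl_act w \<circ> op_add a' b'"
    by (simp only: op_add_comp comp_op_add[OF cherednik_weyl[OF assms(1)]])
  then show ?case using dunkl_plus.dunkl_plus_add[OF ab(1,2)] by blast
next
  case (dunkl_plus_scale a c)
  then obtain a' where a: "a' \<in> S" "a \<circ> weyl_act w = weyl_act w \<circ> a'" by blast
  then have "op_scale c a \<circ> weyl_act w = weyl_act w \<circ> op_scale c a'"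
    by (simp only: op_scale_comp comp_op_scale[OF cherednik_weyl[OF assms(1)]])
  then show ?case using dunkl_plus.dunkl_plus_scale[OF a(1)] by blast
next
  case (dunkl_plus_comp a b)
  then obtain a' b' where ab: "a' \<in> S" "b' \<in> S" "a \<circ> weyl_act w = weyl_act w \<circ> a'"
      "b \<circ> weyl_act w = weyl_act w \<circ> b'" by blast
  then have "(a \<circ> b) \<circ> weyl_act w = weyl_act w \<circ> (a' \<circ> b')"
    by (metis comp_assoc)
  then show ?case using dunkl_plus.dunkl_plus_comp[OF ab(1,2)] by blast
qed

subsection \<open>Triangular decomposition\<close>

abbreviation "tri \<equiv> triangular R Rp k"

lemma tri_subset_H: "a \<in> tri \<Longrightarrow> a \<in> H"
  by (induction rule: triangular.induct)
     (blast intro: cherednik_comp op_mult_in_H cherednik_weyl cherednik_add S_id_subset_H)+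

lemma tri_op_mult: "a \<in> tri \<Longrightarrow> op_mult q \<circ> a \<in> tri"
proof (induction rule: triangular.induct)
  case (triangular_base w s p)
  then show ?case
    using triangular.triangular_base[OF triangular_base, of "q * p"]
    by (simp only: op_mult_mult comp_assoc)
next
  case (triangular_add a b)
  then show ?case
    by (simp only: comp_op_add[OF op_mult_in_H] triangular.triangular_add)
qed

lemma tri_weyl: "a \<in> tri \<Longrightarrow> w \<in> W \<Longrightarrow> weyl_act w \<circ> a \<in> tri"
proof (induction rule: triangular.induct)
  case (triangular_base w' s p)
  have "weyl_act w \<circ> (op_mult p \<circ> weyl_act w' \<circ> s) =
      (weyl_act w \<circ> op_mult p) \<circ> weyl_act w' \<circ> s"
    by (simp only: comp_assoc)
  also have "\<dots> = op_mult (weyl_act w p) \<circ> (weyl_act w \<circ> weyl_act w') \<circ> s"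
    by (simp only: comp_assoc weyl_comp_op_mult)
  also have "\<dots> = op_mult (weyl_act w p) \<circ> weyl_act (w \<circ> w') \<circ> s"
    by (simp only: weyl_comp_weyl triangular_base)
  finally show ?case
    using triangular.triangular_base[OF W_comp] triangular_base by metis
next
  case (triangular_add a b)
  then show ?case
    by (simp only: comp_op_add[OF cherednik_weyl] triangular.triangular_add)
qed

lemma tri_sum:
  assumes "finite A" "\<And>i. i \<in> A \<Longrightarrow> f i \<in> tri"
  shows "(\<lambda>p. \<Sum>i\<in>A. f i p) \<in> tri"
  using assms
proof (induction A rule: finite_induct)
  case empty
  have "(\<lambda>p. \<Sum>i\<in>{}. f i p) = op_mult 0 \<circ> weyl_act id \<circ> id"
    by (simp add: fun_eq_iff op_mult_def)
  then show ?case using triangular_base[OF weyl_id] by (metis insertI1)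
next
  case (insert i A)
  then have "(\<lambda>p. \<Sum>i\<in>insert i A. f i p) = op_add (f i) (\<lambda>p. \<Sum>i\<in>A. f i p)"
    by (simp add: fun_eq_iff op_add_def)
  then show ?case using insert by (simp add: triangular_add)
qed

text \<open>The product rule for \<open>T y\<close> on \<open>p\<close> leaves one term with a Dunkl
  operator to the left of \<open>w\<close>, moved across by equivariance; the others contain no new
  Dunkl operator and are sorted by the preceding closure rules.\<close>

lemma tri_dunkl: "a \<in> tri \<Longrightarrow> T y \<circ> a \<in> tri"
proof (induction rule: triangular.induct)
  case (triangular_base w s p)
  obtain y' where y': "T y \<circ> weyl_act w = weyl_act w \<circ> T y'"
    using dunkl_comp_weyl triangular_base by blast
  let ?c = "\<lambda>\<alpha>. Const (k \<alpha> * pairing (cplx \<alpha>) y) * quot_diff \<alpha> p"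
  let ?rest = "\<lambda>q. \<Sum>\<alpha>\<in>Rp. (op_mult (?c \<alpha>) \<circ> (weyl_act (r \<alpha>) \<circ> (op_mult 1 \<circ> weyl_act w \<circ> s))) q"
  have eq: "T y \<circ> (op_mult p \<circ> weyl_act w \<circ> s) = op_add (op_mult p \<circ> weyl_act w \<circ> (T y' \<circ> s))
      (op_add (op_mult (dir_deriv y p) \<circ> weyl_act w \<circ> s) ?rest)"
    using fun_cong[OF y', unfolded comp_apply]
    by (simp add: fun_eq_iff op_defs dunkl_mult mult.assoc add.assoc)
  \<comment> \<open>The new Dunkl operator joins \<open>s\<close>, or stands alone when
    \<open>s\<close> is \<open>id\<close>.\<close>
  have Ts: "T y' \<circ> s \<in> insert id S"
    using triangular_base(2) dunkl_plus_gen[of R Rp k y'] dunkl_plus_comp[of "T y'" R Rp k s] by auto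
  have rest: "?rest \<in> tri"
  proof (rule tri_sum[OF finite_Rp])
    fix \<alpha> assume "\<alpha> \<in> Rp"
    then show "op_mult (?c \<alpha>) \<circ> (weyl_act (r \<alpha>) \<circ> (op_mult 1 \<circ> weyl_act w \<circ> s)) \<in> tri"
      using Rp_subset triangular.triangular_base[OF triangular_base]
      by (intro tri_op_mult tri_weyl reflection_in_W) auto
  qed
  show ?case
    unfolding eq
    by (intro triangular.triangular_add triangular.triangular_base triangular_base Ts rest)
next
  case (triangular_add a b)
  then show ?case
    by (simp only: comp_op_add[OF cherednik_dunkl] triangular.triangular_add)
qed

text \<open>\<open>tri\<close> absorbs left multiplication by each generator, hence by all of
  \<open>H\<close>, and it contains \<open>id\<close>.\<close>

lemma H_subset_tri:
  assumes "a \<in> H"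
  shows "a \<in> tri"
proof -
  have "\<forall>b\<in>tri. a \<circ> b \<in> tri"
    using assms
  proof (induction rule: cherednik.induct)
    case (cherednik_weyl w)
    then show ?case by (blast intro: tri_weyl)
  next
    case (cherednik_mult x)
    then show ?case by (blast intro: tri_op_mult)
  next
    case (cherednik_dunkl y)
    then show ?case by (blast intro: tri_dunkl)
  next
    case (cherednik_add a b)
    then show ?case by (simp add: op_add_comp triangular_add del: comp_apply)
  next
    case (cherednik_scale a c)
    have "op_scale c a \<circ> b = op_mult (Const c) \<circ> (a \<circ> b)" for b
      by (simp add: fun_eq_iff op_defs)
    then show ?case using cherednik_scale tri_op_mult by metis
  next
    case (cherednik_comp a b)
    then show ?case by (metis comp_assoc)
  qed
  moreover have "op_mult 1 \<circ> weyl_act id \<circ> id \<in> tri" by (rule triangular_base[OF weyl_id]) simp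
  moreover have "op_mult 1 \<circ> weyl_act id \<circ> id = (id :: 'n oper)"
    unfolding weyl_act_id by (simp add: fun_eq_iff op_mult_def)
  ultimately show ?thesis by (metis comp_id)
qed

subsection \<open>The projection to the group algebra\<close>

lemma rho_id: "\<rho> id = mat 1"
  and rho_comp: "w \<in> W \<Longrightarrow> w' \<in> W \<Longrightarrow> \<rho> (w \<circ> w') = \<rho> w ** \<rho> w'"
  and invariant_subspace: "vec.subspace U \<Longrightarrow> (\<And>w u. w \<in> W \<Longrightarrow> u \<in> U \<Longrightarrow> \<rho> w *v u \<in> U) \<Longrightarrow>
      U = {0} \<or> U = UNIV"
  using irreducible unfolding irreducible_rep_def by blast+

lemma rho_comp_apply: "w \<in> W \<Longrightarrow> w' \<in> W \<Longrightarrow> \<rho> (w \<circ> w') *v u = \<rho> w *v (\<rho> w' *v u)"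
  by (simp add: rho_comp matrix_vector_mul_assoc)

lemma rho_inv: "w \<in> W \<Longrightarrow> \<rho> w *v (\<rho> (inv w) *v u) = u"
  using rho_comp_apply[of w "inv w" u] by (simp only: inv_W inv_W_comp rho_id matrix_vector_mul_lid)

text \<open>The lowest-degree part of \<open>a.u\<close>, obtained from the projection of
  \<open>a\<close> to the group algebra. Only values of \<open>\<pi> a\<close> on the Weyl group
  enter, the ones that \<open>cherednik_projection\<close> controls.\<close>

definition act :: "'n oper \<Rightarrow> complex ^ 'm \<Rightarrow> complex ^ 'm" where
  "act a u = group_algebra_act R \<rho> (\<pi> a) u"

lemma pi_rules:
  assumes "w \<in> W"
  shows "a \<in> H \<Longrightarrow> \<pi> (op_scale c a) w = c * \<pi> a w"
    and "a \<in> H \<Longrightarrow> b \<in> H \<Longrightarrow> \<pi> (op_add a b) w = \<pi> a w + \<pi> b w"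
    and "a \<in> H \<Longrightarrow> p \<in> poly_plus \<Longrightarrow> \<pi> (op_mult p \<circ> a) w = 0"
    and "a \<in> H \<Longrightarrow> s \<in> S \<Longrightarrow> \<pi> (a \<circ> s) w = 0"
    and "\<pi> (group_algebra_op R d) w = d w"
  using projection assms unfolding cherednik_projection_def by blast+

lemma act_scale: "a \<in> H \<Longrightarrow> act (op_scale c a) u = c *s act a u"
  by (simp add: act_def group_algebra_act_def pi_rules vec.scale_sum_right vector_smult_assoc)

lemma act_add: "a \<in> H \<Longrightarrow> b \<in> H \<Longrightarrow> act (op_add a b) u = act a u + act b u"
  by (simp add: act_def group_algebra_act_def pi_rules vec.scale_left_distrib sum.distrib)

lemma act_op_mult_comp: "a \<in> H \<Longrightarrow> p \<in> poly_plus \<Longrightarrow> act (op_mult p \<circ> a) u = 0"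
  by (simp add: act_def group_algebra_act_def pi_rules(3))

lemma act_comp_S: "a \<in> H \<Longrightarrow> s \<in> S \<Longrightarrow> act (a \<circ> s) u = 0"
  by (simp add: act_def group_algebra_act_def pi_rules(4))

lemma act_weyl:
  assumes "w \<in> W"
  shows "act (weyl_act w) u = \<rho> w *v u"
proof -
  let ?d = "\<lambda>w'. if w' = w then 1 else 0 :: complex"
  have "group_algebra_op R ?d = weyl_act w"
  proof
    fix p
    have "group_algebra_op R ?d p = (\<Sum>w'\<in>W. if w' = w then weyl_act w' p else 0)"
      unfolding group_algebra_op_def by (intro sum.cong) auto
    then show "group_algebra_op R ?d p = weyl_act w p"
      using assms finite_W by simp
  qed
  then have "act (weyl_act w) u = (\<Sum>w'\<in>W. ?d w' *s (\<rho> w' *v u))"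
    using pi_rules(5)[of _ ?d] by (simp add: act_def group_algebra_act_def)
  also have "\<dots> = (\<Sum>w'\<in>W. if w' = w then \<rho> w' *v u else 0)"
    by (intro sum.cong) auto
  finally show ?thesis using assms finite_W by simp
qed

lemma act_add_right: "act a (u + u') = act a u + act a u'"
  by (simp add: act_def group_algebra_act_def matrix_vector_right_distrib vec.scale_right_distrib sum.distrib)

lemma act_scale_right: "act a (c *s u) = c *s act a u"
  by (simp add: act_def group_algebra_act_def vector_scalar_commute vec.scale_sum_right
    vector_smult_assoc mult.commute)

lemma act_sum_right: "act a (\<Sum>i\<in>A. f i) = (\<Sum>i\<in>A. act a (f i))"
  using act_scale_right[of a 0]
  by (induction A rule: infinite_finite_induct) (simp_all add: act_add_right)

text \<open>The constant term of \<open>p\<close> acts as a scalar; the remainder lies in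
  \<open>poly_plus\<close> and is killed by the projection.\<close>

lemma act_op_mult_weyl:
  assumes "w \<in> W"
  shows "act (op_mult p \<circ> weyl_act w) u = Poly_Mapping.lookup p 0 *s (\<rho> w *v u)"
proof -
  let ?c = "Poly_Mapping.lookup p 0"
  have "op_mult p \<circ> weyl_act w =
      op_add (op_scale ?c (weyl_act w)) (op_mult (p - Const ?c) \<circ> weyl_act w)"
    by (simp add: fun_eq_iff op_defs left_diff_distrib)
  moreover have "p - Const ?c \<in> poly_plus" by (simp add: poly_plus_iff lookup_minus)
  ultimately show ?thesis
    using assms by (simp add: act_add act_scale act_weyl act_op_mult_comp cherednik_weyl cherednik_scale
        cherednik_comp op_mult_in_H del: comp_apply)
qed

lemma act_op_mult: "act (op_mult p) u = Poly_Mapping.lookup p 0 *s u"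
  using act_op_mult_weyl[OF weyl_id, of p u] unfolding weyl_act_id comp_id
  by (simp only: rho_id matrix_vector_mul_lid)

lemma act_base: "w \<in> W \<Longrightarrow> s \<in> insert id S \<Longrightarrow> act (op_mult p \<circ> weyl_act w \<circ> s) u =
    (if s = id then Poly_Mapping.lookup p 0 *s (\<rho> w *v u) else 0)"
  using act_op_mult_weyl[of w p u] act_comp_S[OF cherednik_comp[OF op_mult_in_H cherednik_weyl], of w s p u]
  by auto

text \<open>\<open>cherednik_projection\<close> prescribes linearity, a kernel and the values on the
  group algebra. Compatibility with right multiplication by the group is derived on triangular
  products, where \<open>w\<close> either meets \<open>w'\<close> directly or is moved past an
  element of \<open>S\<close>, which keeps the value zero.\<close>

lemma act_comp_weyl:
  assumes "a \<in> H" "w \<in> W"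
  shows "act (a \<circ> weyl_act w) u = act a (\<rho> w *v u)"
  using H_subset_tri[OF assms(1)]
proof (induction rule: triangular.induct)
  case (triangular_base w' s p)
  show ?case
  proof (cases "s = id")
    case True
    have "op_mult p \<circ> weyl_act w' \<circ> id \<circ> weyl_act w = op_mult p \<circ> weyl_act (w' \<circ> w)"
      by (simp only: comp_id comp_assoc weyl_comp_weyl triangular_base)
    then show ?thesis
      using act_op_mult_weyl[OF W_comp[OF triangular_base(1) assms(2)]]
        act_op_mult_weyl[OF triangular_base(1)] rho_comp_apply[OF triangular_base(1) assms(2)] True
      by (simp only: comp_id)
  next
    case False
    then have "s \<in> S" using triangular_base by simp
    then obtain s' where s': "s' \<in> S" "s \<circ> weyl_act w = weyl_act w \<circ> s'"
      using S_comp_weyl assms(2) by blast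
    have "op_mult p \<circ> weyl_act w' \<circ> s \<circ> weyl_act w = (op_mult p \<circ> weyl_act w' \<circ> weyl_act w) \<circ> s'"
      by (simp only: comp_assoc s'(2))
    then have "act (op_mult p \<circ> weyl_act w' \<circ> s \<circ> weyl_act w) u = 0"
      using act_comp_S[OF _ s'(1)] triangular_base(1) assms(2)
      by (metis cherednik_comp cherednik_weyl op_mult_in_H)
    then show ?thesis
      using act_base[OF triangular_base] False by (simp only: if_False)
  qed
next
  case (triangular_add a b)
  then show ?case
    by (simp only: op_add_comp act_add tri_subset_H cherednik_comp cherednik_weyl assms(2))
qed

lemma act_weyl_comp:
  assumes "a \<in> H" "w \<in> W"
  shows "act (weyl_act w \<circ> a) u = \<rho> w *v act a u"
  using H_subset_tri[OF assms(1)]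
proof (induction rule: triangular.induct)
  case (triangular_base w' s p)
  have "weyl_act w \<circ> (op_mult p \<circ> weyl_act w' \<circ> s) = op_mult (weyl_act w p) \<circ> weyl_act (w \<circ> w') \<circ> s"
    by (simp only: weyl_comp_weyl[OF assms(2), symmetric] weyl_comp_op_mult flip: comp_assoc)
  then show ?case
    using act_base[OF W_comp[OF assms(2) triangular_base(1)] triangular_base(2), of "weyl_act w p" u]
      act_base[OF triangular_base, of p u] rho_comp_apply[OF assms(2) triangular_base(1), of u]
    by (simp add: lookup_weyl_act_0 vector_scalar_commute del: comp_apply)
next
  case (triangular_add a b)
  then show ?case
    by (simp only: comp_op_add[OF cherednik_weyl[OF assms(2)]] act_add tri_subset_H cherednik_comp
        cherednik_weyl assms(2) matrix_vector_right_distrib)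
qed

lemma form_add: "form u (x + y) = form u x + form u y"
  and form_scale: "form u (c *s x) = c * form u x"
  and form_commute: "form u x = form x u"
  and form_nondegenerate: "(\<And>x. form u x = 0) \<Longrightarrow> u = 0"
  and form_invariant: "w \<in> W \<Longrightarrow> form (\<rho> w *v u) (\<rho> w *v x) = form u x"
  using invariant unfolding invariant_form_def by blast+

lemma form_0: "form u 0 = 0"
  using form_scale[of u 0 0] by simp

text \<open>Together with \<open>sigma_op_mult\<close>: the involution exchanges \<open>S\<close>
  with multiplication by \<open>poly_plus\<close>, and thereby the two one-sided ideals killed by
  \<open>\<pi>\<close>.\<close>

lemma sigma_S: "s \<in> S \<Longrightarrow> \<exists>q\<in>poly_plus. \<sigma> s = op_mult q"
proof (induction rule: dunkl_plus.induct)
  case (dunkl_plus_gen y)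
  show ?case using sigma_dunkl[of y]
    by (intro bexI[of _ "linear_form (inv (Biso R) y)"]) (simp_all add: poly_plus_iff)
next
  case (dunkl_plus_add a b)
  then obtain p q where "p \<in> poly_plus" "q \<in> poly_plus" "\<sigma> a = op_mult p" "\<sigma> b = op_mult q" by blast
  then show ?case
    using dunkl_plus_add(1,2)
    by (intro bexI[of _ "p + q"]) (simp_all add: sigma_add S_subset_H op_mult_add poly_plus_iff lookup_add)
next
  case (dunkl_plus_scale a c)
  then obtain p where "p \<in> poly_plus" "\<sigma> a = op_mult p" by blast
  then show ?case
    using dunkl_plus_scale(1)
    by (intro bexI[of _ "Const c * p"])
       (simp_all add: sigma_scale S_subset_H op_mult_Const_mult poly_plus_iff lookup_Const_mult)
next
  case (dunkl_plus_comp a b)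
  then obtain p q where "p \<in> poly_plus" "q \<in> poly_plus" "\<sigma> a = op_mult p" "\<sigma> b = op_mult q" by blast
  then show ?case
    using dunkl_plus_comp(1,2)
    by (intro bexI[of _ "q * p"])
       (simp_all only: sigma_comp S_subset_H op_mult_mult poly_plus_iff lookup_mult_0 mult_zero_left)
qed

lemma sigma_op_mult:
  assumes "p \<in> poly_plus"
  shows "\<sigma> (op_mult p) \<in> S"
proof -
  \<comment> \<open>A vanishing constant term is not inherited by the pieces of the induction, so
    the claim is made for every polynomial with its constant term removed.\<close>
  have "\<sigma> (op_mult (p - Const (Poly_Mapping.lookup p 0))) \<in> S" for p
  proof (induction p rule: cpoly_induct)
    case (Const c)
    \<comment> \<open>\<open>dunkl_plus\<close> has no rule for zero; it arises as \<open>0\<close>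
      times a generator.\<close>
    have "op_mult (0 :: 'n cpoly) = op_scale 0 (op_mult (linear_form 0))"
      by (simp add: fun_eq_iff op_defs)
    then show ?case
      using sigma_scale[OF op_mult_in_H] sigma_linear_form dunkl_plus_scale[OF dunkl_plus_gen]
      by (metis lookup_Const_0 cancel_comm_monoid_add_class.diff_cancel)
  next
    case (Var i)
    show ?case using sigma_linear_form[of "axis i 1"] dunkl_plus_gen by (simp add: linear_form_axis)
  next
    case (add p q)
    have "p + q - Const (Poly_Mapping.lookup (p + q) 0) =
        (p - Const (Poly_Mapping.lookup p 0)) + (q - Const (Poly_Mapping.lookup q 0))"
      by (simp add: lookup_add Const_add)
    then show ?case using add by (simp only: op_mult_add sigma_add op_mult_in_H dunkl_plus_add)
  next
    case (mult p q)
    let ?a = "Poly_Mapping.lookup p 0" and ?b = "Poly_Mapping.lookup q 0"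
    \<comment> \<open>Every summand keeps a factor from which the constant term has been
      removed.\<close>
    have "p * q - Const (Poly_Mapping.lookup (p * q) 0) =
        (p - Const ?a) * (q - Const ?b) + (Const ?a * (q - Const ?b) + Const ?b * (p - Const ?a))"
      by (simp add: lookup_mult_0 Const_mult algebra_simps)
    then show ?case
      using mult by (simp only: op_mult_add op_mult_mult[of "p - _"] op_mult_Const_mult sigma_add sigma_comp sigma_scale
          op_mult_in_H cherednik_scale cherednik_add cherednik_comp dunkl_plus_add dunkl_plus_scale dunkl_plus_comp)
  qed
  from this[of p] assms show ?thesis by (simp add: poly_plus_iff)
qed

text \<open>On the group part the involution is inversion, which is the adjoint by invariance of
  \<open>form\<close>; terms with a factor from \<open>S\<close> or \<open>poly_plus\<close> project
  to zero on both sides. This adjointness is the contravariance of the form.\<close>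

lemma form_act_sigma:
  assumes "a \<in> H"
  shows "form (act (\<sigma> a) u) u' = form u (act a u')"
  using H_subset_tri[OF assms]
proof (induction rule: triangular.induct)
  case (triangular_base w s p)
  have w: "inv w \<in> W" using triangular_base inv_W by blast
  have H: "op_mult p \<in> H" "weyl_act w \<in> H" "weyl_act (inv w) \<in> H" "s \<in> H"
    using op_mult_in_H triangular_base w cherednik_weyl S_id_subset_H by blast+
  show ?case
  proof (cases "s = id")
    case True
    let ?c = "Poly_Mapping.lookup p 0"
    have pp: "p - Const ?c \<in> poly_plus" by (simp add: poly_plus_iff lookup_minus)
    have "op_mult p = op_add (op_scale ?c id) (op_mult (p - Const ?c))"
      by (simp add: fun_eq_iff op_defs left_diff_distrib)
    then have "\<sigma> (op_mult p) = op_add (op_scale ?c id) (\<sigma> (op_mult (p - Const ?c)))"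
      by (metis sigma_add sigma_scale sigma_id op_mult_in_H id_in_H scale_id_in_H)
    then have "\<sigma> (op_mult p \<circ> weyl_act w \<circ> s) =
        op_add (op_scale ?c (weyl_act (inv w))) (weyl_act (inv w) \<circ> \<sigma> (op_mult (p - Const ?c)))"
      using H True triangular_base
      by (simp only: comp_id sigma_comp sigma_weyl comp_op_add comp_op_scale)
    then have "act (\<sigma> (op_mult p \<circ> weyl_act w \<circ> s)) u = ?c *s (\<rho> (inv w) *v u)"
      using H w sigma_op_mult[OF pp]
      by (simp only: act_add act_scale act_weyl act_comp_S cherednik_scale cherednik_comp S_subset_H add_0_right)
    moreover have "form (\<rho> (inv w) *v u) u' = form u (\<rho> w *v u')"
      using form_invariant[OF triangular_base(1), of "\<rho> (inv w) *v u" u'] rho_inv[OF triangular_base(1)] by simp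
    ultimately show ?thesis
      using act_base[OF triangular_base, of p u'] True
      by (simp add: form_scale form_commute[of "_ *s _"] form_commute[of u'] del: comp_apply)
  next
    case False
    then have "s \<in> S" using triangular_base by simp
    then obtain q where q: "q \<in> poly_plus" "\<sigma> s = op_mult q" using sigma_S by blast
    have "\<sigma> (op_mult p \<circ> weyl_act w \<circ> s) = op_mult q \<circ> \<sigma> (op_mult p \<circ> weyl_act w)"
      using H by (simp only: sigma_comp[of "op_mult p \<circ> weyl_act w"] cherednik_comp q)
    then have "act (\<sigma> (op_mult p \<circ> weyl_act w \<circ> s)) u = 0"
      using act_op_mult_comp[OF sigma_in_H q(1)] H by (simp only: cherednik_comp)
    then show ?thesis
      using act_base[OF triangular_base, of p u'] False by (simp only: form_0 form_commute[of 0] if_False)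
  qed
next
  case (triangular_add a b)
  then show ?case
    by (simp only: sigma_add act_add tri_subset_H sigma_in_H form_add form_commute[of "_ + _"]
       form_commute[of "act _ u" u'])
qed

end

section \<open>Quotient modules\<close>

text \<open>Axioms tailored to coset computations: an abelian group with additive operators.
  Negation is the action of the scalar -1, so submodules are automatically closed under it.\<close>

locale op_mod =
  fixes H :: "'n oper set" and M :: "('n, 'a) op_module"
  assumes scal: "op_scale c id \<in> H"
    and zero_closed: "mzero M \<in> mcarrier M"
    and add_closed: "x \<in> mcarrier M \<Longrightarrow> y \<in> mcarrier M \<Longrightarrow> madd M x y \<in> mcarrier M"
    and act_closed: "h \<in> H \<Longrightarrow> x \<in> mcarrier M \<Longrightarrow> mact M h x \<in> mcarrier M"
    and add_assoc: "x \<in> mcarrier M \<Longrightarrow> y \<in> mcarrier M \<Longrightarrow> u \<in> mcarrier M \<Longrightarrow>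
        madd M (madd M x y) u = madd M x (madd M y u)"
    and add_commute: "x \<in> mcarrier M \<Longrightarrow> y \<in> mcarrier M \<Longrightarrow> madd M x y = madd M y x"
    and zero_add: "x \<in> mcarrier M \<Longrightarrow> madd M (mzero M) x = x"
    and add_neg: "x \<in> mcarrier M \<Longrightarrow> madd M x (mact M (op_scale (- 1) id) x) = mzero M"
    and act_add: "h \<in> H \<Longrightarrow> x \<in> mcarrier M \<Longrightarrow> y \<in> mcarrier M \<Longrightarrow>
        mact M h (madd M x y) = madd M (mact M h x) (mact M h y)"
begin

abbreviation "C \<equiv> mcarrier M"
abbreviation plus_M (infixl "\<oplus>" 65) where "x \<oplus> y \<equiv> madd M x y"
abbreviation "neg x \<equiv> mact M (op_scale (- 1) id) x"

lemma neg_closed: "x \<in> C \<Longrightarrow> neg x \<in> C"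
  using scal act_closed by blast

lemma add_zero: "x \<in> C \<Longrightarrow> x \<oplus> mzero M = x"
  using add_commute zero_add zero_closed by metis

lemma neg_add_cancel: "x \<in> C \<Longrightarrow> y \<in> C \<Longrightarrow> neg x \<oplus> (x \<oplus> y) = y"
  by (metis add_assoc add_commute add_neg neg_closed zero_add)

lemma add_neg_cancel: "x \<in> C \<Longrightarrow> y \<in> C \<Longrightarrow> x \<oplus> (neg x \<oplus> y) = y"
  by (metis add_assoc add_neg neg_closed zero_add)

lemma act_zero:
  assumes "h \<in> H"
  shows "mact M h (mzero M) = mzero M"
proof -
  let ?a = "mact M h (mzero M)"
  have a: "?a \<in> C" using assms act_closed zero_closed by blast
  have "?a \<oplus> ?a = ?a" using act_add[OF assms zero_closed zero_closed] by (simp add: zero_add zero_closed)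
  then show ?thesis using neg_add_cancel[OF a a] by (metis a add_commute add_neg neg_closed)
qed

lemma submoduleD:
  assumes "submodule H M N"
  shows "N \<subseteq> C" "mzero M \<in> N" "x \<in> N \<Longrightarrow> y \<in> N \<Longrightarrow> x \<oplus> y \<in> N"
    "h \<in> H \<Longrightarrow> x \<in> N \<Longrightarrow> mact M h x \<in> N" "x \<in> N \<Longrightarrow> neg x \<in> N"
  using assms scal by (auto simp: submodule_def)

lemma submodule_carrier: "submodule H M C"
  by (simp add: submodule_def zero_closed add_closed act_closed)

lemma submodule_generated_submodule:
  assumes "X \<subseteq> C"
  shows "submodule H M (submodule_generated H M X)"
proof (rule submodule_def[THEN iffD2], intro conjI ballI)
  show "submodule_generated H M X \<subseteq> C"
    unfolding submodule_generated_def using assms submodule_carrier by blast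
qed (auto simp: submodule_generated_def submoduleD)

lemma submodule_generated_superset: "X \<subseteq> submodule_generated H M X"
  by (auto simp: submodule_generated_def)

lemma submodule_generated_least: "submodule H M N \<Longrightarrow> X \<subseteq> N \<Longrightarrow> submodule_generated H M X \<subseteq> N"
  by (auto simp: submodule_generated_def)

lemma mspan_subset: "X \<subseteq> C \<Longrightarrow> mspan M X \<subseteq> C"
proof
  fix x assume "x \<in> mspan M X" "X \<subseteq> C"
  then show "x \<in> C"
    by (induction rule: mspan.induct) (auto intro: zero_closed add_closed act_closed scal)
qed

context
  fixes N
  assumes N: "submodule H M N"
begin

lemma self_in_coset: "x \<in> C \<Longrightarrow> x \<in> mcoset M N x"
  unfolding mcoset_def using add_zero submoduleD(2)[OF N] by (auto intro!: exI[of _ "mzero M"])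

lemma mcoset_eq_iff:
  assumes "x \<in> C" "y \<in> C"
  shows "mcoset M N x = mcoset M N y \<longleftrightarrow> (\<exists>n\<in>N. y = x \<oplus> n)"
proof
  assume "mcoset M N x = mcoset M N y"
  then have "y \<in> mcoset M N x" using self_in_coset assms by simp
  then show "\<exists>n\<in>N. y = x \<oplus> n" by (auto simp: mcoset_def)
next
  assume "\<exists>n\<in>N. y = x \<oplus> n"
  then obtain n where n: "n \<in> N" "y = x \<oplus> n" by blast
  have NC: "u \<in> C" if "u \<in> N" for u using that submoduleD(1)[OF N] by blast
  show "mcoset M N x = mcoset M N y"
  proof (intro equalityI subsetI)
    fix u assume "u \<in> mcoset M N x"
    then obtain a where a: "a \<in> N" "u = x \<oplus> a" by (auto simp: mcoset_def)
    have "u = y \<oplus> (neg n \<oplus> a)"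
      using a n assms NC by (simp add: add_assoc add_closed neg_closed add_neg_cancel)
    then show "u \<in> mcoset M N y"
      using submoduleD[OF N] a n by (auto simp: mcoset_def)
  next
    fix u assume "u \<in> mcoset M N y"
    then obtain a where a: "a \<in> N" "u = y \<oplus> a" by (auto simp: mcoset_def)
    have "u = x \<oplus> (n \<oplus> a)"
      using a n assms NC by (simp add: add_assoc)
    then show "u \<in> mcoset M N x"
      using submoduleD[OF N] a n by (auto simp: mcoset_def)
  qed
qed

lemma mcoset_eq_zero_iff: "x \<in> C \<Longrightarrow> mcoset M N x = mcoset M N (mzero M) \<longleftrightarrow> x \<in> N"
  using mcoset_eq_iff[OF zero_closed, of x] submoduleD(1)[OF N] zero_add
  by (metis (no_types, lifting) subsetD)

lemma quotient_carrier: "mcarrier (quotient_module M N) = mcoset M N ` C"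
  and quotient_zero: "mzero (quotient_module M N) = mcoset M N (mzero M)"
  by (simp_all add: quotient_module_def)

lemma quotient_add:
  assumes "x \<in> C" "y \<in> C"
  shows "madd (quotient_module M N) (mcoset M N x) (mcoset M N y) = mcoset M N (x \<oplus> y)"
proof -
  have NC: "u \<in> C" if "u \<in> N" for u using that submoduleD(1)[OF N] by blast
  have "{a \<oplus> b | a b. a \<in> mcoset M N x \<and> b \<in> mcoset M N y} = mcoset M N (x \<oplus> y)"
  proof (intro equalityI subsetI)
    fix u assume "u \<in> {a \<oplus> b | a b. a \<in> mcoset M N x \<and> b \<in> mcoset M N y}"
    then obtain n n' where n: "n \<in> N" "n' \<in> N" "u = (x \<oplus> n) \<oplus> (y \<oplus> n')"
      by (auto simp: mcoset_def)
    have "u = (x \<oplus> y) \<oplus> (n \<oplus> n')"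
      using n assms NC by (metis add_assoc add_closed add_commute)
    then show "u \<in> mcoset M N (x \<oplus> y)"
      using n submoduleD(3)[OF N] by (auto simp: mcoset_def)
  next
    fix u assume "u \<in> mcoset M N (x \<oplus> y)"
    then obtain n where n: "n \<in> N" "u = (x \<oplus> y) \<oplus> n" by (auto simp: mcoset_def)
    then have "u = x \<oplus> (y \<oplus> n)" using assms NC by (simp add: add_assoc)
    moreover have "y \<oplus> n \<in> mcoset M N y" using n by (auto simp: mcoset_def)
    ultimately show "u \<in> {a \<oplus> b | a b. a \<in> mcoset M N x \<and> b \<in> mcoset M N y}"
      using self_in_coset assms by blast
  qed
  then show ?thesis by (simp add: quotient_module_def)
qed

lemma quotient_act:
  assumes "h \<in> H" "x \<in> C"
  shows "mact (quotient_module M N) h (mcoset M N x) = mcoset M N (mact M h x)"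
proof -
  have NC: "u \<in> C" if "u \<in> N" for u using that submoduleD(1)[OF N] by blast
  have "{mact M h a \<oplus> b | a b. a \<in> mcoset M N x \<and> b \<in> N} = mcoset M N (mact M h x)"
  proof (intro equalityI subsetI)
    fix u assume "u \<in> {mact M h a \<oplus> b | a b. a \<in> mcoset M N x \<and> b \<in> N}"
    then obtain n n' where n: "n \<in> N" "n' \<in> N" "u = mact M h (x \<oplus> n) \<oplus> n'"
      by (auto simp: mcoset_def)
    have "u = mact M h x \<oplus> (mact M h n \<oplus> n')"
      using n assms NC by (simp add: act_add add_assoc act_closed)
    then show "u \<in> mcoset M N (mact M h x)"
      using n assms submoduleD[OF N] by (auto simp: mcoset_def)
  next
    fix u assume "u \<in> mcoset M N (mact M h x)"
    then show "u \<in> {mact M h a \<oplus> b | a b. a \<in> mcoset M N x \<and> b \<in> N}"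
      using self_in_coset[OF assms(2)] by (auto simp: mcoset_def)
  qed
  then show ?thesis by (simp add: quotient_module_def)
qed

lemma op_mod_quotient: "op_mod H (quotient_module M N)"
proof
  note q = quotient_carrier quotient_zero quotient_add quotient_act
  show "op_scale c id \<in> H" for c by (rule scal)
  show "mzero (quotient_module M N) \<in> mcarrier (quotient_module M N)"
    by (simp add: q zero_closed)
  show "madd (quotient_module M N) x y \<in> mcarrier (quotient_module M N)"
    if "x \<in> mcarrier (quotient_module M N)" "y \<in> mcarrier (quotient_module M N)" for x y
    using that by (auto simp: q add_closed)
  show "mact (quotient_module M N) h x \<in> mcarrier (quotient_module M N)"
    if "h \<in> H" "x \<in> mcarrier (quotient_module M N)" for h x
    using that by (auto simp: q act_closed)
  show "madd (quotient_module M N) (madd (quotient_module M N) x y) u =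
      madd (quotient_module M N) x (madd (quotient_module M N) y u)"
    if "x \<in> mcarrier (quotient_module M N)" "y \<in> mcarrier (quotient_module M N)"
      "u \<in> mcarrier (quotient_module M N)" for x y u
    using that by (auto simp: q add_closed add_assoc)
  show "madd (quotient_module M N) x y = madd (quotient_module M N) y x"
    if "x \<in> mcarrier (quotient_module M N)" "y \<in> mcarrier (quotient_module M N)" for x y
    using that by (auto simp: q add_commute)
  show "madd (quotient_module M N) (mzero (quotient_module M N)) x = x"
    if "x \<in> mcarrier (quotient_module M N)" for x
    using that by (auto simp: q zero_add zero_closed)
  show "madd (quotient_module M N) x (mact (quotient_module M N) (op_scale (- 1) id) x) =
      mzero (quotient_module M N)" if "x \<in> mcarrier (quotient_module M N)" for x
    using that by (auto simp: q add_neg neg_closed scal)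
  show "mact (quotient_module M N) h (madd (quotient_module M N) x y) =
      madd (quotient_module M N) (mact (quotient_module M N) h x) (mact (quotient_module M N) h y)"
    if "h \<in> H" "x \<in> mcarrier (quotient_module M N)" "y \<in> mcarrier (quotient_module M N)" for h x y
    using that by (auto simp: q act_add add_closed act_closed)
qed

lemma submodule_image:
  assumes "submodule H M N'"
  shows "submodule H (quotient_module M N) (mcoset M N ` N')"
proof -
  have C: "x \<in> C" if "x \<in> N'" for x using that submoduleD(1)[OF assms] by blast
  show ?thesis
    unfolding submodule_def using submoduleD(2-)[OF assms] C
    by (auto simp: quotient_carrier quotient_zero quotient_add quotient_act)
qed

lemma submodule_preimage:
  assumes "submodule H (quotient_module M N) J"
  shows "submodule H M {x \<in> C. mcoset M N x \<in> J}"
    and "N \<subseteq> {x \<in> C. mcoset M N x \<in> J}"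
    and "mcoset M N ` {x \<in> C. mcoset M N x \<in> J} = J"
proof -
  interpret Q: op_mod H "quotient_module M N" by (rule op_mod_quotient)
  show "submodule H M {x \<in> C. mcoset M N x \<in> J}"
    unfolding submodule_def
    using Q.submoduleD[OF assms] zero_closed add_closed act_closed
    by (auto simp: quotient_zero simp flip: quotient_add quotient_act)
  show "N \<subseteq> {x \<in> C. mcoset M N x \<in> J}"
  proof
    fix x assume "x \<in> N"
    then have "x \<in> C" "mcoset M N x = mcoset M N (mzero M)"
      using submoduleD(1)[OF N] mcoset_eq_zero_iff[of x] by blast+
    then show "x \<in> {x \<in> C. mcoset M N x \<in> J}"
      using Q.submoduleD(2)[OF assms] by (simp add: quotient_zero)
  qed
  show "mcoset M N ` {x \<in> C. mcoset M N x \<in> J} = J"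
    using Q.submoduleD(1)[OF assms] by (auto simp: quotient_carrier)
qed

lemma mcoset_image_mem_iff:
  assumes "submodule H M N'" "N \<subseteq> N'" "x \<in> C"
  shows "mcoset M N x \<in> mcoset M N ` N' \<longleftrightarrow> x \<in> N'"
proof
  assume "mcoset M N x \<in> mcoset M N ` N'"
  then obtain y where y: "y \<in> N'" "mcoset M N y = mcoset M N x" by auto
  then obtain n where "n \<in> N" "x = y \<oplus> n"
    using mcoset_eq_iff[of y x] assms submoduleD(1)[OF assms(1)] by auto
  then show "x \<in> N'" using assms y submoduleD(3)[OF assms(1)] by auto
qed simp

text \<open>The correspondence theorem: images and preimages match the submodules above
  \<open>N\<close> with those of the quotient.\<close>

lemma simple_quotient_iff:
  "simple_module H (quotient_module M N) \<longleftrightarrow>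
     N \<noteq> C \<and> (\<forall>N'. submodule H M N' \<and> N \<subseteq> N' \<longrightarrow> N' = N \<or> N' = C)"
proof
  assume simple: "simple_module H (quotient_module M N)"
  have "N \<noteq> C"
  proof
    assume "N = C"
    then have "mcoset M N x = mcoset M N (mzero M)" if "x \<in> C" for x
      using mcoset_eq_zero_iff[OF that] that by simp
    then have "mcoset M N ` C \<subseteq> {mcoset M N (mzero M)}" by (intro image_subsetI) simp
    then have "mcoset M N ` C = {mcoset M N (mzero M)}" using zero_closed by blast
    then show False using simple by (simp add: simple_module_def quotient_carrier quotient_zero)
  qed
  moreover have "N' = N \<or> N' = C" if "submodule H M N'" "N \<subseteq> N'" for N'
  proof -
    have "mcoset M N ` N' = {mcoset M N (mzero M)} \<or> mcoset M N ` N' = mcoset M N ` C"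
      using simple submodule_image[OF that(1)]
      unfolding simple_module_def quotient_carrier quotient_zero by metis
    then show ?thesis
    proof
      assume "mcoset M N ` N' = {mcoset M N (mzero M)}"
      then have "x \<in> N" if "x \<in> N'" for x
        using that mcoset_eq_zero_iff[of x] submoduleD(1)[OF \<open>submodule H M N'\<close>] by (metis imageI singletonD subsetD)
      then show ?thesis using that by blast
    next
      assume *: "mcoset M N ` N' = mcoset M N ` C"
      then have "x \<in> N'" if "x \<in> C" for x
        using mcoset_image_mem_iff[OF \<open>submodule H M N'\<close> \<open>N \<subseteq> N'\<close> that] that by (metis imageI)
      then show ?thesis using submoduleD(1)[OF that(1)] by blast
    qed
  qed
  ultimately show "N \<noteq> C \<and> (\<forall>N'. submodule H M N' \<and> N \<subseteq> N' \<longrightarrow> N' = N \<or> N' = C)" by blast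
next
  assume *: "N \<noteq> C \<and> (\<forall>N'. submodule H M N' \<and> N \<subseteq> N' \<longrightarrow> N' = N \<or> N' = C)"
  have "mcoset M N ` C \<noteq> {mcoset M N (mzero M)}"
  proof
    assume "mcoset M N ` C = {mcoset M N (mzero M)}"
    then have "x \<in> N" if "x \<in> C" for x
      using that mcoset_eq_zero_iff[of x] by (metis imageI singletonD)
    then show False using * submoduleD(1)[OF N] by blast
  qed
  moreover have "J = {mcoset M N (mzero M)} \<or> J = mcoset M N ` C"
    if "submodule H (quotient_module M N) J" for J
  proof -
    let ?N' = "{x \<in> C. mcoset M N x \<in> J}"
    note J = submodule_preimage[OF that]
    have "?N' = N \<or> ?N' = C"
      using * J(1,2) by blast
    then have "J = mcoset M N ` N \<or> J = mcoset M N ` C"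
      by (rule disj_forward; subst J(3)[symmetric]) (simp_all only:)
    moreover have "mcoset M N ` N = {mcoset M N (mzero M)}"
    proof -
      have "mcoset M N x = mcoset M N (mzero M)" if "x \<in> N" for x
        using mcoset_eq_zero_iff[of x] submoduleD(1)[OF N] that by blast
      then show ?thesis using submoduleD(2)[OF N] by blast
    qed
    ultimately show ?thesis by simp
  qed
  ultimately show "simple_module H (quotient_module M N)"
    by (simp add: simple_module_def quotient_carrier quotient_zero)
qed

text \<open>Evaluates the definite description in \<open>simple_quotient\<close>. The image of a
  largest proper submodule has simple quotient; any other such kernel is proper, hence contained in
  that image, and by its own maximality equal to it.\<close>

lemma simple_quotient_kernel:
  assumes J0: "submodule H M J0" "N \<subseteq> J0" "J0 \<noteq> C"
    and max: "\<And>N'. submodule H M N' \<Longrightarrow> N \<subseteq> N' \<Longrightarrow> N' \<noteq> C \<Longrightarrow> N' \<subseteq> J0"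
  shows "(THE J. submodule H (quotient_module M N) J \<and>
      simple_module H (quotient_module (quotient_module M N) J)) = mcoset M N ` J0"
proof (rule the_equality)
  interpret Q: op_mod H "quotient_module M N" by (rule op_mod_quotient)
  let ?Q = "quotient_module M N" and ?J = "mcoset M N ` J0"
  have J: "submodule H ?Q ?J" by (rule submodule_image[OF J0(1)])
  have J_ne: "?J \<noteq> mcarrier ?Q"
  proof
    assume "?J = mcarrier ?Q"
    then have "C \<subseteq> J0" using mcoset_image_mem_iff[OF J0(1,2)] by (auto simp: quotient_carrier)
    then show False using J0(3) submoduleD(1)[OF J0(1)] by blast
  qed
  have below: "J' \<subseteq> ?J" if J': "submodule H ?Q J'" "J' \<noteq> mcarrier ?Q" for J'
  proof -
    let ?N' = "{x \<in> C. mcoset M N x \<in> J'}"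
    have "?N' \<noteq> C"
      using submodule_preimage(3)[OF J'(1)] J'(2) quotient_carrier by metis
    then have "?N' \<subseteq> J0" using max submodule_preimage[OF J'(1)] by blast
    then show ?thesis using submodule_preimage(3)[OF J'(1)] by blast
  qed
  show "submodule H ?Q ?J \<and> simple_module H (quotient_module ?Q ?J)"
    using J J_ne below Q.simple_quotient_iff[OF J] by blast
  fix J' assume J': "submodule H ?Q J' \<and> simple_module H (quotient_module ?Q J')"
  then have "J' \<noteq> mcarrier ?Q" "submodule H ?Q ?J \<and> J' \<subseteq> ?J \<longrightarrow> ?J = J' \<or> ?J = mcarrier ?Q"
    using Q.simple_quotient_iff[of J'] by blast+
  then show "J' = ?J" using below J' J J_ne by blast
qed

lemma mspan_quotient:
  assumes "X \<subseteq> C"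
  shows "mspan (quotient_module M N) (mcoset M N ` X) = mcoset M N ` mspan M X"
proof (intro equalityI subsetI)
  fix x assume "x \<in> mspan (quotient_module M N) (mcoset M N ` X)"
  then show "x \<in> mcoset M N ` mspan M X"
  proof (induction rule: mspan.induct)
    case mspan_zero
    show ?case unfolding quotient_zero by (rule imageI) (rule mspan.mspan_zero)
  next
    case (mspan_step x y c)
    then obtain x' y' where xy: "x' \<in> X" "x = mcoset M N x'" "y' \<in> mspan M X" "y = mcoset M N y'"
      by auto
    then have "x' \<in> C" "y' \<in> C" using assms mspan_subset[OF assms] by auto
    then show ?case
      using xy mspan.mspan_step[OF xy(1,3), of c] by (simp add: quotient_act quotient_add scal act_closed)
  qed
next
  fix x assume "x \<in> mcoset M N ` mspan M X"
  then obtain x' where x': "x' \<in> mspan M X" "x = mcoset M N x'" by auto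
  from x'(1) have "mcoset M N x' \<in> mspan (quotient_module M N) (mcoset M N ` X)"
  proof (induction rule: mspan.induct)
    case mspan_zero
    show ?case unfolding quotient_zero[symmetric] by (rule mspan.mspan_zero)
  next
    case (mspan_step x y c)
    then have "x \<in> C" "y \<in> C" using assms mspan_subset[OF assms] by auto
    then show ?case
      using mspan.mspan_step[OF imageI[OF mspan_step(1)] mspan_step(3), of c]
      by (simp add: quotient_act quotient_add scal act_closed)
  qed
  then show "x \<in> mspan (quotient_module M N) (mcoset M N ` X)" using x' by simp
qed

text \<open>Spanning sets are pulled back along the quotient map, so that linear algebra takes place
  among representatives.\<close>

lemma finite_dimensional_quotient_iff:
  "finite_dimensional (quotient_module M N) \<longleftrightarrow>
     (\<exists>X. finite X \<and> X \<subseteq> C \<and> (\<forall>t\<in>C. \<exists>s\<in>mspan M X. mcoset M N s = mcoset M N t))"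
proof
  assume "finite_dimensional (quotient_module M N)"
  then obtain X where X: "finite X" "X \<subseteq> mcoset M N ` C"
      "mcoset M N ` C \<subseteq> mspan (quotient_module M N) X"
    by (auto simp: finite_dimensional_def quotient_carrier)
  then obtain Y where Y: "finite Y" "Y \<subseteq> C" "X = mcoset M N ` Y"
    by (metis finite_subset_image)
  then show "\<exists>X. finite X \<and> X \<subseteq> C \<and> (\<forall>t\<in>C. \<exists>s\<in>mspan M X. mcoset M N s = mcoset M N t)"
    using X(3) mspan_quotient[OF Y(2)] by (intro exI[of _ Y]) (fastforce simp: image_iff)
next
  assume "\<exists>X. finite X \<and> X \<subseteq> C \<and> (\<forall>t\<in>C. \<exists>s\<in>mspan M X. mcoset M N s = mcoset M N t)"
  then obtain X where X: "finite X" "X \<subseteq> C" "\<forall>t\<in>C. \<exists>s\<in>mspan M X. mcoset M N s = mcoset M N t"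
    by blast
  show "finite_dimensional (quotient_module M N)"
    unfolding finite_dimensional_def quotient_carrier
    using X mspan_quotient[OF X(2)]
    by (intro exI[of _ "mcoset M N ` X"]) (auto simp: image_iff, metis)
qed

end

text \<open>The third isomorphism theorem as far as dimension requires it: nested cosets coincide
  exactly when the single cosets modulo \<open>J\<close> do.\<close>

lemma finite_dimensional_double_quotient:
  assumes N: "submodule H M N" and J: "submodule H M J" "N \<subseteq> J"
  shows "finite_dimensional (quotient_module (quotient_module M N) (mcoset M N ` J)) \<longleftrightarrow>
    finite_dimensional (quotient_module M J)"
proof -
  interpret Q: op_mod H "quotient_module M N" by (rule op_mod_quotient[OF N])
  let ?Q = "quotient_module M N" and ?J = "mcoset M N ` J"
  note QJ = submodule_image[OF N J(1)]
  have eq: "mcoset ?Q ?J (mcoset M N x) = mcoset ?Q ?J (mcoset M N y) \<longleftrightarrow> mcoset M J x = mcoset M J y"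
    if xy: "x \<in> C" "y \<in> C" for x y
  proof -
    have "mcoset ?Q ?J (mcoset M N x) = mcoset ?Q ?J (mcoset M N y) \<longleftrightarrow>
        (\<exists>n\<in>J. mcoset M N y = mcoset M N (x \<oplus> n))"
      using Q.mcoset_eq_iff[OF QJ, of "mcoset M N x" "mcoset M N y"] xy submoduleD(1)[OF J(1)]
      by (auto simp: quotient_carrier[OF N] quotient_add[OF N] subset_iff)
    also have "\<dots> \<longleftrightarrow> (\<exists>n\<in>J. y = x \<oplus> n)"
    proof
      assume "\<exists>n\<in>J. mcoset M N y = mcoset M N (x \<oplus> n)"
      then obtain n where n: "n \<in> J" "mcoset M N (x \<oplus> n) = mcoset M N y" by auto
      then have nC: "n \<in> C" using submoduleD(1)[OF J(1)] by blast
      then obtain n' where n': "n' \<in> N" "y = x \<oplus> n \<oplus> n'"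
        using n xy mcoset_eq_iff[OF N, of "x \<oplus> n" y] add_closed by auto
      then have "y = x \<oplus> (n \<oplus> n')"
        using nC xy submoduleD(1)[OF N] by (simp add: add_assoc subset_iff)
      then show "\<exists>n\<in>J. y = x \<oplus> n" using n n' J submoduleD(3)[OF J(1)] by blast
    qed blast
    also have "\<dots> \<longleftrightarrow> mcoset M J x = mcoset M J y" using mcoset_eq_iff[OF J(1) xy] by simp
    finally show ?thesis .
  qed
  show ?thesis
    unfolding Q.finite_dimensional_quotient_iff[OF QJ] finite_dimensional_quotient_iff[OF J(1)]
  proof safe
    fix X assume X: "finite X" "X \<subseteq> mcarrier ?Q"
      and span: "\<forall>t\<in>mcarrier ?Q. \<exists>s\<in>mspan ?Q X. mcoset ?Q ?J s = mcoset ?Q ?J t"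
    then obtain Y where Y: "finite Y" "Y \<subseteq> C" "X = mcoset M N ` Y"
      by (metis finite_subset_image quotient_carrier[OF N])
    have "\<exists>s\<in>mspan M Y. mcoset M J s = mcoset M J t" if t: "t \<in> C" for t
    proof -
      obtain s where s: "s \<in> mspan ?Q X" "mcoset ?Q ?J s = mcoset ?Q ?J (mcoset M N t)"
        using span t quotient_carrier[OF N] by blast
      then obtain s' where s': "s' \<in> mspan M Y" "s = mcoset M N s'"
        using mspan_quotient[OF N Y(2)] Y(3) by auto
      then show ?thesis using s eq[of s' t] t mspan_subset[OF Y(2)] by auto
    qed
    then show "\<exists>X. finite X \<and> X \<subseteq> C \<and> (\<forall>t\<in>C. \<exists>s\<in>mspan M X. mcoset M J s = mcoset M J t)"
      using Y by blast
  next
    fix X assume X: "finite X" "X \<subseteq> C"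
      and span: "\<forall>t\<in>C. \<exists>s\<in>mspan M X. mcoset M J s = mcoset M J t"
    have "\<exists>s\<in>mspan ?Q (mcoset M N ` X). mcoset ?Q ?J s = mcoset ?Q ?J t" if t: "t \<in> mcarrier ?Q" for t
    proof -
      obtain t' where t': "t' \<in> C" "t = mcoset M N t'" using t quotient_carrier[OF N] by auto
      then obtain s where s: "s \<in> mspan M X" "mcoset M J s = mcoset M J t'" using span by blast
      then show ?thesis
        using eq[of s t'] t' mspan_subset[OF X(2)] mspan_quotient[OF N X(2)] by auto
    qed
    then show "\<exists>Y. finite Y \<and> Y \<subseteq> mcarrier ?Q \<and>
        (\<forall>t\<in>mcarrier ?Q. \<exists>s\<in>mspan ?Q Y. mcoset ?Q ?J s = mcoset ?Q ?J t)"
      using X quotient_carrier[OF N] by (intro exI[of _ "mcoset M N ` X"]) auto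
  qed
qed

end

section \<open>Linear dependence and eigenvectors\<close>

text \<open>Lets coefficient sums of polynomials of different degrees share one range.\<close>

lemma sum_coeff_degree:
  fixes g :: "nat \<Rightarrow> 'a::comm_monoid_add"
  assumes "degree f \<le> n" "\<And>i. coeff f i = 0 \<Longrightarrow> g i = 0"
  shows "(\<Sum>i\<le>n. g i) = (\<Sum>i\<le>degree f. g i)"
  by (rule sum.mono_neutral_right) (use assms coeff_eq_0[of f] in auto)

text \<open>The strengthened claim, with solutions supported in arbitrarily high degree, makes the
  induction over the constraints work: two solutions of disjoint support can be combined.\<close>

lemma polynomial_solution:
  fixes c :: "nat \<Rightarrow> 'x \<Rightarrow> 'a::field"
  assumes "finite X"
  shows "\<exists>f. f \<noteq> 0 \<and> (\<forall>i<n. coeff f i = 0) \<and> (\<forall>x\<in>X. (\<Sum>i\<le>degree f. coeff f i * c i x) = 0)"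
  using assms
proof (induction X arbitrary: n rule: finite_induct)
  case empty
  show ?case by (rule exI[of _ "monom 1 n"]) simp
next
  case (insert y X)
  define L where "L f x = (\<Sum>i\<le>degree f. coeff f i * c i x)" for f x
  obtain f where f: "f \<noteq> 0" "\<forall>i<n. coeff f i = 0" "\<forall>x\<in>X. L f x = 0"
    using insert.IH[of n] by (auto simp: L_def)
  \<comment> \<open>The support of \<open>g\<close> starts beyond the degree of \<open>f\<close>, so
    the leading coefficient of \<open>f\<close> cannot cancel in the combination.\<close>
  define m where "m = max n (Suc (degree f))"
  obtain g where g: "g \<noteq> 0" "\<forall>i<m. coeff g i = 0" "\<forall>x\<in>X. L g x = 0"
    using insert.IH[of m] by (auto simp: L_def)
  have comb: "L (smult a f + smult b g) x = a * L f x + b * L g x" for a b x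
  proof -
    let ?h = "smult a f + smult b g" and ?N = "max (degree f) (degree g)"
    have "degree ?h \<le> ?N"
      by (intro degree_add_le) (auto intro: order_trans[OF degree_smult_le])
    then have "L ?h x = (\<Sum>i\<le>?N. coeff ?h i * c i x)"
      unfolding L_def by (intro sum_coeff_degree[symmetric]) auto
    also have "\<dots> = a * (\<Sum>i\<le>?N. coeff f i * c i x) + b * (\<Sum>i\<le>?N. coeff g i * c i x)"
      by (simp add: distrib_right sum.distrib sum_distrib_left mult.assoc)
    also have "(\<Sum>i\<le>?N. coeff f i * c i x) = L f x"
      unfolding L_def by (rule sum_coeff_degree) auto
    also have "(\<Sum>i\<le>?N. coeff g i * c i x) = L g x"
      unfolding L_def by (rule sum_coeff_degree) auto
    finally show ?thesis .
  qed
  \<comment> \<open>Cross-multiplying by the two values at \<open>y\<close> makes the new constraint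
    hold.\<close>
  let ?h = "smult (L g y) f + smult (- L f y) g"
  have h: "\<forall>i<n. coeff ?h i = 0" "\<forall>x\<in>insert y X. L ?h x = 0"
    unfolding comb using f g by (auto simp: m_def)
  show ?case
  proof (cases "L g y = 0")
    case True
    then show ?thesis using g by (intro exI[of _ g]) (auto simp: L_def m_def)
  next
    case False
    have "coeff ?h (degree f) = L g y * lead_coeff f"
      using g by (simp add: m_def)
    then have "?h \<noteq> 0" using False f by (metis coeff_0 leading_coeff_0_iff mult_eq_0_iff)
    then show ?thesis using h unfolding L_def by blast
  qed
qed

text \<open>A nonzero polynomial of least degree in \<open>A\<close> that kills one vector
  \<open>u0\<close> has a complex root \<open>c\<close>; its cofactor after division by
  \<open>X - c\<close>, applied to \<open>u0\<close>, is nonzero by minimality and is killed by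
  \<open>A - c\<close>.\<close>

lemma eigenvector_exists:
  fixes A :: "complex ^ 'm::finite \<Rightarrow> complex ^ 'm"
  assumes add: "\<And>x y. A (x + y) = A x + A y" and scale: "\<And>c x. A (c *s x) = c *s A x"
  shows "\<exists>c u. u \<noteq> 0 \<and> A u = c *s u"
proof -
  define u0 :: "complex ^ 'm" where "u0 = 1"
  have "u0 \<noteq> 0" by (simp add: u0_def vec_eq_iff)
  define ev where "ev f = (\<Sum>i\<le>degree f. coeff f i *s (A ^^ i) u0)" for f
  have ev_n: "ev f = (\<Sum>i\<le>n. coeff f i *s (A ^^ i) u0)" if "degree f \<le> n" for f n
    unfolding ev_def using that by (intro sum_coeff_degree[symmetric]) auto
  have A_sum: "A (\<Sum>i\<in>I. g i) = (\<Sum>i\<in>I. A (g i))" for g and I :: "nat set"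
    using scale[of 0 0] by (induction I rule: infinite_finite_induct) (simp_all add: add)
  have ev_factor: "ev ([:- c, 1:] * g) = A (ev g) - c *s ev g" for c g
  proof -
    let ?n = "Suc (degree g)"
    have "degree ([:- c, 1:] * g) \<le> ?n"
      using degree_mult_le[of "[:- c, 1:]" g] by simp
    then have "ev ([:- c, 1:] * g) = (\<Sum>i\<le>?n. coeff ([:- c, 1:] * g) i *s (A ^^ i) u0)"
      by (rule ev_n)
    also have "\<dots> = (\<Sum>i\<le>?n. coeff (pCons 0 g) i *s (A ^^ i) u0) - c *s (\<Sum>i\<le>?n. coeff g i *s (A ^^ i) u0)"
      by (simp add: vec.scale_sum_right vector_smult_assoc vec.scale_left_diff_distrib sum_subtractf
            del: sum.atMost_Suc)
    also have "(\<Sum>i\<le>?n. coeff g i *s (A ^^ i) u0) = ev g" by (rule ev_n[symmetric]) simp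
    also have "(\<Sum>i\<le>?n. coeff (pCons 0 g) i *s (A ^^ i) u0) = A (ev g)"
      unfolding ev_def A_sum scale by (subst sum.atMost_Suc_shift) simp
    finally show ?thesis .
  qed
  \<comment> \<open>Each of the finitely many coordinates imposes one linear constraint on the
    coefficients of \<open>f\<close>.\<close>
  have "\<exists>f. f \<noteq> 0 \<and> ev f = 0"
    using polynomial_solution[of UNIV 0 "\<lambda>i x. ((A ^^ i) u0) $ x"]
    by (auto simp: ev_def vec_eq_iff)
  then have "\<exists>f. (f \<noteq> 0 \<and> ev f = 0) \<and> (\<forall>g. g \<noteq> 0 \<and> ev g = 0 \<longrightarrow> degree f \<le> degree g)"
    using ex_has_least_nat[of "\<lambda>f. f \<noteq> 0 \<and> ev f = 0" _ degree] by blast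
  then obtain f where f: "f \<noteq> 0" "ev f = 0" and min: "\<And>g. g \<noteq> 0 \<Longrightarrow> ev g = 0 \<Longrightarrow> degree f \<le> degree g"
    by blast
  have "degree f \<noteq> 0"
  proof
    assume "degree f = 0"
    then obtain a where a: "f = [:a:]" by (rule degree_eq_zeroE)
    then show False using f \<open>u0 \<noteq> 0\<close> by (simp add: ev_def)
  qed
  then have "\<not> constant (poly f)" by (simp add: constant_degree)
  then obtain c where "poly f c = 0" using fundamental_theorem_of_algebra by blast
  then obtain g where g: "f = [:- c, 1:] * g" by (auto simp: poly_eq_0_iff_dvd)
  then have "g \<noteq> 0" using f by auto
  then have "degree f = Suc (degree g)" unfolding g by (subst degree_mult_eq) auto
  then have "ev g \<noteq> 0" using min[of g] \<open>g \<noteq> 0\<close> by auto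
  moreover have "A (ev g) = c *s ev g" using ev_factor[of c g] f(2) g by simp
  ultimately show ?thesis by blast
qed

section \<open>Verma modules\<close>

text \<open>Replaces the module addition by pointwise \<open>+\<close>, which gives tensors the
  group laws and finite sums of function and vector types.\<close>

lemma op_add_eq_plus: "op_add a b = a + b"
  by (simp add: op_add_def fun_eq_iff)

lemma sum_fun_apply: "(\<Sum>i\<in>A. f i) x = (\<Sum>i\<in>A. f i x)" for f :: "'i \<Rightarrow> 'a \<Rightarrow> 'b::comm_monoid_add"
  by (induction A rule: infinite_finite_induct) simp_all

context verma_setup
begin

abbreviation "TM \<equiv> tensor_module H :: ('n, 'n oper ^ 'm) op_module"
abbreviation "K \<equiv> verma_kernel R Rp k \<rho>"
abbreviation "pt \<equiv> pure_tensor :: 'n oper \<Rightarrow> complex ^ 'm \<Rightarrow> 'n oper ^ 'm"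

definition tact :: "'n oper \<Rightarrow> 'n oper ^ 'm \<Rightarrow> 'n oper ^ 'm" where
  "tact h t = (\<chi> i. h \<circ> t $ i)"

lemma TM_simps:
  "t \<in> mcarrier TM \<longleftrightarrow> (\<forall>i. t $ i \<in> H)"
  "mzero TM = 0"
  "madd TM s t = s + t"
  "mact TM h t = tact h t"
  by (simp_all add: tensor_module_def tact_def vec_eq_iff op_add_eq_plus fun_eq_iff)

lemma tact_comp: "tact (a \<circ> b) t = tact a (tact b t)"
  by (simp add: tact_def vec_eq_iff fun_eq_iff)

lemma tact_neg: "tact (op_scale (- 1) id) t = - t"
  by (simp add: tact_def vec_eq_iff fun_eq_iff op_scale_def Const_minus)

lemma tact_add: "h \<in> H \<Longrightarrow> tact h (s + t) = tact h s + tact h t"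
  by (simp add: tact_def vec_eq_iff fun_eq_iff H_add)

lemma tact_sum: "h \<in> H \<Longrightarrow> tact h (\<Sum>i\<in>A. f i) = (\<Sum>i\<in>A. tact h (f i))"
  by (induction A rule: infinite_finite_induct)
     (simp_all add: tact_add, simp_all add: tact_def vec_eq_iff fun_eq_iff H_0)

lemma tact_diff: "h \<in> H \<Longrightarrow> tact h (s - t) = tact h s - tact h t"
  using tact_add[of h "s - t" t] by (simp add: eq_diff_eq)

lemma H_plus: "a \<in> H \<Longrightarrow> b \<in> H \<Longrightarrow> a + b \<in> H"
  using cherednik_add[of a R Rp k b] by (simp add: op_add_eq_plus)

lemma zero_in_H: "0 \<in> H"
proof -
  have "op_scale 0 id = (0 :: 'n oper)" by (simp add: op_scale_def fun_eq_iff)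
  then show ?thesis using scale_id_in_H by metis
qed

lemma H_sum_closed: "(\<And>i. i \<in> A \<Longrightarrow> f i \<in> H) \<Longrightarrow> (\<Sum>i\<in>A. f i) \<in> H"
  by (induction A rule: infinite_finite_induct) (simp_all add: H_plus zero_in_H)

sublocale TM: op_mod H TM
proof
  show "madd TM x (mact TM (op_scale (- 1) id) x) = mzero TM" for x
    by (simp add: TM_simps tact_neg)
  show "mact TM h x \<in> mcarrier TM" if "h \<in> H" "x \<in> mcarrier TM" for h x
    using that by (simp only: TM_simps tact_def vec_lambda_beta cherednik_comp simp_thms)
qed (simp_all only: TM_simps tact_add scale_id_in_H add_ac zero_in_H H_plus
      zero_index vector_add_component add_0_left add_0_right simp_thms)

lemma sub_add: "submodule H TM N \<Longrightarrow> x \<in> N \<Longrightarrow> y \<in> N \<Longrightarrow> x + y \<in> N"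
  and sub_0: "submodule H TM N \<Longrightarrow> 0 \<in> N"
  and sub_act: "submodule H TM N \<Longrightarrow> h \<in> H \<Longrightarrow> x \<in> N \<Longrightarrow> tact h x \<in> N"
  using TM.submoduleD[of N] by (simp_all add: TM_simps)

lemma sub_minus: "submodule H TM N \<Longrightarrow> x \<in> N \<Longrightarrow> - x \<in> N"
  using TM.submoduleD(5)[of N x] by (simp add: TM_simps tact_neg)

lemma sub_diff: "submodule H TM N \<Longrightarrow> x \<in> N \<Longrightarrow> y \<in> N \<Longrightarrow> x - y \<in> N"
  using sub_add[of N x "- y"] sub_minus by simp

lemma sub_sum: "submodule H TM N \<Longrightarrow> (\<And>i. i \<in> A \<Longrightarrow> f i \<in> N) \<Longrightarrow> (\<Sum>i\<in>A. f i) \<in> N"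
  by (induction A rule: infinite_finite_induct) (simp_all add: sub_0 sub_add)

lemma sub_diff_iff: "submodule H TM N \<Longrightarrow> x - y \<in> N \<Longrightarrow> x \<in> N \<longleftrightarrow> y \<in> N"
  using sub_add[of N "x - y" y] sub_diff[of N x "x - y"] by auto

lemma pt_nth: "pt a u $ i = op_scale (u $ i) a"
  by (simp add: pure_tensor_def)

lemma pt_closed: "a \<in> H \<Longrightarrow> pt a u \<in> mcarrier TM"
  by (simp add: TM_simps pt_nth cherednik_scale)

lemma pt_add: "pt (a + b) u = pt a u + pt b u"
  and pt_add_right: "pt a (u + u') = pt a u + pt a u'"
  and pt_minus_right: "pt a (- u) = - pt a u"
  and pt_0: "pt 0 u = 0"
  by (simp_all add: vec_eq_iff fun_eq_iff pt_nth op_scale_def distrib_left distrib_right Const_add Const_minus)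

lemma pt_diff_right: "pt a (u - u') = pt a u - pt a u'"
  using pt_add_right[of a "u - u'" u'] by (simp add: eq_diff_eq)

lemma pt_sum: "pt (\<Sum>i\<in>A. f i) u = (\<Sum>i\<in>A. pt (f i) u)"
  by (induction A rule: infinite_finite_induct)
     (simp_all only: pt_add pt_0 sum.infinite sum.empty sum.insert not_False_eq_True)

lemma tact_pt: "h \<in> H \<Longrightarrow> tact h (pt a u) = pt (h \<circ> a) u"
  by (simp add: tact_def vec_eq_iff fun_eq_iff pt_nth op_scale_def H_Const_mult)

lemma pt_scale: "pt (op_scale c a) u = pt a (c *s u)"
  by (simp add: vec_eq_iff fun_eq_iff pt_nth op_scale_def Const_mult mult_ac)

lemma pt_scale_right: "pt a (c *s u) = tact (op_scale c id) (pt a u)"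
  by (simp add: vec_eq_iff fun_eq_iff pt_nth op_scale_def Const_mult tact_def mult_ac)

lemma pt_axis_nth: "pt a (axis j 1) $ i = (if i = j then a else 0)"
  by (simp add: fun_eq_iff pt_nth op_scale_def axis_def)

lemma sum_pt_axis: "(\<Sum>j\<in>UNIV. pt (t $ j) (axis j 1)) = t"
proof -
  have "(\<Sum>j\<in>UNIV. pt (t $ j) (axis j 1)) $ i = t $ i" for i
    by (simp add: pt_axis_nth if_distrib cong: if_cong)
  then show ?thesis by (simp add: vec_eq_iff)
qed

text \<open>The map a \<otimes> u \<mapsto> \<pi>(a)u, the component of lowest degree. The sum over
  axes appears because a tensor is stored as a vector of operators.\<close>

definition \<Phi> :: "'n oper ^ 'm \<Rightarrow> complex ^ 'm" where
  "\<Phi> t = (\<Sum>i\<in>UNIV. act (t $ i) (axis i 1))"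

lemma \<Phi>_add: "s \<in> mcarrier TM \<Longrightarrow> t \<in> mcarrier TM \<Longrightarrow> \<Phi> (s + t) = \<Phi> s + \<Phi> t"
  using act_add by (simp add: \<Phi>_def TM_simps op_add_eq_plus sum.distrib)

lemma \<Phi>_pt: "a \<in> H \<Longrightarrow> \<Phi> (pt a u) = act a u"
proof -
  assume a: "a \<in> H"
  have "\<Phi> (pt a u) = act a (\<Sum>i\<in>UNIV. u $ i *s axis i 1)"
    by (simp add: \<Phi>_def pt_nth act_scale[OF a] act_sum_right act_scale_right)
  then show ?thesis by (simp only: basis_expansion)
qed

text \<open>The largest submodule inside the kernel of \<open>\<Phi>\<close>: the preimage in the
  tensor module of the radical of the form.\<close>

definition J0 :: "('n oper ^ 'm) set" where
  "J0 = {t \<in> mcarrier TM. \<forall>c\<in>H. \<Phi> (tact c t) = 0}"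

lemma tact_closed: "h \<in> H \<Longrightarrow> t \<in> mcarrier TM \<Longrightarrow> tact h t \<in> mcarrier TM"
  using TM.act_closed by (simp add: TM_simps)

lemma submodule_J0: "submodule H TM J0"
proof -
  have "act 0 u = 0" for u
    using act_scale[OF id_in_H, of 0 u] by (simp add: op_scale_def zero_fun_def)
  then have "\<Phi> 0 = 0" by (simp add: \<Phi>_def)
  moreover have "tact c 0 = 0" if "c \<in> H" for c
    using TM.act_zero[OF that] by (simp add: TM_simps)
  moreover have "tact c (x + y) \<in> mcarrier TM \<and> \<Phi> (tact c (x + y)) = \<Phi> (tact c x) + \<Phi> (tact c y)"
    if "c \<in> H" "x \<in> mcarrier TM" "y \<in> mcarrier TM" for c x y
    using that \<Phi>_add[OF tact_closed tact_closed] tact_closed[OF that(1) TM.add_closed[OF that(2,3)]]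
    by (simp add: tact_add TM_simps(3))
  ultimately show ?thesis
    unfolding submodule_def J0_def
    using TM.zero_closed TM.add_closed tact_closed
    by (auto simp: TM_simps(2-) cherednik_comp simp flip: tact_comp)
qed

lemma \<Phi>_J0: "t \<in> J0 \<Longrightarrow> \<Phi> t = 0"
proof -
  assume "t \<in> J0"
  then have "\<Phi> (tact id t) = 0" using id_in_H by (simp add: J0_def)
  then show ?thesis by (simp add: tact_def)
qed

lemma balancing_closed: "balancing_relations R Rp k \<rho> \<subseteq> mcarrier TM"
  unfolding balancing_relations_def
  using TM.add_closed pt_closed cherednik_comp cherednik_weyl S_subset_H by blast

lemma submodule_K: "submodule H TM K"
  unfolding verma_kernel_def by (rule TM.submodule_generated_submodule[OF balancing_closed])

lemma K_balance:
  assumes "a \<in> H" "w \<in> W"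
  shows "pt (a \<circ> weyl_act w) u - pt a (\<rho> w *v u) \<in> K"
proof -
  have "madd TM (pt (a \<circ> weyl_act w) u) (pt a (- (\<rho> w *v u))) \<in> K"
    unfolding verma_kernel_def
    by (rule subsetD[OF TM.submodule_generated_superset])
       (use assms in \<open>unfold balancing_relations_def, blast\<close>)
  then show ?thesis by (simp add: TM_simps pt_minus_right)
qed

lemma K_S:
  assumes "a \<in> H" "s \<in> S"
  shows "pt (a \<circ> s) u \<in> K"
  unfolding verma_kernel_def
  by (rule subsetD[OF TM.submodule_generated_superset])
     (use assms in \<open>unfold balancing_relations_def, blast\<close>)

text \<open>Applying any operator and then \<open>\<Phi>\<close> kills both families of relations,
  by right equivariance of the projection and by its vanishing on products ending in
  \<open>S\<close>. So \<open>\<Phi>\<close> descends to the Verma module.\<close>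

lemma K_subset_J0: "K \<subseteq> J0"
  unfolding verma_kernel_def
proof (rule TM.submodule_generated_least[OF submodule_J0])
  show "balancing_relations R Rp k \<rho> \<subseteq> J0"
  proof
    fix t assume t: "t \<in> balancing_relations R Rp k \<rho>"
    then have C: "t \<in> mcarrier TM" using balancing_closed by blast
    have "\<Phi> (tact c t) = 0" if c: "c \<in> H" for c
      using t unfolding balancing_relations_def
    proof
      assume "t \<in> {madd TM (pt (a \<circ> weyl_act w) v) (pt a (- (\<rho> w *v v))) | a w v. a \<in> H \<and> w \<in> W}"
      then obtain a w u where a: "a \<in> H" "w \<in> W"
        and t: "t = pt (a \<circ> weyl_act w) u + pt a (- (\<rho> w *v u))"
        by (auto simp: TM_simps)
      note H = a(1) cherednik_weyl[OF a(2)] c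
      have "tact c t = pt (c \<circ> a \<circ> weyl_act w) u + pt (c \<circ> a) (- 1 *s (\<rho> w *v u))"
        using c by (simp add: t tact_add tact_pt comp_assoc vector_sneg_minus1[symmetric] del: comp_apply)
      then have "\<Phi> (tact c t) = act (c \<circ> a \<circ> weyl_act w) u + act (c \<circ> a) (- 1 *s (\<rho> w *v u))"
        using H by (simp only: \<Phi>_add pt_closed cherednik_comp \<Phi>_pt)
      then show ?thesis
        using act_comp_weyl[OF cherednik_comp[OF c a(1)] a(2)]
        unfolding act_scale_right by simp
    next
      assume "t \<in> {pt (a \<circ> s) v | a s v. a \<in> H \<and> s \<in> S}"
      then obtain a s u where a: "a \<in> H" "s \<in> S" and t: "t = pt (a \<circ> s) u" by blast
      have "\<Phi> (tact c t) = act (c \<circ> a \<circ> s) u"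
        using a c by (simp only: t tact_pt \<Phi>_pt cherednik_comp S_subset_H flip: comp_assoc)
      then show ?thesis using act_comp_S[OF cherednik_comp[OF c a(1)] a(2)] by simp
    qed
    then show "t \<in> J0" using C by (simp add: J0_def)
  qed
qed

definition polyt :: "'n cpoly ^ 'm \<Rightarrow> 'n oper ^ 'm" where
  "polyt p = (\<chi> i. op_mult (p $ i))"

lemma polyt_closed: "polyt p \<in> mcarrier TM"
  by (simp add: TM_simps polyt_def op_mult_in_H)

lemma polyt_add: "polyt (p + q) = polyt p + polyt q"
  by (simp add: polyt_def vec_eq_iff op_mult_add op_add_eq_plus)

lemma polyt_eq_sum: "polyt p = (\<Sum>i\<in>UNIV. pt (op_mult (p $ i)) (axis i 1))"
  using sum_pt_axis[of "polyt p"] by (simp add: polyt_def)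

lemma pt_op_mult: "pt (op_mult q) u = polyt (\<chi> i. Const (u $ i) * q)"
  by (simp add: polyt_def vec_eq_iff pt_nth op_mult_Const_mult)

text \<open>On a triangular product, a factor from \<open>S\<close> kills the tensor modulo
  \<open>K\<close>, and otherwise the group element is moved onto \<open>u\<close>. This is the
  spanning half of the identification of the Verma module with polynomials tensor V.\<close>

lemma pt_normal_form:
  assumes "a \<in> H"
  shows "\<exists>p. pt a u - polyt p \<in> K"
  using H_subset_tri[OF assms]
proof (induction rule: triangular.induct)
  case (triangular_base w s p)
  show ?case
  proof (cases "s = id")
    case True
    then show ?thesis
      using K_balance[OF op_mult_in_H triangular_base(1), of p u] by (simp add: pt_op_mult del: comp_apply) blast
  next
    case False
    then have "pt (op_mult p \<circ> weyl_act w \<circ> s) u \<in> K"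
      using triangular_base by (intro K_S cherednik_comp op_mult_in_H cherednik_weyl) auto
    moreover have "polyt 0 = 0" by (simp add: polyt_def vec_eq_iff op_mult_def fun_eq_iff)
    ultimately show ?thesis by (metis diff_zero)
  qed
next
  case (triangular_add a b)
  then obtain p q where "pt a u - polyt p \<in> K" "pt b u - polyt q \<in> K" by blast
  from sub_add[OF submodule_K this] show ?case
    by (intro exI[of _ "p + q"]) (simp only: op_add_eq_plus pt_add polyt_add add_diff_add)
qed

lemma normal_form:
  assumes "t \<in> mcarrier TM"
  shows "\<exists>p. t - polyt p \<in> K"
proof -
  have "\<exists>p. pt (t $ j) (axis j 1) - polyt p \<in> K" for j
    using assms by (intro pt_normal_form) (simp add: TM_simps)
  then obtain p where p: "\<And>j. pt (t $ j) (axis j 1) - polyt (p j) \<in> K" by metis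
  have "polyt (\<Sum>j\<in>A. p j) = (\<Sum>j\<in>A. polyt (p j))" for A
    using polyt_add[of 0 0] by (induction A rule: infinite_finite_induct) (simp_all add: polyt_add)
  then have "t - polyt (\<Sum>j\<in>UNIV. p j) = (\<Sum>j\<in>UNIV. pt (t $ j) (axis j 1) - polyt (p j))"
    by (simp add: sum_subtractf sum_pt_axis)
  also have "\<dots> \<in> K" by (rule sub_sum[OF submodule_K p])
  finally show ?thesis by blast
qed

text \<open>Invariant polynomials commute with the group, so by irreducibility membership of
  \<open>q \<otimes> u\<close> for a single \<open>u\<close> propagates to all of \<open>q (H \<otimes> V)\<close>.\<close>

lemma invariant_polynomial_propagates:
  assumes N: "submodule H TM N" "K \<subseteq> N" and q: "\<And>w. w \<in> W \<Longrightarrow> weyl_act w q = q"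
    and u: "pt (op_mult q) u \<in> N" "u \<noteq> 0" and t: "t \<in> mcarrier TM"
  shows "tact (op_mult q) t \<in> N"
proof -
  let ?U = "{u. pt (op_mult q) u \<in> N}"
  have "vec.subspace ?U"
    unfolding vec.subspace_def
  proof (intro conjI ballI allI)
    show "0 \<in> ?U" using sub_0[OF N(1)] pt_diff_right[of "op_mult q" 0 0] by simp
    show "x + y \<in> ?U" if "x \<in> ?U" "y \<in> ?U" for x y
      using that sub_add[OF N(1)] by (simp add: pt_add_right)
    show "c *s x \<in> ?U" if "x \<in> ?U" for c x
      using that sub_act[OF N(1) scale_id_in_H] by (simp add: pt_scale_right)
  qed
  moreover have "\<rho> w *v x \<in> ?U" if w: "w \<in> W" and "x \<in> ?U" for w x
  proof -
    have "tact (weyl_act w) (pt (op_mult q) x) \<in> N"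
      using that sub_act[OF N(1) cherednik_weyl[OF w]] by simp
    \<comment> \<open>The group element slides past the invariant \<open>q\<close>; modulo
      \<open>K\<close> it is then absorbed into the vector.\<close>
    then have "pt (op_mult q \<circ> weyl_act w) x \<in> N"
      by (simp only: tact_pt cherednik_weyl[OF w] weyl_comp_op_mult q[OF w])
    then show ?thesis
      using sub_diff_iff[OF N(1)] K_balance[OF op_mult_in_H w] N(2) by blast
  qed
  ultimately have "?U = {0} \<or> ?U = UNIV" by (rule invariant_subspace)
  then have U: "pt (op_mult q) x \<in> N" for x using u by blast
  obtain p where p: "t - polyt p \<in> K" using normal_form[OF t] by blast
  have "op_mult q \<circ> op_mult b = op_mult b \<circ> op_mult q" for b
    by (metis mult.commute op_mult_mult)
  then have "tact (op_mult q) (polyt p) = (\<Sum>i\<in>UNIV. tact (op_mult (p $ i)) (pt (op_mult q) (axis i 1)))"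
    by (simp only: polyt_eq_sum tact_sum op_mult_in_H tact_pt)
  then have "tact (op_mult q) (polyt p) \<in> N"
    using sub_sum[OF N(1) sub_act[OF N(1) op_mult_in_H U]] by (simp only:)
  moreover have "tact (op_mult q) t - tact (op_mult q) (polyt p) \<in> N"
    using sub_act[OF N(1) op_mult_in_H] p N(2) by (metis tact_diff op_mult_in_H subsetD)
  ultimately show ?thesis using sub_diff_iff[OF N(1)] by blast
qed

lemma op_mult_1: "op_mult 1 = id"
  by (simp add: op_mult_def fun_eq_iff)

lemma tact_id: "tact id t = t"
  by (simp add: tact_def)

text \<open>The propagation applied to the invariant polynomial 1.\<close>

lemma submodule_eq_carrier:
  assumes N: "submodule H TM N" "K \<subseteq> N" and u: "pt id u \<in> N" "u \<noteq> 0"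
  shows "N = mcarrier TM"
proof -
  have "weyl_act w 1 = (1 :: 'n cpoly)" for w
    by (metis Const_1 weyl_act_Const)
  then have "t \<in> N" if "t \<in> mcarrier TM" for t
    using invariant_polynomial_propagates[OF N, of 1 u t] u that by (simp add: op_mult_1 tact_id)
  then show ?thesis using TM.submoduleD(1)[OF N(1)] by blast
qed

subsection \<open>The Euler operator\<close>

text \<open>The action of \<open>euler\<close> in degree 0: there the Dunkl operators in
  \<open>sum_Var_dunkl\<close> vanish, leaving minus the sum of the terms
  \<open>k \<alpha> (1 - r \<alpha>)\<close>.\<close>

definition lowest_euler :: "complex ^ 'm \<Rightarrow> complex ^ 'm" where
  "lowest_euler u = (\<Sum>\<alpha>\<in>Rp. (- k \<alpha>) *s u) + (\<Sum>\<alpha>\<in>Rp. k \<alpha> *s (\<rho> (r \<alpha>) *v u))"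

lemma euler_eq: "euler = (\<Sum>i\<in>UNIV. op_mult (Var i) \<circ> T (axis i 1)) +
    ((\<Sum>\<alpha>\<in>Rp. op_scale (- k \<alpha>) id) + (\<Sum>\<alpha>\<in>Rp. op_scale (k \<alpha>) (weyl_act (r \<alpha>))))"
proof
  fix p :: "'n cpoly"
  show "euler p = ((\<Sum>i\<in>UNIV. op_mult (Var i) \<circ> T (axis i 1)) +
    ((\<Sum>\<alpha>\<in>Rp. op_scale (- k \<alpha>) id) + (\<Sum>\<alpha>\<in>Rp. op_scale (k \<alpha>) (weyl_act (r \<alpha>))))) p"
    using sum_Var_dunkl[of p]
    by (simp add: sum_fun_apply op_mult_def op_scale_def right_diff_distrib sum_subtractf Const_minus sum_negf)
qed

lemma euler_in_H: "euler \<in> H"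
  unfolding euler_eq using Rp_subset
  by (intro H_plus H_sum_closed cherednik_comp op_mult_in_H cherednik_dunkl scale_id_in_H
      cherednik_scale cherednik_weyl reflection_in_W) auto

lemma pt_euler: "pt euler u - pt id (lowest_euler u) \<in> K"
proof -
  let ?e1 = "\<Sum>i\<in>UNIV. op_mult (Var i) \<circ> T (axis i 1)"
  let ?e2 = "\<Sum>\<alpha>\<in>Rp. op_scale (- k \<alpha>) id" and ?e3 = "\<Sum>\<alpha>\<in>Rp. op_scale (k \<alpha>) (weyl_act (r \<alpha>))"
  have pt_sum_right: "pt a (\<Sum>i\<in>B. f i) = (\<Sum>i\<in>B. pt a (f i))" for a f and B :: "(real ^ 'n) set"
    using pt_diff_right[of a 0 0]
    by (induction B rule: infinite_finite_induct) (simp_all add: pt_add_right)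
  have "pt ?e1 u \<in> K"
    unfolding pt_sum by (intro sub_sum[OF submodule_K] K_S op_mult_in_H dunkl_plus_gen)
  moreover have "pt ?e2 u = pt id (\<Sum>\<alpha>\<in>Rp. (- k \<alpha>) *s u)"
    by (simp add: pt_sum pt_scale pt_sum_right)
  moreover have "pt ?e3 u - pt id (\<Sum>\<alpha>\<in>Rp. k \<alpha> *s (\<rho> (r \<alpha>) *v u)) \<in> K"
    unfolding pt_sum pt_sum_right sum_subtractf[symmetric]
  proof (rule sub_sum[OF submodule_K])
    fix \<alpha> assume "\<alpha> \<in> Rp"
    then have "r \<alpha> \<in> W" using Rp_subset reflection_in_W by blast
    from K_balance[OF id_in_H this, of "k \<alpha> *s u"]
    show "pt (op_scale (k \<alpha>) (weyl_act (r \<alpha>))) u - pt id (k \<alpha> *s (\<rho> (r \<alpha>) *v u)) \<in> K"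
      by (simp add: pt_scale vector_scalar_commute)
  qed
  moreover have "pt euler u - pt id (lowest_euler u) = pt ?e1 u +
      (pt ?e2 u - pt id (\<Sum>\<alpha>\<in>Rp. (- k \<alpha>) *s u)) + (pt ?e3 u - pt id (\<Sum>\<alpha>\<in>Rp. k \<alpha> *s (\<rho> (r \<alpha>) *v u)))"
    unfolding euler_eq pt_add lowest_euler_def pt_add_right by simp
  ultimately show ?thesis
    using sub_add[OF submodule_K] by simp
qed

lemma lowest_euler_add: "lowest_euler (x + y) = lowest_euler x + lowest_euler y"
  by (simp add: lowest_euler_def vec.scale_right_distrib sum.distrib matrix_vector_right_distrib sum_negf sum_subtractf)

lemma lowest_euler_scale: "lowest_euler (c *s x) = c *s lowest_euler x"
  by (simp add: lowest_euler_def vec.scale_right_distrib vec.scale_sum_right vector_smult_assoc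
      vector_scalar_commute mult.commute)

lemma pt_id_in_J0: "pt id u \<in> J0 \<Longrightarrow> u = 0"
  using \<Phi>_J0[of "pt id u"] \<Phi>_pt[OF id_in_H, of u] act_weyl[OF weyl_id, of u]
  unfolding weyl_act_id rho_id matrix_vector_mul_lid by simp

text \<open>The Euler operator commutes with the group already as an operator on polynomials, so its
  action on the lowest degree does too.\<close>

lemma lowest_euler_equivariant:
  assumes w: "w \<in> W"
  shows "lowest_euler (\<rho> w *v u) = \<rho> w *v lowest_euler u"
proof -
  have "euler \<circ> weyl_act w = weyl_act w \<circ> euler"
    by (simp add: fun_eq_iff weyl_act_euler)
  then have e: "pt (euler \<circ> weyl_act w) u = tact (weyl_act w) (pt euler u)"
    using cherednik_weyl[OF w] by (simp only: tact_pt)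
  have "tact (weyl_act w) (pt id (lowest_euler u)) = pt (id \<circ> weyl_act w) (lowest_euler u)"
    using cherednik_weyl[OF w] by (simp only: tact_pt id_comp comp_id)
  then have 1: "tact (weyl_act w) (pt euler u) - pt (id \<circ> weyl_act w) (lowest_euler u) \<in> K"
    using sub_act[OF submodule_K cherednik_weyl[OF w] pt_euler[of u]] cherednik_weyl[OF w]
    by (simp only: tact_diff)
  note 2 = K_balance[OF euler_in_H w, of u]
  note 3 = pt_euler[of "\<rho> w *v u"]
  note 4 = K_balance[OF id_in_H w, of "lowest_euler u"]
  \<comment> \<open>A telescoping comparison modulo \<open>K\<close> of the two orders in which
    \<open>euler\<close> and \<open>w\<close> can act on \<open>u\<close>.\<close>
  have "pt id (\<rho> w *v lowest_euler u - lowest_euler (\<rho> w *v u)) =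
      (pt (euler \<circ> weyl_act w) u - pt euler (\<rho> w *v u)) + (pt euler (\<rho> w *v u) - pt id (lowest_euler (\<rho> w *v u)))
      - (tact (weyl_act w) (pt euler u) - pt (id \<circ> weyl_act w) (lowest_euler u))
      - (pt (id \<circ> weyl_act w) (lowest_euler u) - pt id (\<rho> w *v lowest_euler u))"
    unfolding e pt_diff_right by simp
  also have "\<dots> \<in> K"
    by (rule sub_diff[OF submodule_K sub_diff[OF submodule_K sub_add[OF submodule_K 2 3] 1] 4])
  finally show ?thesis using K_subset_J0 pt_id_in_J0 by force
qed

text \<open>Schur's lemma: an eigenspace is nonzero and, by equivariance, invariant.\<close>

lemma lowest_euler_scalar: "\<exists>c. \<forall>u. lowest_euler u = c *s u"
proof -
  obtain c u where u: "u \<noteq> 0" "lowest_euler u = c *s u"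
    using eigenvector_exists[of lowest_euler] lowest_euler_add lowest_euler_scale by blast
  let ?U = "{u. lowest_euler u = c *s u}"
  have "lowest_euler 0 = 0" using lowest_euler_scale[of 0 0] by simp
  then have "vec.subspace ?U"
    by (auto simp: vec.subspace_def lowest_euler_add lowest_euler_scale vec.scale_right_distrib vector_smult_assoc mult.commute)
  moreover have "\<rho> w *v x \<in> ?U" if "w \<in> W" "x \<in> ?U" for w x
    using that by (simp add: lowest_euler_equivariant vector_scalar_commute)
  ultimately have "?U = {0} \<or> ?U = UNIV" by (rule invariant_subspace)
  then show ?thesis using u by blast
qed

text \<open>As a derivation, \<open>euler\<close> acts on p \<otimes> u by differentiating p and by
  acting on u, the latter being a scalar modulo \<open>K\<close>. Removing that scalar multiple
  leaves the degree operator on coefficients; this is what makes submodules above \<open>K\<close>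
  graded.\<close>

lemma euler_polyt:
  assumes N: "submodule H TM N" "K \<subseteq> N" and p: "polyt p \<in> N"
  shows "polyt (\<chi> i. euler (p $ i)) \<in> N"
proof -
  obtain c where c: "\<And>u. lowest_euler u = c *s u" using lowest_euler_scalar by blast
  have "tact euler (polyt p) = polyt (\<chi> i. euler (p $ i)) + (\<Sum>i\<in>UNIV. tact (op_mult (p $ i)) (pt euler (axis i 1)))"
  proof -
    have "(\<Sum>i\<in>UNIV. tact (op_mult (p $ i)) (pt euler (axis i 1))) = (\<chi> i. op_mult (p $ i) \<circ> euler)"
      using sum_pt_axis[of "\<chi> i. op_mult (p $ i) \<circ> euler"] by (simp only: tact_pt op_mult_in_H vec_lambda_beta)
    then show ?thesis
      by (simp add: tact_def polyt_def vec_eq_iff fun_eq_iff op_mult_def euler_mult)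
  qed
  moreover have "(\<Sum>i\<in>UNIV. tact (op_mult (p $ i)) (pt euler (axis i 1))) \<in> N"
  proof -
    have "(\<Sum>i\<in>UNIV. tact (op_mult (p $ i)) (pt euler (axis i 1))) - tact (op_scale c id) (polyt p) =
        (\<Sum>i\<in>UNIV. tact (op_mult (p $ i)) (pt euler (axis i 1) - pt id (lowest_euler (axis i 1))))"
    proof -
      have "(\<Sum>i\<in>UNIV. tact (op_mult (p $ i)) (pt id (lowest_euler (axis i 1)))) =
          tact (op_scale c id) (\<Sum>i\<in>UNIV. pt (op_mult (p $ i)) (axis i 1))"
        by (simp only: c tact_pt op_mult_in_H comp_id pt_scale_right[of "op_mult _"] tact_sum scale_id_in_H)
      then show ?thesis
        by (simp only: tact_diff op_mult_in_H sum_subtractf polyt_eq_sum)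
    qed
    also have "\<dots> \<in> N"
      using pt_euler N(2) by (intro sub_sum[OF N(1)] sub_act[OF N(1)] op_mult_in_H) blast
    finally show ?thesis
      using sub_diff_iff[OF N(1)] sub_act[OF N(1) scale_id_in_H p] by blast
  qed
  ultimately show ?thesis
    using sub_diff[OF N(1) sub_act[OF N(1) euler_in_H p]] by fastforce
qed

text \<open>A tensor outside \<open>J0\<close> has a multiple with nonzero constant term. Isolating
  this term by the degree operator puts a nonzero vector of V into \<open>N\<close>, and such a
  vector generates everything.\<close>

lemma submodule_below_J0:
  assumes N: "submodule H TM N" "K \<subseteq> N" "N \<noteq> mcarrier TM"
  shows "N \<subseteq> J0"
proof
  fix t assume t: "t \<in> N"
  then have tC: "t \<in> mcarrier TM" using TM.submoduleD(1)[OF N(1)] by blast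
  show "t \<in> J0"
  proof (rule ccontr)
    assume "t \<notin> J0"
    then obtain c where c: "c \<in> H" "\<Phi> (tact c t) \<noteq> 0" using tC by (auto simp: J0_def)
    obtain p where p: "tact c t - polyt p \<in> K" using normal_form[OF tact_closed[OF c(1) tC]] by blast
    then have pN: "polyt p \<in> N" using sub_diff_iff[OF N(1)] sub_act[OF N(1) c(1) t] N(2) by blast
    define u :: "complex ^ 'm" where "u = (\<chi> i. Poly_Mapping.lookup (p $ i) 0)"
    have "\<Phi> (tact c t) = \<Phi> (tact c t - polyt p) + \<Phi> (polyt p)"
      using \<Phi>_add[of "tact c t - polyt p" "polyt p"] p polyt_closed TM.submoduleD(1)[OF submodule_K] by auto
    also have "\<Phi> (tact c t - polyt p) = 0"
      using \<Phi>_J0 p K_subset_J0 by blast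
    also have "\<Phi> (polyt p) = (\<Sum>i\<in>UNIV. u $ i *s axis i 1)"
      by (simp add: \<Phi>_def polyt_def act_op_mult u_def)
    finally have "u \<noteq> 0" using c by (simp add: basis_expansion)
    \<comment> \<open>The product of the factors 1 - X/n, evaluated at the degree operator, is 1 in
      degree 0 and 0 in degrees 1 to \<open>D\<close>; for large \<open>D\<close> it retains the
      constant terms only.\<close>
    have filter: "\<exists>p'. polyt p' \<in> N \<and> (\<forall>i e. Poly_Mapping.lookup (p' $ i) e =
        (\<Prod>n=1..D. 1 - of_nat (mono_degree e) / of_nat n) * Poly_Mapping.lookup (p $ i) e)" for D
    proof (induction D)
      case 0
      then show ?case using pN by auto
    next
      case (Suc D)
      then obtain p' where p': "polyt p' \<in> N" "\<And>i e. Poly_Mapping.lookup (p' $ i) e =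
        (\<Prod>n=1..D. 1 - of_nat (mono_degree e) / of_nat n) * Poly_Mapping.lookup (p $ i) e" by blast
      \<comment> \<open>Adding \<open>c'\<close> times the degree operator multiplies by the next
        factor of the product.\<close>
      define c' :: complex where "c' = - 1 / of_nat (Suc D)"
      let ?q = "p' + (\<chi> i. Const c' * euler (p' $ i))"
      have "polyt (\<chi> i. Const c' * euler (p' $ i)) = tact (op_scale c' id) (polyt (\<chi> i. euler (p' $ i)))"
        by (simp add: polyt_def tact_def vec_eq_iff fun_eq_iff op_mult_def op_scale_def mult.assoc)
      then have "polyt ?q \<in> N"
        using sub_add[OF N(1) p'(1)] sub_act[OF N(1) scale_id_in_H euler_polyt[OF N(1,2) p'(1)]]
        by (simp add: polyt_add)
      moreover have "Poly_Mapping.lookup (?q $ i) e =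
        (\<Prod>n=1..Suc D. 1 - of_nat (mono_degree e) / of_nat n) * Poly_Mapping.lookup (p $ i) e" for i e
      proof -
        have "Poly_Mapping.lookup (?q $ i) e =
            Poly_Mapping.lookup (p' $ i) e + c' * (of_nat (mono_degree e) * Poly_Mapping.lookup (p' $ i) e)"
          by (simp add: lookup_add lookup_Const_mult lookup_euler)
        also have "\<dots> = (1 - of_nat (mono_degree e) / of_nat (Suc D)) * Poly_Mapping.lookup (p' $ i) e"
          by (simp add: c'_def left_diff_distrib del: of_nat_Suc)
        finally show ?thesis
          by (simp add: p'(2) prod.nat_ivl_Suc' mult.assoc del: of_nat_Suc)
      qed
      ultimately show ?case by blast
    qed
    \<comment> \<open>Inserting \<open>0\<close> keeps the set nonempty, so that the maximum is
      meaningful.\<close>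
    define D where "D = Max (insert 0 (mono_degree ` (\<Union>i. Poly_Mapping.keys (p $ i))))"
    have D: "mono_degree e \<le> D" if "e \<in> Poly_Mapping.keys (p $ i)" for e i
      unfolding D_def using that by (intro Max_ge) auto
    obtain p' where p': "polyt p' \<in> N" "\<And>i e. Poly_Mapping.lookup (p' $ i) e =
        (\<Prod>n=1..D. 1 - of_nat (mono_degree e) / of_nat n) * Poly_Mapping.lookup (p $ i) e"
      using filter[of D] by blast
    have "p' $ i = Const (u $ i)" for i
    proof (rule poly_mapping_eqI)
      fix e
      have "Poly_Mapping.lookup (p' $ i) e = 0" if "e \<noteq> 0"
      proof (cases "e \<in> Poly_Mapping.keys (p $ i)")
        case True
        then have "mono_degree e \<in> {1..D}" using D that mono_degree_eq_0[of e] by (auto simp: Suc_le_eq)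
        then have "(\<Prod>n=1..D. 1 - of_nat (mono_degree e) / of_nat n) = (0 :: complex)"
          by (intro prod_zero bexI[of _ "mono_degree e"]) auto
        then show ?thesis by (simp add: p'(2))
      qed (simp add: p'(2) in_keys_iff)
      moreover have "Poly_Mapping.lookup (p' $ i) 0 = u $ i"
        using mono_degree_eq_0[of "0 :: 'n \<Rightarrow>\<^sub>0 nat"] by (simp add: p'(2) u_def)
      ultimately show "Poly_Mapping.lookup (p' $ i) e = Poly_Mapping.lookup (Const (u $ i)) e"
        by (simp add: Const_def lookup_single when_def)
    qed
    then have "polyt p' = pt id u"
      using pt_op_mult[of 1 u] by (simp add: op_mult_1 polyt_def)
    then have "N = mcarrier TM"
      using submodule_eq_carrier[OF N(1,2) _ \<open>u \<noteq> 0\<close>] p'(1) by simp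
    then show False using N(3) by simp
  qed
qed

lemma J0_ne_carrier: "J0 \<noteq> mcarrier TM"
  using pt_id_in_J0[of v] pt_closed[OF id_in_H, of v] v_nonzero by auto

lemma finite_dimensional_simple_quotient:
  "finite_dimensional (simple_quotient R Rp k \<rho>) \<longleftrightarrow> finite_dimensional (quotient_module TM J0)"
proof -
  have "simple_quotient R Rp k \<rho> = quotient_module (quotient_module TM K) (mcoset TM K ` J0)"
    unfolding simple_quotient_def verma_def
    using TM.simple_quotient_kernel[OF submodule_K submodule_J0 K_subset_J0 J0_ne_carrier submodule_below_J0]
    by simp
  then show ?thesis
    using TM.finite_dimensional_double_quotient[OF submodule_K submodule_J0 K_subset_J0] by simp
qed

end

section \<open>Monomials and homogeneous degree\<close>

lemma monomial_eq_prod_list: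
  fixes e :: "'n::finite \<Rightarrow>\<^sub>0 nat"
  shows "\<exists>xs. length xs = mono_degree e \<and> Poly_Mapping.single e 1 = prod_list (map linear_form xs)"
proof -
  have pow: "Var i ^ n = prod_list (map linear_form (replicate n (axis i 1)))" for i :: 'n and n
    by (simp add: linear_form_axis prod_list_replicate)
  have "\<exists>xs. length xs = (\<Sum>i\<in>A. Poly_Mapping.lookup e i) \<and>
      (\<Prod>i\<in>A. Var i ^ Poly_Mapping.lookup e i) = prod_list (map linear_form xs)" if "finite A" for A
    using that
  proof (induction A rule: finite_induct)
    case empty
    show ?case by (rule exI[of _ "[]"]) simp
  next
    case (insert i A)
    then obtain xs where "length xs = (\<Sum>i\<in>A. Poly_Mapping.lookup e i)"
      "(\<Prod>i\<in>A. Var i ^ Poly_Mapping.lookup e i) = prod_list (map linear_form xs)" by blast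
    with insert show ?case
      by (intro exI[of _ "replicate (Poly_Mapping.lookup e i) (axis i 1) @ xs"]) (simp add: pow)
  qed
  from this[of UNIV] show ?thesis
    by (simp add: mono_degree_def single_eq_prod_Var)
qed

lemma finite_mono_degree: "finite {e :: 'n::finite \<Rightarrow>\<^sub>0 nat. mono_degree e < d}"
proof (rule inj_on_finite)
  show "inj_on Poly_Mapping.lookup {e :: 'n \<Rightarrow>\<^sub>0 nat. mono_degree e < d}"
    by (rule inj_onI) (rule poly_mapping_eq_iff[THEN iffD2])
  show "Poly_Mapping.lookup ` {e :: 'n \<Rightarrow>\<^sub>0 nat. mono_degree e < d} \<subseteq> (\<Pi>\<^sub>E i\<in>UNIV. {..d})"
  proof (clarsimp simp: PiE_UNIV_domain)
    fix e :: "'n \<Rightarrow>\<^sub>0 nat" and i assume "mono_degree e < d"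
    moreover have "Poly_Mapping.lookup e i \<le> mono_degree e"
      unfolding mono_degree_def by (rule member_le_sum) auto
    ultimately show "Poly_Mapping.lookup e i \<le> d" by simp
  qed
  show "finite (\<Pi>\<^sub>E i\<in>(UNIV :: 'n set). {..d})" by (intro finite_PiE) auto
qed

text \<open>A condition on exponents becomes an eigenvector equation, so degrees of products follow
  from the derivation rule.\<close>

lemma homogeneous_iff_euler: "p \<in> homogeneous n \<longleftrightarrow> euler p = of_nat n * p"
proof
  assume p: "p \<in> homogeneous n"
  show "euler p = of_nat n * p"
  proof (rule poly_mapping_eqI)
    fix e
    show "Poly_Mapping.lookup (euler p) e = Poly_Mapping.lookup (of_nat n * p) e"
      using p by (cases "e \<in> Poly_Mapping.keys p")
        (auto simp: homogeneous_def lookup_euler lookup_Const_mult in_keys_iff simp flip: Const_of_nat)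
  qed
next
  assume p: "euler p = of_nat n * p"
  have "of_nat (mono_degree e) * Poly_Mapping.lookup p e = of_nat n * Poly_Mapping.lookup p e" for e
    using arg_cong[OF p, of "\<lambda>p. Poly_Mapping.lookup p e"]
    by (simp add: lookup_euler lookup_Const_mult flip: Const_of_nat)
  then show "p \<in> homogeneous n"
    by (auto simp: homogeneous_def in_keys_iff)
qed

lemma euler_power:
  assumes "euler p = of_nat d * p"
  shows "euler (p ^ m) = of_nat (d * m) * p ^ m"
proof (induction m)
  case 0
  then show ?case using euler_Const[of 1] by simp
next
  case (Suc m)
  then show ?case by (simp add: euler_mult assms algebra_simps)
qed

lemma euler_E_poly: "euler (E_poly z) = of_nat 2 * E_poly z"
proof -
  have "euler (linear_form x ^ 2) = of_nat 2 * linear_form x ^ 2" for x :: "complex ^ 'a"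
    using euler_power[of "linear_form x" 1 2] by (simp add: euler_linear_form)
  then show ?thesis
    by (simp add: E_poly_def euler_mult euler_sum sum_distrib_left mult_ac)
qed

context verma_setup
begin

section \<open>The radical of the contravariant form\<close>

abbreviation "orbit \<equiv> verma_orbit R Rp k \<rho> v"

lemma orbit_eq_coset: "a \<in> H \<Longrightarrow> orbit a = mcoset TM K (pt a v)"
  unfolding verma_orbit_def verma_def verma_class_def
  using TM.quotient_act[OF submodule_K, of a "pt id v"] pt_closed[OF id_in_H, of v]
  by (simp only: TM_simps(4) tact_pt comp_id)

text \<open>The two tensors differ by an element of \<open>K\<close>, hence of \<open>J0\<close>, on
  which \<open>\<Phi>\<close> vanishes after any operator. This yields independence of the choices
  made in \<open>verma_form\<close>.\<close>

lemma act_eq_of_coset_eq: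
  assumes "a \<in> H" "b \<in> H" "c \<in> H" "orbit a = orbit b"
  shows "act (c \<circ> a) v = act (c \<circ> b) v"
proof -
  obtain n where n: "n \<in> K" "pt b v = pt a v + n"
    using assms(4) TM.mcoset_eq_iff[OF submodule_K pt_closed[OF assms(1), of v] pt_closed[OF assms(2), of v]]
    by (auto simp only: orbit_eq_coset assms(1,2) TM_simps)
  then have nC: "n \<in> mcarrier TM" using TM.submoduleD(1)[OF submodule_K] by blast
  have "\<Phi> (tact c n) = 0" using n(1) K_subset_J0 assms(3) by (auto simp: J0_def)
  moreover have "\<Phi> (tact c (pt b v)) = \<Phi> (tact c (pt a v)) + \<Phi> (tact c n)"
    unfolding n(2) using assms nC by (simp only: tact_add \<Phi>_add tact_closed pt_closed)
  ultimately show ?thesis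
    using assms by (simp only: tact_pt \<Phi>_pt cherednik_comp add_0_right)
qed

text \<open>The tensors congruent modulo \<open>K\<close> to some a \<otimes> v form a submodule
  containing 1 \<otimes> v, and this vector generates.\<close>

lemma orbit_surj:
  assumes "t \<in> mcarrier TM"
  shows "\<exists>a\<in>H. mcoset TM K t = orbit a"
proof -
  let ?N = "{t \<in> mcarrier TM. \<exists>a\<in>H. t - pt a v \<in> K}"
  have "submodule H TM ?N"
    unfolding submodule_def TM_simps(2-)
  proof (intro conjI ballI)
    have "0 - pt 0 v \<in> K" using sub_0[OF submodule_K] by (simp add: pt_0)
    then show "0 \<in> ?N" using TM.zero_closed zero_in_H by (auto simp only: TM_simps(2) mem_Collect_eq)
    show "x + y \<in> ?N" if xy: "x \<in> ?N" "y \<in> ?N" for x y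
    proof -
      obtain a b where ab: "a \<in> H" "b \<in> H" "x - pt a v \<in> K" "y - pt b v \<in> K" using xy by blast
      have "(x + y) - pt (a + b) v \<in> K"
        unfolding pt_add add_diff_add by (rule sub_add[OF submodule_K ab(3,4)])
      then show ?thesis using xy TM.add_closed[of x y] H_plus[OF ab(1,2)] unfolding TM_simps(3) by blast
    qed
    show "tact h x \<in> ?N" if hx: "h \<in> H" "x \<in> ?N" for h x
    proof -
      obtain a where a: "a \<in> H" "x - pt a v \<in> K" using hx by blast
      have "tact h x - pt (h \<circ> a) v \<in> K"
        using sub_act[OF submodule_K hx(1) a(2)] by (simp only: tact_diff[OF hx(1)] tact_pt[OF hx(1)])
      then show ?thesis using hx tact_closed cherednik_comp[OF hx(1) a(1)] by blast
    qed
  qed blast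
  moreover have "K \<subseteq> ?N"
  proof
    fix x assume "x \<in> K"
    then have "x - pt 0 v \<in> K" "x \<in> mcarrier TM"
      using TM.submoduleD(1)[OF submodule_K] by (auto simp: pt_0)
    then show "x \<in> ?N" using zero_in_H by blast
  qed
  moreover have "pt id v \<in> ?N"
    using pt_closed[OF id_in_H] id_in_H sub_0[OF submodule_K] by (auto simp del: id_apply intro!: bexI[of _ id])
  ultimately have "?N = mcarrier TM" using submodule_eq_carrier v_nonzero by blast
  then obtain a where a: "a \<in> H" "t - pt a v \<in> K" using assms by blast
  then have "\<exists>n\<in>K. t = madd TM (pt a v) n" by (auto simp: TM_simps intro!: bexI[of _ "t - pt a v"])
  then have "mcoset TM K t = mcoset TM K (pt a v)"
    using TM.mcoset_eq_iff[OF submodule_K pt_closed[OF a(1), of v] assms] by simp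
  then show ?thesis using a orbit_eq_coset by auto
qed

text \<open>\<open>verma_form\<close> chooses representatives. The second can be exchanged at once;
  the first stands under \<open>\<sigma>\<close>, so adjointness turns it to the right end before it
  is exchanged. This is why \<open>a\<close> and \<open>b\<close> come out in reversed
  order.\<close>

lemma verma_form_orbit:
  assumes "a \<in> H" "b \<in> H"
  shows "verma_form R Rp k \<rho> \<sigma> \<pi> form v (orbit a) (orbit b) = form v (act (\<sigma> b \<circ> a) v)"
proof -
  define a' where "a' = (SOME a'. a' \<in> H \<and> orbit a' = orbit a)"
  define b' where "b' = (SOME b'. b' \<in> H \<and> orbit b' = orbit b)"
  have a': "a' \<in> H" "orbit a' = orbit a"
    using someI[of "\<lambda>a'. a' \<in> H \<and> orbit a' = orbit a" a] assms by (auto simp: a'_def)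
  have b': "b' \<in> H" "orbit b' = orbit b"
    using someI[of "\<lambda>b'. b' \<in> H \<and> orbit b' = orbit b" b] assms by (auto simp: b'_def)
  have "verma_form R Rp k \<rho> \<sigma> \<pi> form v (orbit a) (orbit b) = form v (act (\<sigma> a' \<circ> b') v)"
    by (simp add: verma_form_def act_def a'_def b'_def Let_def)
  also have "act (\<sigma> a' \<circ> b') v = act (\<sigma> a' \<circ> b) v"
    using a' b' assms by (intro act_eq_of_coset_eq sigma_in_H)
  also have "\<sigma> a' \<circ> b = \<sigma> (\<sigma> b \<circ> a')"
    using a' assms by (simp only: sigma_comp sigma_in_H sigma_sigma)
  also have "form v (act (\<sigma> (\<sigma> b \<circ> a')) v) = form v (act (\<sigma> b \<circ> a') v)"
    using form_act_sigma[OF cherednik_comp[OF sigma_in_H[OF assms(2)] a'(1)], of v v]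
    by (simp only: form_commute[of v "act (\<sigma> (\<sigma> b \<circ> a')) v"])
  also have "act (\<sigma> b \<circ> a') v = act (\<sigma> b \<circ> a) v"
    using a' assms by (intro act_eq_of_coset_eq sigma_in_H)
  finally show ?thesis .
qed

text \<open>\<open>form\<close> tests against the single vector \<open>v\<close>, but prefixing
  group elements to the operator tests against all translates of \<open>v\<close>; a vector
  orthogonal to all of them lies in a proper invariant subspace and so vanishes.\<close>

lemma orbit_in_radical_iff:
  assumes a: "a \<in> H"
  shows "orbit a \<in> verma_radical R Rp k \<rho> \<sigma> \<pi> form v \<longleftrightarrow> pt a v \<in> J0"
proof -
  have carrier: "mcarrier (verma R Rp k \<rho>) = orbit ` H"
  proof -
    have "orbit b \<in> mcoset TM K ` mcarrier TM" if "b \<in> H" for b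
      using that pt_closed orbit_eq_coset by blast
    then show ?thesis
      unfolding verma_def TM.quotient_carrier[OF submodule_K] using orbit_surj by blast
  qed
  have "orbit a \<in> verma_radical R Rp k \<rho> \<sigma> \<pi> form v \<longleftrightarrow> (\<forall>b\<in>H. form v (act (\<sigma> b \<circ> a) v) = 0)"
    unfolding verma_radical_def carrier using a by (auto simp: verma_form_orbit simp del: comp_apply)
  \<comment> \<open>The involution maps \<open>H\<close> onto itself, so \<open>\<sigma> b\<close>
    is an arbitrary element.\<close>
  also have "\<dots> \<longleftrightarrow> (\<forall>c\<in>H. form v (act (c \<circ> a) v) = 0)"
    using sigma_in_H sigma_sigma by metis
  also have "\<dots> \<longleftrightarrow> (\<forall>c\<in>H. act (c \<circ> a) v = 0)"
  proof
    assume *: "\<forall>c\<in>H. form v (act (c \<circ> a) v) = 0"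
    let ?U = "{u. \<forall>w\<in>W. form v (\<rho> w *v u) = 0}"
    have "vec.subspace ?U"
      by (auto simp: vec.subspace_def form_0 form_add form_scale matrix_vector_right_distrib vector_scalar_commute)
    moreover have "\<rho> w *v u \<in> ?U" if "w \<in> W" "u \<in> ?U" for w u
    proof -
      have "form v (\<rho> w' *v (\<rho> w *v u)) = 0" if "w' \<in> W" for w'
        using \<open>u \<in> ?U\<close> W_comp[OF that \<open>w \<in> W\<close>] rho_comp_apply[OF that \<open>w \<in> W\<close>, of u] by force
      then show ?thesis by blast
    qed
    ultimately have "?U = {0} \<or> ?U = UNIV" by (rule invariant_subspace)
    moreover have "?U \<noteq> UNIV"
    proof
      assume "?U = UNIV"
      then have "form v (\<rho> id *v u) = 0" for u using weyl_id by blast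
      then show False using form_nondegenerate[of v] v_nonzero by (simp only: rho_id matrix_vector_mul_lid) blast
    qed
    ultimately have U: "?U = {0}" by blast
    show "\<forall>c\<in>H. act (c \<circ> a) v = 0"
    proof
      fix c assume c: "c \<in> H"
      have "form v (\<rho> w *v act (c \<circ> a) v) = 0" if w: "w \<in> W" for w
        using act_weyl_comp[OF cherednik_comp[OF c a] w, of v] *[rule_format, OF cherednik_comp[OF cherednik_weyl[OF w] c]]
        by (simp only: comp_assoc)
      then have "act (c \<circ> a) v \<in> ?U" by blast
      then show "act (c \<circ> a) v = 0" using U by blast
    qed
  qed (simp add: form_0 del: comp_apply)
  also have "\<dots> \<longleftrightarrow> pt a v \<in> J0"
    unfolding J0_def using pt_closed[OF a, of v] by (simp add: tact_pt \<Phi>_pt cherednik_comp a del: comp_apply)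
  finally show ?thesis .
qed

lemma orbit_in_grade:
  assumes "p \<in> homogeneous n"
  shows "orbit (op_mult p) \<in> verma_grade R Rp k \<rho> n"
proof -
  have "Const (v $ i) * p \<in> homogeneous n" for i
    using assms by (simp add: homogeneous_iff_euler euler_mult mult_ac)
  then have "verma_class R Rp k \<rho> (\<chi> i. op_mult (Const (v $ i) * p)) \<in> verma_grade R Rp k \<rho> n"
    unfolding verma_grade_def mem_Collect_eq by (intro exI[of _ "\<lambda>i. Const (v $ i) * p"]) simp
  then show ?thesis
    by (simp add: orbit_eq_coset op_mult_in_H pt_op_mult polyt_def verma_class_def)
qed

lemma E_power_in_radical_grade_iff:
  "orbit (op_mult (E_poly z ^ m)) \<in> radical_grade R Rp k \<rho> \<sigma> \<pi> form v (2 * m) \<longleftrightarrow>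
     pt (op_mult (E_poly z ^ m)) v \<in> J0"
  using orbit_in_grade[of "E_poly z ^ m" "2 * m"] euler_power[OF euler_E_poly, of z m]
  by (simp add: radical_grade_def orbit_in_radical_iff op_mult_in_H homogeneous_iff_euler)

section \<open>The annihilator of the simple quotient\<close>

text \<open>Formed among operators and not vectors, so as to be a two-sided ideal, stable under
  commutators with Dunkl operators.\<close>

definition Ann :: "'n oper set" where
  "Ann = {h \<in> H. \<forall>t\<in>mcarrier TM. tact h t \<in> J0}"

lemma Ann_left: "a \<in> H \<Longrightarrow> h \<in> Ann \<Longrightarrow> a \<circ> h \<in> Ann"
  using sub_act[OF submodule_J0] by (auto simp: Ann_def tact_comp cherednik_comp)

lemma Ann_right: "a \<in> H \<Longrightarrow> h \<in> Ann \<Longrightarrow> h \<circ> a \<in> Ann"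
  using tact_closed by (auto simp: Ann_def tact_comp cherednik_comp)

lemma Ann_plus:
  assumes "a \<in> Ann" "b \<in> Ann"
  shows "a + b \<in> Ann"
proof -
  have "tact (a + b) t = tact a t + tact b t" for t
    by (simp add: tact_def vec_eq_iff fun_eq_iff)
  then show ?thesis using assms sub_add[OF submodule_J0] H_plus by (auto simp only: Ann_def mem_Collect_eq)
qed

lemma Ann_0: "0 \<in> Ann"
proof -
  have "tact 0 t = 0" for t by (simp add: tact_def vec_eq_iff fun_eq_iff)
  then show ?thesis using sub_0[OF submodule_J0] zero_in_H by (simp only: Ann_def mem_Collect_eq) simp
qed

lemma Ann_sum: "(\<And>i. i \<in> B \<Longrightarrow> f i \<in> Ann) \<Longrightarrow> (\<Sum>i\<in>B. f i) \<in> Ann"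
  by (induction B rule: infinite_finite_induct) (simp_all only: Ann_0 Ann_plus sum.infinite sum.empty sum.insert insert_iff simp_thms)

lemma Ann_scale: "a \<in> Ann \<Longrightarrow> op_scale c a \<in> Ann"
  using Ann_left[OF scale_id_in_H, of a c] by (simp only: op_scale_comp id_comp)

lemma Ann_diff: "a \<in> Ann \<Longrightarrow> b \<in> Ann \<Longrightarrow> a - b \<in> Ann"
proof -
  assume "a \<in> Ann" "b \<in> Ann"
  moreover have "a - b = a + op_scale (- 1) b"
    by (simp add: fun_eq_iff op_scale_def Const_minus)
  ultimately show ?thesis using Ann_plus Ann_scale by metis
qed

definition Ann_poly :: "'n cpoly set" where
  "Ann_poly = {p. op_mult p \<in> Ann}"

lemma Ann_poly_mult: "p \<in> Ann_poly \<Longrightarrow> q * p \<in> Ann_poly"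
  unfolding Ann_poly_def mem_Collect_eq op_mult_mult by (rule Ann_left[OF op_mult_in_H])

lemma Ann_poly_add: "p \<in> Ann_poly \<Longrightarrow> q \<in> Ann_poly \<Longrightarrow> p + q \<in> Ann_poly"
  unfolding Ann_poly_def mem_Collect_eq op_mult_add op_add_eq_plus by (rule Ann_plus)

lemma Ann_poly_diff: "p \<in> Ann_poly \<Longrightarrow> q \<in> Ann_poly \<Longrightarrow> p - q \<in> Ann_poly"
  using Ann_poly_add[of p "- 1 * q"] Ann_poly_mult[of q "- 1"] by simp

lemma Ann_poly_sum: "(\<And>i. i \<in> B \<Longrightarrow> f i \<in> Ann_poly) \<Longrightarrow> (\<Sum>i\<in>B. f i) \<in> Ann_poly"
proof -
  have "0 \<in> Ann_poly"
  proof -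
    have "op_mult 0 = (0 :: 'n oper)" by (simp add: fun_eq_iff op_mult_def)
    then show ?thesis using Ann_0 by (simp only: Ann_poly_def mem_Collect_eq)
  qed
  then show "(\<And>i. i \<in> B \<Longrightarrow> f i \<in> Ann_poly) \<Longrightarrow> (\<Sum>i\<in>B. f i) \<in> Ann_poly"
    by (induction B rule: infinite_finite_induct) (auto intro: Ann_poly_add)
qed

text \<open>Irreducibility spreads the condition from \<open>v\<close> to the whole module, so the
  annihilator becomes visible on one vector.\<close>

lemma Ann_poly_invariant_iff:
  assumes "\<And>w. w \<in> W \<Longrightarrow> weyl_act w q = q"
  shows "q \<in> Ann_poly \<longleftrightarrow> pt (op_mult q) v \<in> J0"
proof
  assume "q \<in> Ann_poly"
  then have "tact (op_mult q) (pt id v) \<in> J0"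
    using pt_closed[OF id_in_H] by (auto simp: Ann_poly_def Ann_def)
  then show "pt (op_mult q) v \<in> J0" by (simp only: tact_pt op_mult_in_H comp_id)
next
  assume "pt (op_mult q) v \<in> J0"
  then show "q \<in> Ann_poly"
    using invariant_polynomial_propagates[OF submodule_J0 K_subset_J0 assms _ v_nonzero]
    by (simp add: Ann_poly_def Ann_def op_mult_in_H)
qed

text \<open>Multiplication by the derivative is the commutator of \<open>T y\<close> with an
  invariant multiplier, and the two-sided ideal contains it.\<close>

lemma Ann_poly_dir_deriv:
  assumes "\<And>w. w \<in> W \<Longrightarrow> weyl_act w q = q" "q \<in> Ann_poly"
  shows "dir_deriv y q \<in> Ann_poly"
proof -
  have "op_mult (dir_deriv y q) = (T y \<circ> op_mult q) - (op_mult q \<circ> T y)"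
    by (simp add: fun_eq_iff op_mult_def dunkl_mult_invariant[OF assms(1)])
  then show ?thesis
    using assms(2) unfolding Ann_poly_def mem_Collect_eq
    by (simp only: Ann_diff Ann_left Ann_right cherednik_dunkl)
qed

abbreviation "E \<equiv> E_poly z"

lemma weyl_act_E_power: "w \<in> W \<Longrightarrow> weyl_act w (E ^ m) = E ^ m"
  by (simp add: weyl_act_power weyl_act_E)

lemma dir_deriv_E_power:
  "dir_deriv (Biso R x) (E ^ Suc m) = of_nat (Suc m) * E ^ m * linear_form x"
  by (simp only: dir_deriv_power dir_deriv_E diff_Suc_1)

abbreviation "forms xs \<equiv> prod_list (map linear_form xs) :: 'n cpoly"

lemma weyl_act_forms: "weyl_act w (forms xs) = forms (map (complexified w) xs)"
  using weyl_act_Const[of w 1] by (induction xs) (simp_all add: weyl_act_mult weyl_act_linear_form)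

text \<open>\<open>T y\<close> is moved through \<open>xs\<close> one form at a time. A form that is
  passed intact joins the prefix \<open>us\<close>; one that is consumed, into a scalar or a
  reflection, leaves exactly \<open>d\<close> forms times \<open>E ^ Suc a\<close>. The lengths are
  tied together so that this count is always right.\<close>

lemma commutator_in_Ann:
  assumes Ann_poly: "\<And>xs. length xs = d \<Longrightarrow> forms xs * E ^ Suc a \<in> Ann_poly"
    and "length us + length xs = Suc d"
  shows "(\<lambda>s. forms us * (T y (forms xs * (E ^ Suc a * s)) - forms xs * T y (E ^ Suc a * s))) \<in> Ann"
  using assms(2)
proof (induction xs arbitrary: us)
  case Nil
  then show ?case using Ann_0 by (simp add: zero_fun_def)
next
  case (Cons x xs)
  let ?E = "E ^ Suc a"
  let ?c = "\<lambda>\<alpha>. k \<alpha> * pairing (cplx \<alpha>) y * pairing x (cplx (cor \<alpha>))"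
  let ?r = "\<lambda>\<alpha>. complexified (r \<alpha>)"
  have 1: "(\<lambda>s. forms (us @ [x]) * (T y (forms xs * (?E * s)) - forms xs * T y (?E * s))) \<in> Ann"
    using Cons.prems by (intro Cons.IH) simp
  have 2: "op_scale (pairing x y) (op_mult (forms (us @ xs) * ?E)) \<in> Ann"
    using Ann_poly[of "us @ xs"] Cons.prems unfolding Ann_poly_def mem_Collect_eq by (intro Ann_scale) simp
  have 3: "(\<Sum>\<alpha>\<in>Rp. op_scale (?c \<alpha>) (op_mult (forms (us @ map (?r \<alpha>) xs) * ?E) \<circ> weyl_act (r \<alpha>))) \<in> Ann"
  proof (rule Ann_sum)
    fix \<alpha> assume "\<alpha> \<in> Rp"
    then have "weyl_act (r \<alpha>) \<in> H" using Rp_subset by (intro cherednik_weyl reflection_in_W) auto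
    then show "op_scale (?c \<alpha>) (op_mult (forms (us @ map (?r \<alpha>) xs) * ?E) \<circ> weyl_act (r \<alpha>)) \<in> Ann"
      using Ann_poly[of "us @ map (?r \<alpha>) xs"] Cons.prems unfolding Ann_poly_def mem_Collect_eq
      by (intro Ann_scale Ann_right) simp_all
  qed
  \<comment> \<open>Thanks to this the reflected product again consists of linear forms times the
    same power of \<open>E\<close>.\<close>
  have inv: "weyl_act (r \<alpha>) ?E = ?E" if "\<alpha> \<in> Rp" for \<alpha>
    using that Rp_subset by (intro weyl_act_E_power reflection_in_W) auto
  have eq: "(\<lambda>s. forms us * (T y (forms (x # xs) * (?E * s)) - forms (x # xs) * T y (?E * s))) =
      (\<lambda>s. forms (us @ [x]) * (T y (forms xs * (?E * s)) - forms xs * T y (?E * s))) +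
      (op_scale (pairing x y) (op_mult (forms (us @ xs) * ?E)) +
      (\<Sum>\<alpha>\<in>Rp. op_scale (?c \<alpha>) (op_mult (forms (us @ map (?r \<alpha>) xs) * ?E) \<circ> weyl_act (r \<alpha>))))"
  proof
    fix s
    have "forms us * (\<Sum>\<alpha>\<in>Rp. Const (?c \<alpha>) * weyl_act (r \<alpha>) (forms xs * (?E * s))) =
        (\<Sum>\<alpha>\<in>Rp. op_scale (?c \<alpha>) (op_mult (forms (us @ map (?r \<alpha>) xs) * ?E) \<circ> weyl_act (r \<alpha>))) s"
      unfolding sum_fun_apply sum_distrib_left
      by (intro sum.cong refl)
         (simp add: weyl_act_mult weyl_act_forms inv op_scale_def op_mult_def mult_ac del: power_Suc)
    then show "forms us * (T y (forms (x # xs) * (?E * s)) - forms (x # xs) * T y (?E * s)) =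
      ((\<lambda>s. forms (us @ [x]) * (T y (forms xs * (?E * s)) - forms xs * T y (?E * s))) +
      (op_scale (pairing x y) (op_mult (forms (us @ xs) * ?E)) +
      (\<Sum>\<alpha>\<in>Rp. op_scale (?c \<alpha>) (op_mult (forms (us @ map (?r \<alpha>) xs) * ?E) \<circ> weyl_act (r \<alpha>))))) s"
      using dunkl_linear_form_mult[of y x "forms xs * (?E * s)"]
      by (simp add: op_scale_def op_mult_def algebra_simps del: power_Suc)
  qed
  show ?case unfolding eq by (intro Ann_plus 1 2 3)
qed

text \<open>Commuting a Dunkl operator past \<open>p E\<^sup>a\<^sup>+\<^sup>1\<close> trades one factor \<open>E\<close> for a linear form; the terms
  coming from the commutator with \<open>p\<close> have lower degree in \<open>p\<close> and are killed after
  multiplication by one more linear form.\<close>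

lemma trade_E_for_linear_forms:
  assumes Ann_poly: "\<And>xs. length xs = d \<Longrightarrow> forms xs * E ^ Suc a \<in> Ann_poly"
    and "length xs = d + 2"
  shows "forms xs * E ^ a \<in> Ann_poly"
proof -
  \<comment> \<open>\<open>x2\<close> will emerge from the commutator with \<open>E ^ Suc a\<close>;
    \<open>x1\<close> is the spare factor required by \<open>commutator_in_Ann\<close>.\<close>
  obtain x1 x2 xs' where xs: "xs = x1 # x2 # xs'" and len: "length xs' = d"
    using assms(2) by (metis Suc_length_conv add_2_eq_Suc')
  let ?y = "Biso R x2" and ?p = "forms xs'" and ?E = "E ^ Suc a"
  have pE: "op_mult (?p * ?E) \<in> Ann" using Ann_poly[OF len] by (simp add: Ann_poly_def)
  let ?D = "\<lambda>s. forms [x1] * (T ?y (?p * (?E * s)) - ?p * T ?y (?E * s))"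
  have D: "?D \<in> Ann"
    by (rule commutator_in_Ann[OF Ann_poly]) (simp_all add: len)
  \<comment> \<open>The first two products differ by the full commutator with \<open>T ?y\<close>;
    removing \<open>?D\<close>, the part due to \<open>?p\<close>, leaves the derivative of the
    power of \<open>E\<close>.\<close>
  have "op_scale (of_nat (Suc a)) (op_mult (forms xs * E ^ a)) =
      (op_mult (linear_form x1) \<circ> (T ?y \<circ> op_mult (?p * ?E))) -
      (op_mult (linear_form x1) \<circ> (op_mult (?p * ?E) \<circ> T ?y)) - ?D"
  proof
    fix s
    have "T ?y (?E * s) = ?E * T ?y s + of_nat (Suc a) * E ^ a * linear_form x2 * s"
      by (subst dunkl_mult_invariant) (simp_all only: weyl_act_E_power dir_deriv_E_power)
    then show "op_scale (of_nat (Suc a)) (op_mult (forms xs * E ^ a)) s =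
      ((op_mult (linear_form x1) \<circ> (T ?y \<circ> op_mult (?p * ?E))) -
      (op_mult (linear_form x1) \<circ> (op_mult (?p * ?E) \<circ> T ?y)) - ?D) s"
      by (simp add: op_scale_def op_mult_def xs Const_of_nat[of "Suc a"] algebra_simps del: power_Suc of_nat_Suc)
  qed
  also have "\<dots> \<in> Ann"
    by (intro Ann_diff D Ann_left Ann_right pE op_mult_in_H cherednik_dunkl)
  finally have "op_scale (1 / of_nat (Suc a)) (op_scale (of_nat (Suc a)) (op_mult (forms xs * E ^ a))) \<in> Ann"
    by (rule Ann_scale)
  moreover have "op_scale (1 / of_nat (Suc a)) (op_scale (of_nat (Suc a)) h) = h" for h :: "'n oper"
  proof -
    have "Const (1 / of_nat (Suc a)) * (Const (of_nat (Suc a)) * u) = u" for u :: "'n cpoly"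
      by (simp flip: mult.assoc Const_mult del: of_nat_Suc)
    then show ?thesis by (simp only: op_scale_def)
  qed
  ultimately show ?thesis by (simp only: Ann_poly_def mem_Collect_eq)
qed

text \<open>Each trade lowers the power of \<open>E\<close> by one and adds two linear forms;
  \<open>m\<close> trades exhaust \<open>E ^ m\<close>.\<close>

lemma forms_in_Ann_poly:
  assumes "E ^ m \<in> Ann_poly" "length xs = 2 * m"
  shows "forms xs \<in> Ann_poly"
proof -
  have "\<forall>xs. length xs = 2 * j \<longrightarrow> forms xs * E ^ (m - j) \<in> Ann_poly" if "j \<le> m" for j
    using that
  proof (induction j)
    case 0
    then show ?case using assms by simp
  next
    case (Suc j)
    then have "m - j = Suc (m - Suc j)" by simp
    with Suc show ?case
      using trade_E_for_linear_forms[of "2 * j" "m - Suc j"] by simp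
  qed
  from this[of m] assms show ?thesis by simp
qed

lemma single_in_Ann_poly:
  assumes "E ^ m \<in> Ann_poly" "2 * m \<le> mono_degree e"
  shows "Poly_Mapping.single e c \<in> Ann_poly"
proof -
  obtain xs where xs: "length xs = mono_degree e" "Poly_Mapping.single e 1 = forms xs"
    using monomial_eq_prod_list[of e] by blast
  have "forms (take (2 * m) xs) \<in> Ann_poly" using assms xs by (intro forms_in_Ann_poly) auto
  moreover have "forms xs = forms (drop (2 * m) xs) * forms (take (2 * m) xs)"
    by (metis append_take_drop_id map_append mult.commute prod_list.append)
  moreover have "Poly_Mapping.single e c = Const c * Poly_Mapping.single e 1"
    by (simp add: Const_mult_single)
  ultimately show ?thesis using xs(2) Ann_poly_mult by simp
qed

lemma mspan_add: "x \<in> mspan TM X \<Longrightarrow> y \<in> mspan TM X \<Longrightarrow> x + y \<in> mspan TM X"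
proof (induction rule: mspan.induct)
  case mspan_zero
  then show ?case by (simp add: TM_simps)
next
  case (mspan_step x u c)
  then show ?case
    using mspan.mspan_step[of x X "u + y" TM c] by (simp only: TM_simps add.assoc)
qed

text \<open>Monomials of degree at least \<open>2 * m\<close> annihilate the quotient, so the
  finitely many smaller ones, tensored with the standard basis, span it.\<close>

lemma finite_dimensional_if_E_power:
  assumes "E ^ m \<in> Ann_poly"
  shows "finite_dimensional (quotient_module TM J0)"
proof -
  define X where "X = (\<lambda>(e, i). pt (op_mult (Poly_Mapping.single e 1)) (axis i 1)) `
    ({e. mono_degree e < 2 * m} \<times> UNIV)"
  have "finite X" by (simp add: X_def finite_mono_degree)
  have "X \<subseteq> mcarrier TM" using pt_closed[OF op_mult_in_H] by (auto simp only: X_def split: prod.splits)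
  define G where "G = {t. \<exists>s\<in>mspan TM X. t - s \<in> J0}"
  have zero: "0 \<in> mspan TM X" using mspan_zero[of TM X] by (simp add: TM_simps)
  have G_J0: "t \<in> G" if "t \<in> J0" for t
    using that zero unfolding G_def by (auto intro!: bexI[of _ 0])
  have G_add: "s + t \<in> G" if st: "s \<in> G" "t \<in> G" for s t
  proof -
    obtain s' t' where *: "s' \<in> mspan TM X" "t' \<in> mspan TM X" "s - s' \<in> J0" "t - t' \<in> J0"
      using st by (auto simp: G_def)
    have "(s + t) - (s' + t') \<in> J0"
      unfolding add_diff_add by (rule sub_add[OF submodule_J0 *(3,4)])
    then show ?thesis using mspan_add[OF *(1,2)] unfolding G_def by blast
  qed
  have G_sum: "(\<And>i. i \<in> B \<Longrightarrow> f i \<in> G) \<Longrightarrow> (\<Sum>i\<in>B. f i) \<in> G" for f and B :: "'x set"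
    using G_J0[OF sub_0[OF submodule_J0]] G_add
    by (induction B rule: infinite_finite_induct) simp_all
  have G_single: "pt (op_mult (Poly_Mapping.single e c)) (axis i 1) \<in> G" for e c i
  proof (cases "mono_degree e < 2 * m")
    case True
    then have x: "pt (op_mult (Poly_Mapping.single e 1)) (axis i 1) \<in> X" by (force simp: X_def)
    have "op_mult (Poly_Mapping.single e c) = op_scale c (op_mult (Poly_Mapping.single e 1))"
      by (simp add: Const_mult_single flip: op_mult_Const_mult)
    then have "pt (op_mult (Poly_Mapping.single e c)) (axis i 1) \<in> mspan TM X"
      using mspan_step[OF x mspan_zero, of TM c]
      by (simp only: TM_simps pt_scale pt_scale_right add_0_right)
    then show ?thesis
      using sub_0[OF submodule_J0] unfolding G_def by (auto intro!: bexI)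
  next
    case False
    then have "op_mult (Poly_Mapping.single e c) \<in> Ann"
      using single_in_Ann_poly[OF assms, of e c] by (simp add: Ann_poly_def)
    then have "tact (op_mult (Poly_Mapping.single e c)) (pt id (axis i 1)) \<in> J0"
      using pt_closed[OF id_in_H] by (auto simp: Ann_def)
    then show ?thesis
      by (intro G_J0) (simp only: tact_pt op_mult_in_H comp_id)
  qed
  have G_poly: "pt (op_mult p) (axis i 1) \<in> G" for p i
  proof -
    have sum: "op_mult (\<Sum>e\<in>B. f e) = (\<Sum>e\<in>B. op_mult (f e))" for f and B :: "('n \<Rightarrow>\<^sub>0 nat) set"
      by (simp add: fun_eq_iff op_mult_def sum_fun_apply sum_distrib_right)
    have "pt (op_mult (\<Sum>e\<in>Poly_Mapping.keys p. Poly_Mapping.single e (Poly_Mapping.lookup p e))) (axis i 1) \<in> G"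
      unfolding sum pt_sum by (intro G_sum G_single)
    then show ?thesis by (simp flip: cpoly_eq_sum_single)
  qed
  have G: "t \<in> G" if t: "t \<in> mcarrier TM" for t
  proof -
    obtain p where p: "t - polyt p \<in> K" using normal_form[OF t] by blast
    then have "t - polyt p \<in> G" using K_subset_J0 G_J0 by blast
    moreover have "polyt p \<in> G" unfolding polyt_eq_sum by (intro G_sum G_poly)
    ultimately show ?thesis using G_add by fastforce
  qed
  have "\<exists>s\<in>mspan TM X. mcoset TM J0 s = mcoset TM J0 t" if t: "t \<in> mcarrier TM" for t
  proof -
    obtain s where s: "s \<in> mspan TM X" "t - s \<in> J0" using G[OF t] unfolding G_def by blast
    have "s \<in> mcarrier TM" using TM.mspan_subset[OF \<open>X \<subseteq> mcarrier TM\<close>] s(1) by blast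
    moreover have "t = madd TM s (t - s)" by (simp add: TM_simps(3))
    ultimately show ?thesis
      using TM.mcoset_eq_iff[OF submodule_J0 _ t, of s] s by blast
  qed
  then show ?thesis
    unfolding TM.finite_dimensional_quotient_iff[OF submodule_J0]
    using \<open>finite X\<close> \<open>X \<subseteq> mcarrier TM\<close> by (intro exI[of _ X] conjI ballI)
qed

section \<open>Annihilating polynomials in \<open>E\<close>\<close>

lemma tact_scale_add: "tact (op_scale (a + b) id) t = tact (op_scale a id) t + tact (op_scale b id) t"
  and tact_scale_mult: "tact (op_scale (a * b) id) t = tact (op_scale a id) (tact (op_scale b id) t)"
  and tact_scale_0: "tact (op_scale 0 id) t = 0"
  by (simp_all add: tact_def vec_eq_iff fun_eq_iff op_scale_def Const_add Const_mult distrib_right mult.assoc)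

lemma tact_scale_sum: "tact (op_scale (\<Sum>i\<in>B. f i) id) t = (\<Sum>i\<in>B. tact (op_scale (f i) id) t)"
  by (induction B rule: infinite_finite_induct)
     (simp_all only: tact_scale_add tact_scale_0 sum.infinite sum.empty sum.insert simp_thms)

lemma mspan_coefficients:
  assumes "finite X" "s \<in> mspan TM X"
  shows "\<exists>c. s = (\<Sum>x\<in>X. tact (op_scale (c x) id) x)"
  using assms(2)
proof (induction rule: mspan.induct)
  case mspan_zero
  show ?case by (rule exI[of _ "\<lambda>_. 0"]) (simp only: TM_simps tact_scale_0 sum.neutral_const)
next
  case (mspan_step x y c)
  then obtain d where d: "y = (\<Sum>x\<in>X. tact (op_scale (d x) id) x)" by blast
  have "(\<Sum>x'\<in>X. tact (op_scale (d x' + (if x' = x then c else 0)) id) x') =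
      (\<Sum>x'\<in>X. tact (op_scale (d x') id) x' + (if x' = x then tact (op_scale c id) x else 0))"
    by (intro sum.cong) (auto simp: tact_scale_add tact_scale_0)
  also have "\<dots> = y + tact (op_scale c id) x"
    using assms(1) mspan_step(1) by (simp add: sum.distrib d)
  finally show ?case
    by (intro exI[of _ "\<lambda>x'. d x' + (if x' = x then c else 0)"]) (simp only: TM_simps add.commute)
qed

definition peval :: "complex poly \<Rightarrow> 'n cpoly" where
  "peval f = (\<Sum>i\<le>degree f. Const (coeff f i) * E ^ i)"

lemma peval_eq: "degree f \<le> n \<Longrightarrow> peval f = (\<Sum>i\<le>n. Const (coeff f i) * E ^ i)"
  unfolding peval_def by (rule sum_coeff_degree[symmetric]) auto

lemma weyl_act_peval: "w \<in> W \<Longrightarrow> weyl_act w (peval f) = peval f"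
  by (simp add: peval_def weyl_act_sum weyl_act_mult weyl_act_E_power)

text \<open>The vectors \<open>E^i.v\<close> have classes in a finite-dimensional space, so they are
  linearly dependent. Invariance of the resulting \<open>peval f\<close> lifts its vanishing at
  \<open>v\<close> to the whole quotient.\<close>

lemma finite_dimensional_imp_peval:
  assumes "finite_dimensional (quotient_module TM J0)"
  shows "\<exists>f. f \<noteq> 0 \<and> peval f \<in> Ann_poly"
proof -
  obtain X where X: "finite X" "X \<subseteq> mcarrier TM"
    and span: "\<And>t. t \<in> mcarrier TM \<Longrightarrow> \<exists>s\<in>mspan TM X. mcoset TM J0 s = mcoset TM J0 t"
    using assms TM.finite_dimensional_quotient_iff[OF submodule_J0] by blast
  \<comment> \<open>\<open>c\<close> lists coordinates of \<open>E^i.v\<close> along the spanning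
    set \<open>X\<close>, modulo \<open>J0\<close>; one such list is chosen for each
    \<open>i\<close>.\<close>
  define Q where "Q i c \<longleftrightarrow> pt (op_mult (E ^ i)) v - (\<Sum>x\<in>X. tact (op_scale (c x) id) x) \<in> J0"
    for i and c :: "'n oper ^ 'm \<Rightarrow> complex"
  have "\<exists>c. Q i c" for i
  proof -
    let ?t = "pt (op_mult (E ^ i)) v"
    have t: "?t \<in> mcarrier TM" by (rule pt_closed[OF op_mult_in_H])
    then obtain s where s: "s \<in> mspan TM X" "mcoset TM J0 s = mcoset TM J0 ?t" using span by blast
    moreover have "s \<in> mcarrier TM" using s TM.mspan_subset[OF X(2)] by blast
    ultimately obtain n where "n \<in> J0" "?t = s + n"
      using TM.mcoset_eq_iff[OF submodule_J0 _ t] by (auto simp only: TM_simps(3))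
    then have "?t - s \<in> J0" by simp
    then show ?thesis using mspan_coefficients[OF X(1) s(1)] unfolding Q_def by blast
  qed
  then obtain c where "\<And>i. Q i (c i)" by metis
  then have c: "pt (op_mult (E ^ i)) v - (\<Sum>x\<in>X. tact (op_scale (c i x) id) x) \<in> J0" for i
    by (simp only: Q_def)
  obtain f where f: "f \<noteq> 0" "\<And>x. x \<in> X \<Longrightarrow> (\<Sum>i\<le>degree f. coeff f i * c i x) = 0"
    using polynomial_solution[OF X(1), of 0 c] by blast
  let ?s = "\<lambda>a. tact (op_scale a id)"
  have "(\<Sum>i\<le>degree f. ?s (coeff f i) (\<Sum>x\<in>X. ?s (c i x) x)) = (\<Sum>x\<in>X. ?s (\<Sum>i\<le>degree f. coeff f i * c i x) x)"
    by (simp only: tact_sum scale_id_in_H tact_scale_sum tact_scale_mult) (rule sum.swap)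
  also have "\<dots> = 0"
    by (simp add: f(2) tact_scale_0)
  finally have zero: "(\<Sum>i\<le>degree f. ?s (coeff f i) (\<Sum>x\<in>X. ?s (c i x) x)) = 0" .
  have "pt (op_mult (peval f)) v = (\<Sum>i\<le>degree f. ?s (coeff f i) (pt (op_mult (E ^ i)) v))"
  proof -
    have "op_mult (\<Sum>i\<in>B. g i) = (\<Sum>i\<in>B. op_mult (g i))" for g :: "nat \<Rightarrow> 'n cpoly" and B
      by (simp add: fun_eq_iff op_mult_def sum_fun_apply sum_distrib_right)
    then show ?thesis
      by (simp only: peval_def op_mult_Const_mult pt_sum pt_scale pt_scale_right)
  qed
  also have "\<dots> = (\<Sum>i\<le>degree f. ?s (coeff f i) (pt (op_mult (E ^ i)) v - (\<Sum>x\<in>X. ?s (c i x) x)))"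
    using zero by (simp only: tact_diff scale_id_in_H sum_subtractf diff_zero)
  also have "\<dots> \<in> J0"
    by (intro sub_sum[OF submodule_J0] sub_act[OF submodule_J0] scale_id_in_H c)
  finally show ?thesis
    using f(1) Ann_poly_invariant_iff[OF weyl_act_peval] by blast
qed

text \<open>If \<open>f(E)\<close> annihilates the simple quotient, then so does its commutator with a Dunkl
  operator, that is \<open>f'(E) x\<close>, hence also \<open>f'(E) E\<close>; for \<open>f\<close> of minimal degree this forces
  \<open>f'(X) X\<close> to be a multiple of \<open>f\<close>.\<close>

lemma E_power_if_finite_dimensional:
  assumes "finite_dimensional (quotient_module TM J0)"
  shows "\<exists>m. E ^ m \<in> Ann_poly"
proof -
  have "\<exists>f. (f \<noteq> 0 \<and> peval f \<in> Ann_poly) \<and> (\<forall>g. g \<noteq> 0 \<and> peval g \<in> Ann_poly \<longrightarrow> degree f \<le> degree g)"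
    using ex_has_least_nat[of "\<lambda>f. f \<noteq> 0 \<and> peval f \<in> Ann_poly" _ degree]
      finite_dimensional_imp_peval[OF assms] by blast
  then obtain f where f: "f \<noteq> 0" "peval f \<in> Ann_poly"
    and min: "\<And>g. g \<noteq> 0 \<Longrightarrow> peval g \<in> Ann_poly \<Longrightarrow> degree f \<le> degree g" by blast
  define d where "d = degree f"
  \<comment> \<open>The formal derivative of \<open>f\<close> evaluated at \<open>E\<close>; the
    truncated exponent at \<open>i = 0\<close> is harmless because of the factor
    \<open>of_nat i\<close>.\<close>
  define f' where "f' = (\<Sum>i\<le>d. Const (of_nat i * coeff f i) * E ^ (i - 1))"
  have "f' * linear_form x \<in> Ann_poly" for x
  proof -
    have "dir_deriv (Biso R x) (peval f) = f' * linear_form x"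
      by (simp add: peval_def f'_def d_def dir_deriv_sum dir_deriv_mult dir_deriv_power dir_deriv_E
          sum_distrib_right sum_distrib_left Const_mult Const_of_nat mult_ac)
    then show ?thesis using Ann_poly_dir_deriv[OF weyl_act_peval f(2), of "Biso R x"] by simp
  qed
  \<comment> \<open>These multiples recombine the linear forms into \<open>E\<close>, giving a
    polynomial in \<open>E\<close> again.\<close>
  then have "(\<Sum>i\<in>UNIV. (Const (1/2) * linear_form (cplx (z i))) * (f' * linear_form (cplx (z i)))) \<in> Ann_poly"
    by (rule Ann_poly_sum[OF Ann_poly_mult])
  then have "E * f' \<in> Ann_poly"
    by (simp add: E_poly_def sum_distrib_left sum_distrib_right power2_eq_square mult_ac)
  also have "E * f' = (\<Sum>i\<le>d. Const (of_nat i * coeff f i) * E ^ i)"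
  proof -
    have "E * (Const (of_nat i * coeff f i) * E ^ (i - 1)) = Const (of_nat i * coeff f i) * E ^ i" for i
      by (cases i) (simp_all add: mult_ac)
    then show ?thesis by (simp add: f'_def sum_distrib_left)
  qed
  finally have "Const (of_nat d) * peval f - (\<Sum>i\<le>d. Const (of_nat i * coeff f i) * E ^ i) \<in> Ann_poly"
    using f(2) by (intro Ann_poly_diff Ann_poly_mult)
  \<comment> \<open>In \<open>d f - X f'\<close> the leading coefficients cancel, so minimality of
    \<open>d\<close> forces it to be zero. As its coefficients are those of \<open>f\<close> times
    \<open>d - i\<close>, only the term of degree \<open>d\<close> remains in
    \<open>f\<close>.\<close>
  moreover define g where "g = smult (of_nat d) f - pCons 0 (pderiv f)"
  have g_coeff: "coeff g i = (of_nat d - of_nat i) * coeff f i" for i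
    by (cases i) (simp_all add: g_def coeff_pderiv algebra_simps)
  have g_deg: "degree g \<le> d"
    by (rule degree_le) (simp add: g_coeff d_def coeff_eq_0)
  moreover have "peval g = Const (of_nat d) * peval f - (\<Sum>i\<le>d. Const (of_nat i * coeff f i) * E ^ i)"
    unfolding peval_eq[OF g_deg]
    by (simp add: peval_def d_def g_coeff sum_distrib_left left_diff_distrib Const_diff Const_mult
        sum_subtractf mult.assoc)
  ultimately have gIP: "peval g \<in> Ann_poly" by simp
  have "g = 0"
  proof (rule ccontr)
    assume "g \<noteq> 0"
    then have "degree g = d" using min[OF _ gIP] g_deg by (simp add: d_def)
    then have "coeff g d \<noteq> 0" using \<open>g \<noteq> 0\<close> by (metis leading_coeff_0_iff)
    then show False by (simp add: g_coeff)
  qed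
  then have coeff: "coeff f i = 0" if "i \<noteq> d" for i
    using g_coeff[of i] that by simp
  have "peval f = (\<Sum>i\<le>d. if i = d then Const (coeff f d) * E ^ d else 0)"
    unfolding peval_def d_def[symmetric] by (intro sum.cong) (auto simp: coeff)
  then have "peval f = Const (coeff f d) * E ^ d" by simp
  then have "Const (1 / coeff f d) * (Const (coeff f d) * E ^ d) \<in> Ann_poly"
    using Ann_poly_mult[OF f(2)] by simp
  moreover have "coeff f d \<noteq> 0" using f(1) by (simp add: d_def)
  ultimately have "E ^ d \<in> Ann_poly" by (simp flip: mult.assoc Const_mult)
  then show ?thesis by blast
qed

lemma finite_dimensional_iff:
  "finite_dimensional (simple_quotient R Rp k \<rho>) \<longleftrightarrow>
    (\<exists>m. orbit (op_mult (E ^ m)) \<in> radical_grade R Rp k \<rho> \<sigma> \<pi> form v (2 * m))"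
  unfolding finite_dimensional_simple_quotient E_power_in_radical_grade_iff
  using finite_dimensional_if_E_power E_power_if_finite_dimensional
    Ann_poly_invariant_iff[OF weyl_act_E_power] by blast

end

theorem mainTheorem2:
  fixes R Rp :: "(real ^ 'n::finite) set"
    and k :: "real ^ 'n \<Rightarrow> complex"
    and ch :: "(real ^ 'n \<Rightarrow> real ^ 'n) \<Rightarrow> complex"
    and \<rho> :: "(real ^ 'n \<Rightarrow> real ^ 'n) \<Rightarrow> complex ^ 'm::finite ^ 'm"
    and \<sigma> :: "'n oper \<Rightarrow> 'n oper"
    and \<pi> :: "'n oper \<Rightarrow> (real ^ 'n \<Rightarrow> real ^ 'n) \<Rightarrow> complex"
    and form :: "complex ^ 'm \<Rightarrow> complex ^ 'm \<Rightarrow> complex"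
    and v :: "complex ^ 'm"
    and z :: "'n \<Rightarrow> real ^ 'n"
  assumes "reduced_root_system R"
    and "positive_system R Rp"
    and "\<forall>w\<in>weyl_group R. \<forall>\<alpha>\<in>R. k (w \<alpha>) = k \<alpha>"
    and "irreducible_rep R \<rho>"
    and "\<forall>w\<in>weyl_group R. ch w = trace (\<rho> w)"
    and "cherednik_involution R Rp k \<sigma>"
    and "cherednik_projection R Rp k \<pi>"
    and "invariant_form R \<rho> form"
    and "v \<noteq> 0"
    and "orthonormal_basis R z"
  shows "finite_dimensional (simple_quotient R Rp k \<rho>) \<longleftrightarrow>
    (\<exists>m::nat. verma_orbit R Rp k \<rho> v (op_mult (E_poly z ^ m))
       \<in> radical_grade R Rp k \<rho> \<sigma> \<pi> form v (2 * m))"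
proof -
  interpret verma_setup R Rp k z \<rho> \<sigma> \<pi> form v
    by unfold_locales (use assms in auto)
  show ?thesis by (rule finite_dimensional_iff)
qed

end
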